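(* Given a split graph $G$ and a partial order $\pi$ on $V(G)$, one can decide in time $O(|V(G)|\cdot|\pi|)$ whether there is an LBFS ordering of $G$ that is a linear extension of $\pi$.
   Context: Graphs are finite, simple, undirected, connected. A split graph is a graph whose vertex set can be partitioned into a clique and an independent set. LBFS orderings: labels (sets of positive integers) start empty; for $i=1,\dots,|V(G)|$ choose an unnumbered $v$ such that no unnumbered $y$ has $\mathrm{label}(v)\prec\mathrm{label}(y)$, where $S\prec T$ iff $S\subsetneq T$ or $\min(S\setminus T)>\min(T\setminus S)$; set $\sigma(i)=v$ and add $i$ to the labels of unnumbered neighbors of $v$. A linear extension of $\pi$ is an ordering in which $x$ precedes $y$ whenever $(x,y)\in\pi$, $x\ne y$. $|\pi|$ is the number of pairs of $\pi$ (including reflexive pairs). *)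

theory Defs
  imports "Graph_Theory.Pair_Digraph" "Graph_Theory.Digraph_Component"
begin

section \<open>Split graphs\<close>

text \<open>
  A finite simple undirected graph is a \<^locale>\<open>pair_graph\<close>: a finite vertex set together with
  a symmetric, loop-free set of arcs, each undirected edge being present in both directions.
  Either part of the partition of a split graph may be empty.
\<close>

definition is_clique :: "'a pair_pre_digraph \<Rightarrow> 'a set \<Rightarrow> bool" where
  "is_clique G K \<longleftrightarrow> K \<subseteq> pverts G \<and> (\<forall>u\<in>K. \<forall>v\<in>K. u \<noteq> v \<longrightarrow> (u, v) \<in> parcs G)"

definition is_independent :: "'a pair_pre_digraph \<Rightarrow> 'a set \<Rightarrow> bool" where
  "is_independent G I \<longleftrightarrow> I \<subseteq> pverts G \<and> (\<forall>u\<in>I. \<forall>v\<in>I. (u, v) \<notin> parcs G)"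

definition split_graph :: "'a pair_pre_digraph \<Rightarrow> bool" where
  "split_graph G \<longleftrightarrow>
     (\<exists>K I. K \<union> I = pverts G \<and> K \<inter> I = {} \<and> is_clique G K \<and> is_independent G I)"


section \<open>LBFS orderings and linear extensions\<close>

text \<open>
  \<^const>\<open>Min\<close> is meaningless on the empty set; if one label contains the other, only the
  first disjunct may decide.
\<close>

definition label_less :: "nat set \<Rightarrow> nat set \<Rightarrow> bool" where
  "label_less S T \<longleftrightarrow> S \<subset> T \<or> (S - T \<noteq> {} \<and> T - S \<noteq> {} \<and> Min (S - T) > Min (T - S))"

text \<open>
  \<open>lbfs_run G xs label\<close>: the search can number the vertices \<open>xs\<close>, in this order, and then has
  the given labels. The list index of a vertex is its number minus one.
\<close>

inductive lbfs_run :: "'a pair_pre_digraph \<Rightarrow> 'a list \<Rightarrow> ('a \<Rightarrow> nat set) \<Rightarrow> bool"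
  for G :: "'a pair_pre_digraph" where
  start: "lbfs_run G [] (\<lambda>_. {})"
| number: "\<lbrakk> lbfs_run G xs label;
             v \<in> pverts G - set xs;
             \<not> (\<exists>y \<in> pverts G - set xs. label_less (label v) (label y));
             i = length xs + 1;
             label' = (\<lambda>w. if w \<in> pverts G - set (xs @ [v]) \<and> (v, w) \<in> parcs G
                           then label w \<union> {i} else label w) \<rbrakk>
           \<Longrightarrow> lbfs_run G (xs @ [v]) label'"

definition lbfs_ordering :: "'a pair_pre_digraph \<Rightarrow> 'a list \<Rightarrow> bool" where
  "lbfs_ordering G \<sigma> \<longleftrightarrow> length \<sigma> = card (pverts G) \<and> (\<exists>label. lbfs_run G \<sigma> label)"

definition linear_extension :: "'a set \<Rightarrow> 'a rel \<Rightarrow> 'a list \<Rightarrow> bool" where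
  "linear_extension V r \<sigma> \<longleftrightarrow> distinct \<sigma> \<and> set \<sigma> = V \<and>
     (\<forall>x y. (x, y) \<in> r \<and> x \<noteq> y \<longrightarrow> (\<exists>i j. i < j \<and> j < length \<sigma> \<and> \<sigma> ! i = x \<and> \<sigma> ! j = y))"


section \<open>A word RAM\<close>

text \<open>
  Running time is measured on a random access machine presented as a while language over
  scalar variables and zero-initialised arrays with indirect addressing; a program mentions only
  finitely many of both. Every value, address and intermediate result must be smaller than the
  bound \<open>B\<close> (a word of \<open>log B\<close> bits): evaluation that would exceed it gets stuck. Each assignment
  and each test costs one unit; expressions have constant size for a fixed program, so this is
  the usual uniform cost up to a constant factor.
\<close>

type_synonym vname = string

datatype aexp =
    Const nat
  | Var vname
  | Read vname aexp
  | Plus aexp aexp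
  | Minus aexp aexp
  | Times aexp aexp

datatype bexp =
    Less aexp aexp
  | Equal aexp aexp
  | Neg bexp
  | Conj bexp bexp

datatype com =
    Skip
  | Assign vname aexp
  | Store vname aexp aexp
  | Seq com com
  | If bexp com com
  | While bexp com

record ram_state =
  vars :: "vname \<Rightarrow> nat"
  arrays :: "vname \<Rightarrow> nat \<Rightarrow> nat"

text \<open>\<open>Minus\<close> is truncated subtraction.\<close>

fun aval :: "aexp \<Rightarrow> ram_state \<Rightarrow> nat" where
  "aval (Const n) s = n"
| "aval (Var x) s = vars s x"
| "aval (Read a e) s = arrays s a (aval e s)"
| "aval (Plus e f) s = aval e s + aval f s"
| "aval (Minus e f) s = aval e s - aval f s"
| "aval (Times e f) s = aval e s * aval f s"

fun bval :: "bexp \<Rightarrow> ram_state \<Rightarrow> bool" where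
  "bval (Less e f) s \<longleftrightarrow> aval e s < aval f s"
| "bval (Equal e f) s \<longleftrightarrow> aval e s = aval f s"
| "bval (Neg b) s \<longleftrightarrow> \<not> bval b s"
| "bval (Conj b c) s \<longleftrightarrow> bval b s \<and> bval c s"

fun afits :: "nat \<Rightarrow> aexp \<Rightarrow> ram_state \<Rightarrow> bool" where
  "afits B (Const n) s \<longleftrightarrow> n < B"
| "afits B (Var x) s \<longleftrightarrow> vars s x < B"
| "afits B (Read a e) s \<longleftrightarrow> afits B e s \<and> arrays s a (aval e s) < B"
| "afits B (Plus e f) s \<longleftrightarrow> afits B e s \<and> afits B f s \<and> aval e s + aval f s < B"
| "afits B (Minus e f) s \<longleftrightarrow> afits B e s \<and> afits B f s"
| "afits B (Times e f) s \<longleftrightarrow> afits B e s \<and> afits B f s \<and> aval e s * aval f s < B"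

fun bfits :: "nat \<Rightarrow> bexp \<Rightarrow> ram_state \<Rightarrow> bool" where
  "bfits B (Less e f) s \<longleftrightarrow> afits B e s \<and> afits B f s"
| "bfits B (Equal e f) s \<longleftrightarrow> afits B e s \<and> afits B f s"
| "bfits B (Neg b) s \<longleftrightarrow> bfits B b s"
| "bfits B (Conj b c) s \<longleftrightarrow> bfits B b s \<and> bfits B c s"

text \<open>\<open>runs B c s t s'\<close>: with word bound \<open>B\<close>, command \<open>c\<close> started in \<open>s\<close> halts after exactly
  \<open>t\<close> steps in \<open>s'\<close>.\<close>

inductive runs :: "nat \<Rightarrow> com \<Rightarrow> ram_state \<Rightarrow> nat \<Rightarrow> ram_state \<Rightarrow> bool"
  for B :: nat where
  skip: "runs B Skip s 1 s"
| assign: "afits B e s \<Longrightarrow> runs B (Assign x e) s 1 (s\<lparr>vars := (vars s)(x := aval e s)\<rparr>)"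
| store: "\<lbrakk> afits B e s; afits B f s \<rbrakk>
    \<Longrightarrow> runs B (Store a e f) s 1
          (s\<lparr>arrays := (arrays s)(a := (arrays s a)(aval e s := aval f s))\<rparr>)"
| seq: "\<lbrakk> runs B c s t s'; runs B d s' t' s'' \<rbrakk> \<Longrightarrow> runs B (Seq c d) s (t + t') s''"
| if_true: "\<lbrakk> bfits B b s; bval b s; runs B c s t s' \<rbrakk> \<Longrightarrow> runs B (If b c d) s (1 + t) s'"
| if_false: "\<lbrakk> bfits B b s; \<not> bval b s; runs B d s t s' \<rbrakk> \<Longrightarrow> runs B (If b c d) s (1 + t) s'"
| while_false: "\<lbrakk> bfits B b s; \<not> bval b s \<rbrakk> \<Longrightarrow> runs B (While b c) s 1 s"
| while_true: "\<lbrakk> bfits B b s; bval b s; runs B c s t s'; runs B (While b c) s' t' s'' \<rbrakk>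
    \<Longrightarrow> runs B (While b c) s (1 + t + t') s''"

inductive_cases runs_SkipE: "runs B Skip s t s'"
inductive_cases runs_AssignE: "runs B (Assign x e) s t s'"
inductive_cases runs_StoreE: "runs B (Store a e f) s t s'"
inductive_cases runs_SeqE: "runs B (Seq c d) s t s'"
inductive_cases runs_IfE: "runs B (If b c d) s t s'"
inductive_cases runs_WhileE: "runs B (While b c) s t s'"

lemma runs_deterministic:
  "runs B c s t s' \<Longrightarrow> runs B c s u s'' \<Longrightarrow> t = u \<and> s' = s''"
proof (induction arbitrary: u s'' rule: runs.induct)
  case (skip s)
  then show ?case by (rule runs_SkipE) simp
next
  case (assign e s x)
  from assign.prems show ?case by (rule runs_AssignE) simp
next
  case (store e s f a)
  from store.prems show ?case by (rule runs_StoreE) simp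
next
  case (seq c s t s' d t' s1)
  from seq.prems show ?case
  proof (rule runs_SeqE)
    fix t1 r t2
    assume "u = t1 + t2" and 1: "runs B c s t1 r" and 2: "runs B d r t2 s''"
    with seq.IH(1)[OF 1] have "s' = r" "t = t1" by simp_all
    with seq.IH(2) 2 have "t' = t2 \<and> s1 = s''" by simp
    with \<open>u = t1 + t2\<close> \<open>t = t1\<close> show ?thesis by simp
  qed
next
  case (if_true b s c t s' d)
  from if_true.prems show ?case
  proof (rule runs_IfE)
    fix t1
    assume "u = Suc t1" "runs B c s t1 s''"
    with if_true.IH show ?thesis by simp
  qed (use if_true.hyps in simp_all)
next
  case (if_false b s d t s' c)
  from if_false.prems show ?case
  proof (rule runs_IfE)
    fix t1
    assume "u = Suc t1" "runs B d s t1 s''"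
    with if_false.IH show ?thesis by simp
  qed (use if_false.hyps in simp_all)
next
  case (while_false b s c)
  from while_false.prems show ?case
    by (rule runs_WhileE) (use while_false.hyps in simp_all)
next
  case (while_true b s c t s' t' s1)
  from while_true.prems show ?case
  proof (rule runs_WhileE)
    fix t1 r t2
    assume "u = Suc (t1 + t2)" and 1: "runs B c s t1 r" and 2: "runs B (While b c) r t2 s''"
    with while_true.IH(1)[OF 1] have "s' = r" "t = t1" by simp_all
    with while_true.IH(2) 2 have "t' = t2 \<and> s1 = s''" by simp
    with \<open>u = Suc (t1 + t2)\<close> \<open>t = t1\<close> show ?thesis by simp
  qed (use while_true.hyps in simp_all)
qed

definition decides_within :: "nat \<Rightarrow> com \<Rightarrow> ram_state \<Rightarrow> nat \<Rightarrow> bool \<Rightarrow> bool" where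
  "decides_within B P s T answer \<longleftrightarrow>
     (\<exists>t s'. runs B P s t s' \<and> t \<le> T \<and> vars s' ''answer'' = (if answer then 1 else 0))"


section \<open>Input encoding\<close>

text \<open>
  Vertices are the numbers below \<open>n\<close>. The graph is given by adjacency lists and the relation by
  a list of its pairs (reflexive ones included), in arbitrary order. In memory the adjacency lists
  are concatenated into the array \<open>nbr\<close>, the list of \<open>v\<close> occupying the positions from \<open>off v\<close>
  (inclusive) to \<open>off (v + 1)\<close> (exclusive).
\<close>

definition adjacency_lists :: "nat pair_pre_digraph \<Rightarrow> nat list list \<Rightarrow> bool" where
  "adjacency_lists G adj \<longleftrightarrow> length adj = card (pverts G) \<and>
     (\<forall>v < length adj. distinct (adj ! v) \<and> set (adj ! v) = {w. (v, w) \<in> parcs G})"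

definition list_array :: "nat list \<Rightarrow> nat \<Rightarrow> nat" where
  "list_array xs i = (if i < length xs then xs ! i else 0)"

definition input_state :: "nat list list \<Rightarrow> (nat \<times> nat) list \<Rightarrow> ram_state" where
  "input_state adj ps = \<lparr>
     vars = (\<lambda>_. 0)(''n'' := length adj, ''p'' := length ps),
     arrays = (\<lambda>_ _. 0)(
       ''off'' := list_array (map (\<lambda>v. length (concat (take v adj))) [0..<length adj + 1]),
       ''nbr'' := list_array (concat adj),
       ''fst'' := list_array (map fst ps),
       ''snd'' := list_array (map snd ps)) \<rparr>"

end

theory Submission
  imports Defs
begin

text \<open>
  Let \<open>K\<close> be the clique and \<open>N x\<close> the neighbourhood of an independent vertex \<open>x\<close>. If \<open>x\<close> is numbered
  while a clique vertex is still missing, its label is the set of all clique numbers so far; hence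
  the numbered clique vertices lie in \<open>N x\<close>, and the rest of \<open>N x\<close> has to follow immediately. After
  the last clique vertex the labels only depend on the order of \<open>K\<close>, and the independent vertices
  are numbered by decreasing neighbourhoods in the lexicographic order.

  An independent vertex \<open>x\<close> is premature, i.e. forced to precede some clique vertex, if it is below
  one in \<open>\<pi>\<close>, or (weakly) below an independent \<open>y\<close> for which \<open>\<pi>\<close> contains a pair \<open>(y, z)\<close> with
  \<open>z\<close> independent and \<open>N y\<close> a proper subset of \<open>N z\<close>. All other independent vertices may be moved behind the clique, where a pair \<open>(x, y)\<close> of \<open>\<pi>\<close>
  requires that the first clique vertex in the symmetric difference of \<open>N x\<close> and \<open>N y\<close>, if any,
  belongs to \<open>N x\<close>. A premature \<open>x\<close> that is not below one of its own neighbours may be moved right behind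
  \<open>N x\<close>, and at most one vertex of each neighbourhood can be numbered before that neighbourhood is
  complete. What remains is to order the clique and the premature independent vertices subject
  to plain precedences and to constraints of the form ``some element of \<open>N x - N y\<close> comes before
  \<open>c\<close>''. Both kinds are monotone: numbering more vertices never makes a vertex unavailable. Hence the
  greedy strategy decides the problem. With counters of unsatisfied constraints, each pair of \<open>\<pi>\<close>
  costs \<open>O(n)\<close> once, when its constraint is satisfied, and \<open>O(1)\<close> in each of the \<open>2 n\<close> rounds.
\<close>

section \<open>LBFS orderings\<close>

text \<open>The requirement that the rest of \<open>N x\<close> follows \<open>x\<close> immediately
  is not monotone in itself. A virtual node per premature vertex turns it into plain precedences:
  \<open>x\<close> and \<open>N x\<close> before the node, all other clique vertices behind it.
  Neighbourhoods of premature vertices form a chain: if \<open>x\<close> is numbered before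
  \<open>y\<close>, then \<open>N x\<close> is numbered before \<open>y\<close>, and every clique
  vertex numbered before \<open>y\<close> lies in \<open>N y\<close>. So comparing degrees replaces
  comparing sets, and the precedences among the 2n nodes can be tabulated in quadratic time.
  Reflexivity gives n \<le> |\<pi>|, so quadratic preprocessing (finding K, filling the matrices)
  stays within O(n |\<pi>|). All constraints are strict inequalities between numbers; ties are
  broken by vertex number at the end, so no linear order has to be maintained.\<close>

lemma label_less_iff:
  assumes "finite S" "finite T"
  shows "label_less S T \<longleftrightarrow> (\<exists>m\<in>T - S. \<forall>i<m. i \<in> S \<longleftrightarrow> i \<in> T)"
proof
  assume l: "label_less S T"
  then have ne: "T - S \<noteq> {}" unfolding label_less_def by auto
  define m where "m = Min (T - S)"
  have m: "m \<in> T - S" unfolding m_def using ne assms by (intro Min_in) auto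
  have min: "i \<notin> T - S" if "i < m" for i
  proof
    assume "i \<in> T - S"
    then have "m \<le> i" unfolding m_def using assms by (intro Min_le) auto
    with that show False by simp
  qed
  have "i \<notin> S - T" if "i < m" for i
  proof
    assume i: "i \<in> S - T"
    then have "Min (S - T) > m" using l unfolding label_less_def m_def by auto
    moreover have "Min (S - T) \<le> i" using i assms by (intro Min_le) auto
    ultimately show False using that by simp
  qed
  with m min show "\<exists>m\<in>T - S. \<forall>i<m. i \<in> S \<longleftrightarrow> i \<in> T" by blast
next
  assume "\<exists>m\<in>T - S. \<forall>i<m. i \<in> S \<longleftrightarrow> i \<in> T"
  then obtain m where m: "m \<in> T - S" "\<forall>i<m. i \<in> S \<longleftrightarrow> i \<in> T" by blast
  show "label_less S T"
  proof (cases "S - T = {}")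
    case True
    then show ?thesis using m unfolding label_less_def by auto
  next
    case False
    have "Min (T - S) \<le> m" using m assms by (intro Min_le) auto
    moreover have "Min (S - T) \<in> S - T" using False assms by (intro Min_in) auto
    then have "Min (S - T) > m" using m by (metis DiffD1 DiffD2 linorder_neqE_nat)
    ultimately show ?thesis using m False unfolding label_less_def by auto
  qed
qed

text \<open>In a run the label of a vertex freezes when the vertex is numbered, here it does not;
  the two are therefore compared on unnumbered vertices only. \<open>Suc\<close> turns a list index
  into a number.\<close>

definition lbfs_label :: "'a rel \<Rightarrow> 'a list \<Rightarrow> nat \<Rightarrow> 'a \<Rightarrow> nat set" where
  "lbfs_label A xs k w = Suc ` {i. i < k \<and> (xs ! i, w) \<in> A}"

lemma finite_lbfs_label [simp]: "finite (lbfs_label A xs k w)"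
  by (simp add: lbfs_label_def)

lemma lbfs_label_append: "k \<le> length xs \<Longrightarrow> lbfs_label A (xs @ ys) k w = lbfs_label A xs k w"
  unfolding lbfs_label_def by (rule image_cong) (auto simp: nth_append)

lemma lbfs_label_snoc:
  "lbfs_label A (xs @ [v]) (Suc (length xs)) w =
     lbfs_label A xs (length xs) w \<union> (if (v, w) \<in> A then {Suc (length xs)} else {})"
proof -
  have "{i. i < Suc (length xs) \<and> ((xs @ [v]) ! i, w) \<in> A} =
      {i. i < length xs \<and> (xs ! i, w) \<in> A} \<union> (if (v, w) \<in> A then {length xs} else {})"
    by (auto simp: nth_append)
  then show ?thesis unfolding lbfs_label_def by auto
qed

text \<open>A run with the labels eliminated: each choice is judged by labels recomputed from the
  vertices before it.\<close>

definition lbfs_prefix :: "'a set \<Rightarrow> 'a rel \<Rightarrow> 'a list \<Rightarrow> bool" where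
  "lbfs_prefix V A xs \<longleftrightarrow> distinct xs \<and> set xs \<subseteq> V \<and>
     (\<forall>k<length xs. \<forall>y\<in>V - set (take k xs).
        \<not> label_less (lbfs_label A xs k (xs ! k)) (lbfs_label A xs k y))"

lemma lbfs_prefix_snoc:
  "lbfs_prefix V A (xs @ [v]) \<longleftrightarrow> lbfs_prefix V A xs \<and> v \<in> V - set xs \<and>
     (\<forall>y\<in>V - set xs. \<not> label_less (lbfs_label A xs (length xs) v) (lbfs_label A xs (length xs) y))"
proof -
  have all: "(\<forall>k<Suc l. Q k) \<longleftrightarrow> (\<forall>k<l. Q k) \<and> Q l" for Q and l :: nat
    by (auto simp: less_Suc_eq)
  have "(\<forall>k<length xs. \<forall>y\<in>V - set (take k (xs @ [v])).
        \<not> label_less (lbfs_label A (xs @ [v]) k ((xs @ [v]) ! k)) (lbfs_label A (xs @ [v]) k y)) \<longleftrightarrow>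
      (\<forall>k<length xs. \<forall>y\<in>V - set (take k xs).
        \<not> label_less (lbfs_label A xs k (xs ! k)) (lbfs_label A xs k y))"
    by (simp add: nth_append lbfs_label_append)
  then show ?thesis
    unfolding lbfs_prefix_def length_append_singleton all
    by (auto simp: lbfs_label_append)
qed

lemma lbfs_run_imp_prefix:
  "lbfs_run G xs label \<Longrightarrow> lbfs_prefix (pverts G) (parcs G) xs \<and>
     (\<forall>w\<in>pverts G - set xs. label w = lbfs_label (parcs G) xs (length xs) w)"
proof (induction rule: lbfs_run.induct)
  case start
  then show ?case by (simp add: lbfs_prefix_def lbfs_label_def)
next
  case (number xs label v i label')
  then show ?case by (auto simp: lbfs_prefix_snoc lbfs_label_snoc)
qed

lemma lbfs_prefix_imp_run:
  "lbfs_prefix (pverts G) (parcs G) xs \<Longrightarrow> \<exists>label. lbfs_run G xs label"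
proof (induction xs rule: rev_induct)
  case Nil
  then show ?case using lbfs_run.start by blast
next
  case (snoc v xs)
  then obtain label where l: "lbfs_run G xs label" by (auto simp: lbfs_prefix_snoc)
  have "lbfs_run G (xs @ [v]) (\<lambda>w. if w \<in> pverts G - set (xs @ [v]) \<and> (v, w) \<in> parcs G
     then label w \<union> {length xs + 1} else label w)"
    by (rule lbfs_run.number[OF l])
       (use snoc.prems lbfs_run_imp_prefix[OF l] in \<open>auto simp: lbfs_prefix_snoc\<close>)
  then show ?case by blast
qed

text \<open>The four-vertex characterisation of LBFS orderings, in a weak form: the earlier vertex
  may distinguish the two later ones in either direction. \<open>first_difference\<close> recovers
  the direction.\<close>

definition lbfs_condition :: "'a rel \<Rightarrow> 'a list \<Rightarrow> bool" where
  "lbfs_condition A \<sigma> \<longleftrightarrow> (\<forall>m k j. m < k \<and> k < j \<and> j < length \<sigma> \<and>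
     (\<sigma> ! m, \<sigma> ! j) \<in> A \<and> (\<sigma> ! m, \<sigma> ! k) \<notin> A \<longrightarrow>
       (\<exists>i<m. (\<sigma> ! i, \<sigma> ! j) \<in> A \<longleftrightarrow> (\<sigma> ! i, \<sigma> ! k) \<notin> A))"

lemma lbfs_label_less_iff:
  "label_less (lbfs_label A xs k u) (lbfs_label A xs k v) \<longleftrightarrow>
     (\<exists>m<k. (xs ! m, v) \<in> A \<and> (xs ! m, u) \<notin> A \<and> (\<forall>i<m. (xs ! i, u) \<in> A \<longleftrightarrow> (xs ! i, v) \<in> A))"
proof -
  have mem: "i \<in> lbfs_label A xs k w \<longleftrightarrow> i \<noteq> 0 \<and> i - 1 < k \<and> (xs ! (i - 1), w) \<in> A" for i w
    by (cases i) (auto simp: lbfs_label_def)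
  show ?thesis
    unfolding label_less_iff[OF finite_lbfs_label finite_lbfs_label]
  proof (intro iffI; elim bexE exE conjE)
    fix m
    assume m: "m \<in> lbfs_label A xs k v - lbfs_label A xs k u"
      and e: "\<forall>i<m. (i \<in> lbfs_label A xs k u) = (i \<in> lbfs_label A xs k v)"
    show "\<exists>m<k. (xs ! m, v) \<in> A \<and> (xs ! m, u) \<notin> A \<and> (\<forall>i<m. (xs ! i, u) \<in> A \<longleftrightarrow> (xs ! i, v) \<in> A)"
    proof (intro exI[of _ "m - 1"] conjI allI impI)
      fix i assume "i < m - 1"
      then show "((xs ! i, u) \<in> A) = ((xs ! i, v) \<in> A)"
        using e[rule_format, of "Suc i"] m by (auto simp: mem)
    qed (use m in \<open>auto simp: mem\<close>)
  next
    fix m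
    assume "m < k" "(xs ! m, v) \<in> A" "(xs ! m, u) \<notin> A"
      "\<forall>i<m. (xs ! i, u) \<in> A \<longleftrightarrow> (xs ! i, v) \<in> A"
    then show "\<exists>m\<in>lbfs_label A xs k v - lbfs_label A xs k u.
        \<forall>i<m. (i \<in> lbfs_label A xs k u) = (i \<in> lbfs_label A xs k v)"
      by (intro bexI[of _ "Suc m"]) (auto simp: mem)
  qed
qed

text \<open>A duplicate-free prefix of length \<open>card (pverts G)\<close> exhausts the vertices.
  A choice is wrong iff the first earlier vertex distinguishing the chosen one from some later one
  is adjacent to the later one, which is the negation of \<open>lbfs_condition\<close>.\<close>

lemma lbfs_ordering_iff:
  assumes "finite (pverts G)"
  shows "lbfs_ordering G \<sigma> \<longleftrightarrow>
    distinct \<sigma> \<and> set \<sigma> = pverts G \<and> lbfs_condition (parcs G) \<sigma>"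
proof -
  have "lbfs_ordering G \<sigma> \<longleftrightarrow> length \<sigma> = card (pverts G) \<and> lbfs_prefix (pverts G) (parcs G) \<sigma>"
    unfolding lbfs_ordering_def using lbfs_run_imp_prefix lbfs_prefix_imp_run by blast
  also have "\<dots> \<longleftrightarrow> distinct \<sigma> \<and> set \<sigma> = pverts G \<and> lbfs_prefix (pverts G) (parcs G) \<sigma>"
    using card_subset_eq[OF assms, of "set \<sigma>"] distinct_card[of \<sigma>]
    unfolding lbfs_prefix_def by auto
  also have "\<dots> \<longleftrightarrow> distinct \<sigma> \<and> set \<sigma> = pverts G \<and> lbfs_condition (parcs G) \<sigma>"
  proof (intro conj_cong refl)
    assume d: "distinct \<sigma>" and V: "set \<sigma> = pverts G"
    have rest: "pverts G - set (take k \<sigma>) = (\<lambda>j. \<sigma> ! j) ` {k..<length \<sigma>}" if "k < length \<sigma>" for k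
    proof -
      have "pverts G = set (take k \<sigma>) \<union> set (drop k \<sigma>)"
        using V by (metis append_take_drop_id set_append)
      moreover have "set (take k \<sigma>) \<inter> set (drop k \<sigma>) = {}"
        using d by (rule set_take_disj_set_drop_if_distinct) simp
      ultimately have "pverts G - set (take k \<sigma>) = set (drop k \<sigma>)"
        by blast
      also have "\<dots> = (\<lambda>j. \<sigma> ! j) ` {k..<length \<sigma>}"
      proof -
        have "drop k \<sigma> = map (\<lambda>j. \<sigma> ! j) [k..<length \<sigma>]"
          by (rule nth_equalityI) auto
        then show ?thesis by simp
      qed
      finally show ?thesis .
    qed
    have "lbfs_prefix (pverts G) (parcs G) \<sigma> \<longleftrightarrow>
      (\<forall>k<length \<sigma>. \<forall>j. k \<le> j \<and> j < length \<sigma> \<longrightarrow>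
        \<not> label_less (lbfs_label (parcs G) \<sigma> k (\<sigma> ! k)) (lbfs_label (parcs G) \<sigma> k (\<sigma> ! j)))"
      unfolding lbfs_prefix_def using d V by (auto simp: rest)
    also have "\<dots> \<longleftrightarrow> lbfs_condition (parcs G) \<sigma>" (is "?lhs \<longleftrightarrow> ?rhs")
    proof
      assume l: ?lhs
      show ?rhs
        unfolding lbfs_condition_def
      proof (intro allI impI, elim conjE)
        fix m k j
        assume "m < k" "k < j" "j < length \<sigma>" "(\<sigma> ! m, \<sigma> ! j) \<in> parcs G" "(\<sigma> ! m, \<sigma> ! k) \<notin> parcs G"
        then show "\<exists>i<m. (\<sigma> ! i, \<sigma> ! j) \<in> parcs G \<longleftrightarrow> (\<sigma> ! i, \<sigma> ! k) \<notin> parcs G"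
          using l[rule_format, of k j] unfolding lbfs_label_less_iff by auto
      qed
    next
      assume r: ?rhs
      show ?lhs
      proof (intro allI impI notI, elim conjE)
        fix k j
        assume kj: "k < length \<sigma>" "k \<le> j" "j < length \<sigma>"
          and "label_less (lbfs_label (parcs G) \<sigma> k (\<sigma> ! k)) (lbfs_label (parcs G) \<sigma> k (\<sigma> ! j))"
        then obtain m where m: "m < k" "(\<sigma> ! m, \<sigma> ! j) \<in> parcs G" "(\<sigma> ! m, \<sigma> ! k) \<notin> parcs G"
            "\<forall>i<m. (\<sigma> ! i, \<sigma> ! k) \<in> parcs G \<longleftrightarrow> (\<sigma> ! i, \<sigma> ! j) \<in> parcs G"
          unfolding lbfs_label_less_iff by blast
        \<comment> \<open>For \<open>k = j\<close> the two labels coincide and cannot be strictly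
          ordered.\<close>
        then have "k < j" using kj by (cases "k = j") auto
        with r m kj show False unfolding lbfs_condition_def by blast
      qed
    qed
    finally show "lbfs_prefix (pverts G) (parcs G) \<sigma> \<longleftrightarrow> lbfs_condition (parcs G) \<sigma>" .
  qed
  finally show ?thesis .
qed

section \<open>LBFS orderings of split graphs extending a partial order\<close>

text \<open>Positions need only be injective and may have gaps, so an ordering can be given by an
  arithmetic formula instead of a list.\<close>

definition lbfs_pos :: "'a set \<Rightarrow> 'a rel \<Rightarrow> ('a \<Rightarrow> nat) \<Rightarrow> bool" where
  "lbfs_pos V A pos \<longleftrightarrow> inj_on pos V \<and> (\<forall>a\<in>V. \<forall>b\<in>V. \<forall>c\<in>V.
     pos a < pos b \<and> pos b < pos c \<and> (a, c) \<in> A \<and> (a, b) \<notin> A \<longrightarrow>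
       (\<exists>i\<in>V. pos i < pos a \<and> ((i, c) \<in> A \<longleftrightarrow> (i, b) \<notin> A)))"

lemma lbfs_pos_of_list:
  assumes "distinct \<sigma>" "set \<sigma> = V" "lbfs_condition A \<sigma>" "linear_extension V r \<sigma>"
  shows "\<exists>pos. lbfs_pos V A pos \<and> (\<forall>u v. (u, v) \<in> r \<and> u \<noteq> v \<longrightarrow> pos u < pos v)"
proof -
  define pos where "pos = inv_into {..<length \<sigma>} (\<lambda>i. \<sigma> ! i)"
  have inj: "inj_on (\<lambda>i. \<sigma> ! i) {..<length \<sigma>}"
    using assms(1) by (auto simp: inj_on_def nth_eq_iff_index_eq)
  have img: "(\<lambda>i. \<sigma> ! i) ` {..<length \<sigma>} = V"
    using assms(2) by (auto simp: set_conv_nth)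
  have pos_nth: "pos (\<sigma> ! i) = i" if "i < length \<sigma>" for i
    unfolding pos_def using inj that by (intro inv_into_f_f) auto
  have nth_pos: "\<sigma> ! pos v = v \<and> pos v < length \<sigma>" if "v \<in> V" for v
  proof -
    have v: "v \<in> (\<lambda>i. \<sigma> ! i) ` {..<length \<sigma>}" using that img by simp
    show ?thesis using f_inv_into_f[OF v] inv_into_into[OF v] unfolding pos_def by simp
  qed
  have "inj_on pos V" by (rule inj_on_inverseI[of _ "\<lambda>i. \<sigma> ! i"]) (use nth_pos in blast)
  moreover have "\<exists>i\<in>V. pos i < pos a \<and> ((i, c) \<in> A \<longleftrightarrow> (i, b) \<notin> A)"
    if abc: "a \<in> V" "b \<in> V" "c \<in> V" "pos a < pos b" "pos b < pos c" "(a, c) \<in> A" "(a, b) \<notin> A" for a b c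
  proof -
    obtain i where "i < pos a" "(\<sigma> ! i, c) \<in> A \<longleftrightarrow> (\<sigma> ! i, b) \<notin> A"
      using assms(3)[unfolded lbfs_condition_def, rule_format, of "pos a" "pos b" "pos c"] abc
        nth_pos[OF \<open>a \<in> V\<close>] nth_pos[OF \<open>b \<in> V\<close>] nth_pos[OF \<open>c \<in> V\<close>]
      by auto
    moreover then have "i < length \<sigma>" using nth_pos[OF \<open>a \<in> V\<close>] by simp
    ultimately show ?thesis using pos_nth img by (intro bexI[of _ "\<sigma> ! i"]) auto
  qed
  moreover have "pos u < pos v" if uv: "(u, v) \<in> r" "u \<noteq> v" for u v
  proof -
    obtain i j where "i < j" "j < length \<sigma>" "\<sigma> ! i = u" "\<sigma> ! j = v"
      using assms(4) uv unfolding linear_extension_def by blast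
    then show ?thesis using pos_nth[of i] pos_nth[of j] by simp
  qed
  ultimately show ?thesis unfolding lbfs_pos_def by blast
qed

text \<open>Sorting by \<open>pos\<close> gives the list; injectivity makes the sorted positions
  strictly increasing.\<close>

lemma list_of_lbfs_pos:
  fixes pos :: "nat \<Rightarrow> nat"
  assumes lp: "lbfs_pos {..<n} A pos" and r: "r \<subseteq> {..<n} \<times> {..<n}"
    and ext: "\<forall>u v. (u, v) \<in> r \<and> u \<noteq> v \<longrightarrow> pos u < pos v"
  shows "\<exists>\<sigma>. distinct \<sigma> \<and> set \<sigma> = {..<n} \<and> lbfs_condition A \<sigma> \<and> linear_extension {..<n} r \<sigma>"
proof -
  define \<sigma> where "\<sigma> = sort_key pos [0..<n]"
  have d: "distinct \<sigma>" and V: "set \<sigma> = {..<n}" unfolding \<sigma>_def by auto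
  then have len: "length \<sigma> = n" using distinct_card by fastforce
  have inj: "inj_on pos {..<n}" using lp unfolding lbfs_pos_def by blast
  have nth: "\<sigma> ! i < n" if "i < n" for i using V len that nth_mem by fastforce
  have le: "pos (\<sigma> ! i) \<le> pos (\<sigma> ! j)" if "i < j" "j < n" for i j
    using sorted_nth_mono[of "map pos \<sigma>" i j] that len unfolding \<sigma>_def by simp
  have mono: "pos (\<sigma> ! i) < pos (\<sigma> ! j)" if "i < j" "j < n" for i j
  proof -
    have "\<sigma> ! i \<noteq> \<sigma> ! j" using d that len by (simp add: nth_eq_iff_index_eq)
    then have "pos (\<sigma> ! i) \<noteq> pos (\<sigma> ! j)"
      using inj nth that by (auto simp: inj_on_def)
    with le[OF that] show ?thesis by simp
  qed
  have less: "i < j" if "pos (\<sigma> ! i) < pos (\<sigma> ! j)" "i < n" "j < n" for i j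
    using mono[of j i] that by (metis less_asym linorder_neqE_nat order_less_irrefl)
  have ex: "\<exists>i<n. \<sigma> ! i = v" if "v < n" for v using V len that by (metis in_set_conv_nth lessThan_iff)
  have "lbfs_condition A \<sigma>"
    unfolding lbfs_condition_def
  proof (intro allI impI, elim conjE)
    fix m k j
    assume *: "m < k" "k < j" "j < length \<sigma>" "(\<sigma> ! m, \<sigma> ! j) \<in> A" "(\<sigma> ! m, \<sigma> ! k) \<notin> A"
    then have "\<exists>i\<in>{..<n}. pos i < pos (\<sigma> ! m) \<and> ((i, \<sigma> ! j) \<in> A \<longleftrightarrow> (i, \<sigma> ! k) \<notin> A)"
      using lp mono nth len unfolding lbfs_pos_def by simp
    then obtain v where v: "v < n" "pos v < pos (\<sigma> ! m)" "(v, \<sigma> ! j) \<in> A \<longleftrightarrow> (v, \<sigma> ! k) \<notin> A"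
      by auto
    then obtain i where i: "i < n" "\<sigma> ! i = v" using ex by blast
    then have "i < m" using less[of i m] v * len by auto
    with i v show "\<exists>i<m. (\<sigma> ! i, \<sigma> ! j) \<in> A \<longleftrightarrow> (\<sigma> ! i, \<sigma> ! k) \<notin> A" by blast
  qed
  moreover have "linear_extension {..<n} r \<sigma>"
    unfolding linear_extension_def
  proof (intro conjI d V allI impI, elim conjE)
    fix x y assume xy: "(x, y) \<in> r" "x \<noteq> y"
    then obtain i j where "i < n" "\<sigma> ! i = x" "j < n" "\<sigma> ! j = y"
      using ex r by (metis SigmaD1 SigmaD2 lessThan_iff subsetD)
    then show "\<exists>i j. i < j \<and> j < length \<sigma> \<and> \<sigma> ! i = x \<and> \<sigma> ! j = y"
      using less ext xy len by metis
  qed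
  ultimately show ?thesis using d V by blast
qed

text \<open>\<open>k * n + u\<close> with \<open>u < n\<close> encodes a pair so that numerical
  order is lexicographic; all tie-breaking below rests on it.\<close>

lemma scaled_less:
  fixes k l n u v :: nat
  assumes "k < l" "u < n"
  shows "k * n + u < l * n + v"
proof -
  have "k * n + u < (k + 1) * n" using assms by simp
  also have "\<dots> \<le> l * n" using assms by (intro mult_le_mono1) simp
  finally show ?thesis by simp
qed

section \<open>The constraint system of a split graph with a fixed clique\<close>

locale split_instance =
  fixes n :: nat and A \<pi> :: "nat rel" and K :: "nat set"
  assumes arcs: "A \<subseteq> {..<n} \<times> {..<n}"
    and adj_sym: "(u, v) \<in> A \<Longrightarrow> (v, u) \<in> A"
    and adj_irrefl: "(u, u) \<notin> A"
    and K_subset: "K \<subseteq> {..<n}"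
    and clique: "u \<in> K \<Longrightarrow> v \<in> K \<Longrightarrow> u \<noteq> v \<Longrightarrow> (u, v) \<in> A"
    and indep: "(u, v) \<in> A \<Longrightarrow> u \<in> K \<or> v \<in> K"
    and po: "partial_order_on {..<n} \<pi>"
begin

definition nbs :: "nat \<Rightarrow> nat set" where "nbs x = {w. (w, x) \<in> A}"

definition dg :: "nat \<Rightarrow> nat" where "dg x = card (nbs x)"

definition ind :: "nat \<Rightarrow> bool" where "ind x \<longleftrightarrow> x < n \<and> x \<notin> K"

text \<open>Behind the complete clique a properly larger neighbourhood has the larger label,
  whatever the order of the clique. A pair (x, y) of \<open>\<pi>\<close> with
  \<open>nbs x \<subset> nbs y\<close> can thus only be respected by numbering \<open>x\<close>
  while the clique is incomplete.\<close>

definition base :: "nat \<Rightarrow> bool" where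
  "base x \<longleftrightarrow> ind x \<and>
     ((\<exists>c\<in>K. (x, c) \<in> \<pi>) \<or> (\<exists>y. ind y \<and> (x, y) \<in> \<pi> \<and> nbs x \<subset> nbs y))"

text \<open>\<open>M - K\<close> is the set of premature vertices.\<close>

definition M :: "nat set" where
  "M = K \<union> {z. ind z \<and> (\<exists>x. base x \<and> (z, x) \<in> \<pi>)}"

definition early :: "nat \<Rightarrow> bool" where
  "early x \<longleftrightarrow> ind x \<and> (\<exists>c\<in>nbs x. (x, c) \<in> \<pi>)"

text \<open>Precedence constraints between the vertices and virtual nodes: for \<open>x \<in> M - K\<close> the node
  \<open>n + x\<close> marks the moment from which \<open>x\<close> and all its neighbours are numbered.\<close>

definition edge :: "nat \<Rightarrow> nat \<Rightarrow> bool" where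
  "edge u v \<longleftrightarrow>
     (if u < n then
        if v < n then
          (u, v) \<in> \<pi> \<and> u \<noteq> v \<and> v \<in> M \<or> v \<in> M - K \<and> \<not> early v \<and> (u, v) \<in> A
        else v - n \<in> M - K \<and> (u = v - n \<or> (u, v - n) \<in> A)
      else v < n \<and> u - n \<in> M - K \<and>
        (v \<in> K \<and> (v, u - n) \<notin> A \<or> v \<in> M - K \<and> dg (u - n) < dg v))"

text \<open>The second clause says that the first vertex on which \<open>nbs x\<close> and
  \<open>nbs y\<close> differ belongs to \<open>nbs x\<close>; quantifying over all \<open>c\<close>
  avoids naming a first one and keeps the condition monotone. \<open>\<rho>\<close> may have
  ties.\<close>

definition admissible :: "(nat \<Rightarrow> nat) \<Rightarrow> bool" where
  "admissible \<rho> \<longleftrightarrow> (\<forall>u v. edge u v \<longrightarrow> \<rho> u < \<rho> v) \<and>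
     (\<forall>x y c. (x, y) \<in> \<pi> \<and> x \<notin> M \<and> c \<in> nbs y - nbs x \<longrightarrow> (\<exists>d\<in>nbs x - nbs y. \<rho> d < \<rho> c))"

text \<open>Vertices of \<open>M - K\<close> of equal degree will turn out to have the same neighbourhood.\<close>

definition unique_early :: bool where
  "unique_early \<longleftrightarrow> (\<forall>x y. early x \<and> early y \<and> dg x = dg y \<longrightarrow> x = y)"

lemma adj_less: "(u, v) \<in> A \<Longrightarrow> u < n \<and> v < n"
  using arcs by auto

lemma po_less: "(u, v) \<in> \<pi> \<Longrightarrow> u < n \<and> v < n"
  using po by (auto simp: partial_order_on_def preorder_on_def refl_on_def)

lemma po_trans: "(u, v) \<in> \<pi> \<Longrightarrow> (v, w) \<in> \<pi> \<Longrightarrow> (u, w) \<in> \<pi>"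
  using po unfolding partial_order_on_def preorder_on_def trans_def by blast

lemma po_antisym: "(u, v) \<in> \<pi> \<Longrightarrow> (v, u) \<in> \<pi> \<Longrightarrow> u = v"
  using po unfolding partial_order_on_def antisym_def by blast

lemma po_refl: "u < n \<Longrightarrow> (u, u) \<in> \<pi>"
  using po by (auto simp: partial_order_on_def preorder_on_def refl_on_def)

lemma M_less: "u \<in> M \<Longrightarrow> u < n"
  using K_subset by (auto simp: M_def ind_def)

lemma ind_nbs: "ind x \<Longrightarrow> w \<in> nbs x \<Longrightarrow> w \<in> K"
  using indep by (auto simp: ind_def nbs_def)

lemma finite_nbs: "finite (nbs x)"
  by (rule finite_subset[of _ "{..<n}"]) (use adj_less in \<open>auto simp: nbs_def\<close>)

lemma early_M: "early x \<Longrightarrow> x \<in> M - K"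
proof -
  assume "early x"
  then obtain c where "ind x" "c \<in> K" "(x, c) \<in> \<pi>" using ind_nbs unfolding early_def by blast
  then have "base x" "(x, x) \<in> \<pi>" using po_refl unfolding base_def ind_def by auto
  with \<open>ind x\<close> show ?thesis unfolding M_def ind_def by auto
qed

text \<open>A clique vertex \<open>v\<close> makes an independent \<open>u\<close> a
  \<open>base\<close> vertex, a premature \<open>v\<close> passes its status on by transitivity.
  Consequently a pair of \<open>\<pi>\<close> starting outside \<open>M\<close> also ends outside
  \<open>M\<close>, and both ends are independent.\<close>

lemma M_downclosed: "(u, v) \<in> \<pi> \<Longrightarrow> v \<in> M \<Longrightarrow> u \<in> M"
proof (cases "u \<in> K")
  case False
  assume uv: "(u, v) \<in> \<pi>" and v: "v \<in> M"
  have u: "ind u" using False po_less[OF uv] by (simp add: ind_def)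
  show "u \<in> M"
  proof (cases "v \<in> K")
    case True
    then have "base u" using u uv unfolding base_def by blast
    then show ?thesis using u po_refl unfolding M_def ind_def by blast
  next
    case False
    then show ?thesis using u uv v po_trans unfolding M_def by blast
  qed
qed (simp add: M_def)

section \<open>Necessity: an LBFS ordering extending \<pi> satisfies the constraints\<close>

context
  fixes pos :: "nat \<Rightarrow> nat"
  assumes lp: "lbfs_pos {..<n} A pos"
    and ext: "\<forall>u v. (u, v) \<in> \<pi> \<and> u \<noteq> v \<longrightarrow> pos u < pos v"
begin

lemma pos_neq: "u < n \<Longrightarrow> v < n \<Longrightarrow> u \<noteq> v \<Longrightarrow> pos u < pos v \<or> pos v < pos u"
  using lp unfolding lbfs_pos_def inj_on_def by (metis lessThan_iff nat_neq_iff)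

text \<open>\<open>lbfs_pos\<close> yields some earlier vertex distinguishing \<open>b\<close> and
  \<open>c\<close>. If it is adjacent to \<open>c\<close>, it is again a violation at a smaller
  position, so the descent has to end with a vertex adjacent to \<open>b\<close>.\<close>

lemma first_difference:
  assumes "b < n" "c < n" "pos b < pos c" "m < n" "pos m < pos b" "(m, c) \<in> A" "(m, b) \<notin> A"
  shows "\<exists>i<n. pos i < pos m \<and> (i, b) \<in> A \<and> (i, c) \<notin> A"
  using assms(4-7)
proof (induction "pos m" arbitrary: m rule: less_induct)
  case less
  have "\<exists>i\<in>{..<n}. pos i < pos m \<and> ((i, c) \<in> A \<longleftrightarrow> (i, b) \<notin> A)"
    using lp less.prems assms(1-3) unfolding lbfs_pos_def by blast
  then obtain i where i: "i < n" "pos i < pos m" "(i, c) \<in> A \<longleftrightarrow> (i, b) \<notin> A" by auto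
  show ?case
  proof (cases "(i, c) \<in> A")
    case True
    then have "\<exists>j<n. pos j < pos i \<and> (j, b) \<in> A \<and> (j, c) \<notin> A"
      using less.hyps[of i] i less.prems by auto
    then show ?thesis using i by auto
  next
    case False
    then show ?thesis using i by auto
  qed
qed

text \<open>Otherwise an earlier \<open>i\<close> is adjacent to \<open>x\<close> and not to
  \<open>c\<close>. As \<open>x\<close> is independent, \<open>i\<close> is a clique vertex, hence
  adjacent to \<open>c\<close> after all.\<close>

lemma before_ind:
  assumes "ind x" "c \<in> K" "pos x < pos c" "u < n" "pos u < pos x" "(u, c) \<in> A"
  shows "(u, x) \<in> A"
proof (rule ccontr)
  assume "(u, x) \<notin> A"
  then obtain i where i: "i < n" "pos i < pos u" "(i, x) \<in> A" "(i, c) \<notin> A"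
    using first_difference[of x c u] assms K_subset by (auto simp: ind_def)
  then have "i \<in> K" using indep assms by (auto simp: ind_def)
  moreover have "i \<noteq> c" using i assms by auto
  ultimately show False using clique assms i by blast
qed

lemma clique_before_ind:
  assumes "ind x" "c \<in> K" "pos x < pos c" "d \<in> K" "pos d < pos x"
  shows "d \<in> nbs x"
  using before_ind[of x c d] assms clique[of d c] K_subset subsetD[OF K_subset assms(4)]
  by (fastforce simp: nbs_def)

text \<open>If \<open>x\<close> were numbered while \<open>c\<close> is still missing,
  \<open>before_ind\<close> would make \<open>y\<close>, an earlier neighbour of \<open>c\<close>,
  adjacent to \<open>x\<close>.\<close>

lemma nbs_before_next:
  assumes "ind y" "ind x" "pos y < pos x" "c \<in> nbs y"
  shows "pos c < pos x"
proof (rule ccontr)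
  assume "\<not> pos c < pos x"
  moreover have c: "c \<in> K" "c < n" using ind_nbs assms K_subset by auto
  ultimately have "pos x < pos c" using pos_neq[of c x] assms by (auto simp: ind_def)
  then have "(y, x) \<in> A"
    using before_ind[of x c y] assms c adj_sym by (auto simp: ind_def nbs_def)
  then show False using indep assms by (auto simp: ind_def)
qed

text \<open>If \<open>c\<close> came before \<open>d\<close>, the vote of \<open>x\<close> for
  \<open>d\<close> would have to be outweighed by an earlier \<open>i\<close> adjacent to
  \<open>c\<close> and not to \<open>d\<close>. Such an \<open>i\<close> is independent, and
  \<open>nbs_before_next\<close> puts \<open>c\<close> before \<open>x\<close>.\<close>

lemma nbs_before_nonadjacent:
  assumes "ind x" "c \<in> K" "c \<notin> nbs x" "pos x < pos c" "d \<in> nbs x"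
  shows "pos d < pos c"
proof (rule ccontr)
  assume n: "\<not> pos d < pos c"
  have d: "d \<in> K" "d < n" "c < n" using ind_nbs assms K_subset by auto
  have "d \<noteq> c" using assms by auto
  then have "pos c < pos d" using pos_neq[of c d] d n by auto
  then obtain i where i: "i < n" "pos i < pos x" "(i, c) \<in> A" "(i, d) \<notin> A"
    using first_difference[of c d x] assms d adj_sym by (auto simp: nbs_def ind_def)
  have "pos x < pos d" using \<open>pos x < pos c\<close> \<open>pos c < pos d\<close> by simp
  then have "i \<noteq> d" using i by auto
  then have "i \<notin> K" using clique[of i d] i d by auto
  then have "ind i" using i by (simp add: ind_def)
  then show False
    using nbs_before_next[of i x c] i assms adj_sym by (auto simp: nbs_def)
qed

text \<open>In the case of an inclusion, a clique completed by then would contain a vertex of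
  \<open>nbs y - nbs x\<close> numbered before \<open>x\<close>; the first difference of
  \<open>x\<close> and \<open>y\<close> then contradicts \<open>nbs x \<subset> nbs y\<close>. The
  vertex \<open>z\<close> stands for those below \<open>x\<close> in \<open>\<pi>\<close>.\<close>

lemma base_before_clique:
  assumes "base x" "z < n" "pos z \<le> pos x"
  shows "\<exists>c\<in>K. pos z < pos c"
proof (cases "\<exists>c\<in>K. (x, c) \<in> \<pi>")
  case True
  then show ?thesis using ext assms K_subset unfolding base_def ind_def
    by (metis le_less_trans)
next
  case False
  then obtain y where y: "ind y" "(x, y) \<in> \<pi>" "nbs x \<subset> nbs y" "ind x"
    using assms unfolding base_def by blast
  then have xy: "pos x < pos y" using ext by blast
  from y obtain m where m: "m \<in> nbs y" "m \<notin> nbs x" by blast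
  have mK: "m \<in> K" "m < n" using ind_nbs m y K_subset by auto
  show ?thesis
  proof (rule ccontr)
    assume "\<not> ?thesis"
    then have "pos m \<le> pos z" using mK by auto
    moreover have "m \<noteq> x" using mK y by (auto simp: ind_def)
    ultimately have "pos m < pos x"
      using pos_neq[of m x] assms mK y by (auto simp: ind_def)
    then obtain i where "(i, x) \<in> A" "(i, y) \<notin> A"
      using first_difference[of x y m] m mK y xy by (auto simp: ind_def nbs_def)
    then show False using y by (auto simp: nbs_def)
  qed
qed

lemma M_before_clique:
  assumes "x \<in> M - K"
  shows "ind x" "\<exists>c\<in>K. pos x < pos c"
proof -
  show "ind x" using assms by (auto simp: M_def)
  obtain z where "base z" "(x, z) \<in> \<pi>" using assms by (auto simp: M_def)
  moreover then have "pos x \<le> pos z" using ext by (cases "x = z") (auto intro: less_imp_le)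
  ultimately show "\<exists>c\<in>K. pos x < pos c"
    using base_before_clique[of z x] M_less assms by blast
qed

text \<open>Let \<open>x\<close> precede \<open>y\<close>. The neighbours of \<open>x\<close>
  precede \<open>y\<close>, and the clique vertices before \<open>y\<close> lie in
  \<open>nbs y\<close>, since \<open>y\<close> precedes its neighbour \<open>c\<close>. Equal
  degrees make the neighbourhoods equal, so \<open>c\<close> precedes \<open>y\<close>, a
  contradiction.\<close>

lemma unique_early_of_lbfs: "unique_early"
proof -
  have False if e: "early x" "early y" "dg x = dg y" "pos x < pos y" for x y
  proof -
    have x: "ind x" and y: "ind y" using e by (auto simp: early_def)
    obtain c where c: "c \<in> nbs y" "(y, c) \<in> \<pi>" using e by (auto simp: early_def)
    have cK: "c \<in> K" using c y ind_nbs by blast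
    then have yc: "pos y < pos c" using c y ext by (auto simp: ind_def)
    have "nbs x \<subseteq> nbs y"
      using clique_before_ind[OF y cK yc] nbs_before_next[OF x y \<open>pos x < pos y\<close>] ind_nbs[OF x] by blast
    then have "nbs x = nbs y"
      using card_subset_eq[OF finite_nbs] e by (auto simp: dg_def)
    then have "pos c < pos y" using nbs_before_next[OF x y] c e by blast
    then show False using yc by simp
  qed
  then show ?thesis unfolding unique_early_def
    by (metis early_M DiffD1 M_less pos_neq)
qed

text \<open>Each position is stretched to four slots: offset 0 for clique and early vertices, 1 for
  the other independent vertices, 2 for virtual nodes. \<open>e x\<close> is the position at which
  \<open>x\<close> and all its neighbours are numbered. A precedence from a moved vertex or a
  virtual node to a vertex \<open>v\<close> then reduces to \<open>e x < pos v\<close>.\<close>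

lemma admissible_of_lbfs: "\<exists>\<rho>. admissible \<rho>"
proof -
  define e where "e x = Max (pos ` insert x (nbs x))" for x
  \<comment> \<open>The LBFS positions, with the premature vertices that are not early moved behind their neighbours.\<close>
  define \<rho> where "\<rho> u = (if u < n then if u \<in> K \<or> early u then 4 * pos u else 4 * e u + 1
       else 4 * e (u - n) + 2)" for u
  have e_ge: "pos x \<le> e x" "\<And>d. d \<in> nbs x \<Longrightarrow> pos d \<le> e x" for x
    unfolding e_def using finite_nbs by auto
  have e_less: "e x < k" if "pos x < k" "\<And>d. d \<in> nbs x \<Longrightarrow> pos d < k" for x k
    unfolding e_def using finite_nbs that by (subst Max_less_iff) auto
  have next_ind: "e u < pos v" if "ind u" "ind v" "pos u < pos v" for u v
    using nbs_before_next that by (intro e_less) auto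
  have next_clique: "e u < pos v" if "ind u" "v \<in> K" "v \<notin> nbs u" "pos u < pos v" for u v
    using nbs_before_nonadjacent that by (intro e_less) auto
  have "\<rho> u < \<rho> v" if edge: "edge u v" for u v
  proof (cases "u < n")
    case u: True
    show ?thesis
    proof (cases "v < n")
      case v: True
      then consider "(u, v) \<in> \<pi>" "u \<noteq> v" "v \<in> M" | "v \<in> M - K" "\<not> early v" "u \<in> nbs v"
        using edge u by (auto simp: edge_def nbs_def)
      then show ?thesis
      proof cases
        case 1
        then have uv: "pos u < pos v" using ext by blast
        have uM: "u \<in> M" using M_downclosed 1 by blast
        show ?thesis
        proof (cases "u \<in> K \<or> early u")
          case True
          have "4 * pos u < \<rho> v" unfolding \<rho>_def using uv v e_ge(1)[of v] by auto
          with True u show ?thesis by (simp add: \<rho>_def)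
        next
          case False
          then have iu: "ind u" using u by (simp add: ind_def)
          \<comment> \<open>All neighbours of the moved vertex \<open>u\<close> have to precede
            \<open>v\<close>. As \<open>u\<close> is not early, a clique vertex above it is not one
            of its neighbours.\<close>
          have "e u < pos v"
          proof (cases "v \<in> K")
            case True
            then have "v \<notin> nbs u" using False iu 1 by (auto simp: early_def)
            then show ?thesis using next_clique iu True uv by blast
          next
            case False
            then show ?thesis using next_ind iu uv v by (auto simp: ind_def)
          qed
          then show ?thesis using False u v e_ge(1)[of v] by (auto simp: \<rho>_def)
        qed
      next
        case 2
        then have "ind v" by (auto simp: M_def)
        then have "u \<in> K" using ind_nbs 2 by blast
        then show ?thesis using 2 u v e_ge(2)[of u v] by (auto simp: \<rho>_def)
      qed
    next
      case v: False
      then have "v - n \<in> M - K" and *: "u = v - n \<or> u \<in> nbs (v - n)"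
        using edge u by (auto simp: edge_def nbs_def)
      then have iv: "ind (v - n)" by (auto simp: M_def)
      from * have "\<rho> u \<le> 4 * e (v - n) + 1"
      proof
        assume "u = v - n"
        then show ?thesis using u iv e_ge(1)[of u] by (simp add: \<rho>_def)
      next
        assume "u \<in> nbs (v - n)"
        then show ?thesis using u ind_nbs[OF iv] e_ge(2)[of u "v - n"] by (simp add: \<rho>_def)
      qed
      then show ?thesis using v by (simp add: \<rho>_def)
    qed
  next
    case u: False
    define x where "x = u - n"
    have x: "x \<in> M - K" "v < n" "v \<in> K \<and> v \<notin> nbs x \<or> v \<in> M - K \<and> dg x < dg v"
      using edge u by (auto simp: edge_def nbs_def x_def)
    have ix: "ind x" using M_before_clique(1) x(1) .
    obtain c where c: "c \<in> K" "pos x < pos c" using M_before_clique(2) x(1) by blast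
    have xn: "x < n" using ix by (simp add: ind_def)
    have "e x < pos v"
    proof (cases "v \<in> K")
      case True
      then have "v \<notin> nbs x" using x by auto
      then have "\<not> pos v < pos x" using clique_before_ind ix c True by blast
      moreover have "v \<noteq> x" using True ix by (auto simp: ind_def)
      ultimately have "pos x < pos v" using pos_neq[OF x(2) xn] by blast
      then show ?thesis using next_clique ix True \<open>v \<notin> nbs x\<close> by blast
    next
      case False
      then have v: "ind v" "dg x < dg v" using x by (auto simp: ind_def)
      \<comment> \<open>If \<open>v\<close> came first, its neighbours would be clique vertices
        numbered before \<open>x\<close>, hence in \<open>nbs x\<close>, against the
        degrees.\<close>
      have "\<not> pos v < pos x"
      proof
        assume "pos v < pos x"
        then have "nbs v \<subseteq> nbs x"
          using nbs_before_next[OF v(1) ix] clique_before_ind[OF ix c] ind_nbs[OF v(1)] by blast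
        then have "dg v \<le> dg x" unfolding dg_def by (rule card_mono[OF finite_nbs])
        with v show False by simp
      qed
      moreover have "v \<noteq> x" using v by auto
      ultimately have "pos x < pos v" using pos_neq[OF x(2) xn] by blast
      then show ?thesis using next_ind ix v by blast
    qed
    then show ?thesis using u x e_ge(1)[of v] by (auto simp: \<rho>_def x_def)
  qed
  moreover have "\<exists>d\<in>nbs x - nbs y. \<rho> d < \<rho> c"
    if xy: "(x, y) \<in> \<pi>" "x \<notin> M" and c: "c \<in> nbs y - nbs x" for x y c
  proof -
    have ix: "ind x" using po_less xy by (auto simp: ind_def M_def)
    have "y \<notin> M" using M_downclosed xy by blast
    then have iy: "ind y" using po_less xy by (auto simp: ind_def M_def)
    have "\<not> base x" using xy ix po_refl by (auto simp: M_def ind_def)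
    then have "\<not> nbs x \<subset> nbs y" using ix iy xy by (auto simp: base_def)
    then obtain d0 where d0: "d0 \<in> nbs x - nbs y" using c by blast
    have "x \<noteq> y" using c by auto
    then have less: "pos x < pos y" using ext xy by blast
    have cK: "c \<in> K" "c < n" "c \<noteq> x" using ind_nbs iy c K_subset ix by (auto simp: ind_def)
    \<comment> \<open>If \<open>x\<close> precedes \<open>c\<close>, so does all of
      \<open>nbs x\<close>, including \<open>d0\<close>, which exists because \<open>x\<close> is
      not a \<open>base\<close> vertex. If \<open>c\<close> precedes \<open>x\<close>, the LBFS
      condition for \<open>x\<close> and \<open>y\<close> supplies \<open>d\<close>.\<close>
    have "\<exists>d\<in>nbs x - nbs y. pos d < pos c"
    proof (cases "pos x < pos c")
      case True
      then show ?thesis using nbs_before_nonadjacent[of x c d0] ix cK c d0 by blast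
    next
      case False
      then have "pos c < pos x" using pos_neq cK ix by (auto simp: ind_def)
      then obtain i where "pos i < pos c" "(i, x) \<in> A" "(i, y) \<notin> A"
        using first_difference[of x y c] ix iy less cK c by (auto simp: ind_def nbs_def)
      then show ?thesis by (auto simp: nbs_def)
    qed
    then obtain d where d: "d \<in> nbs x - nbs y" "pos d < pos c" by blast
    then have "d \<in> K" "d < n" using ind_nbs ix K_subset by auto
    then show ?thesis using d cK by (intro bexI[of _ d]) (auto simp: \<rho>_def)
  qed
  ultimately show ?thesis unfolding admissible_def by blast
qed

end


section \<open>Sufficiency: an LBFS ordering from an admissible rank\<close>

context
  fixes \<rho> :: "nat \<Rightarrow> nat"
  assumes adm: "admissible \<rho>" and ue: "unique_early"
begin

definition rk :: "nat \<Rightarrow> nat" where "rk u = \<rho> u * n + u"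

text \<open>Lexicographic order of the characteristic vectors along \<open>rk\<close>, the injective
  refinement of \<open>\<rho>\<close>: this is how labels compare once the clique is
  complete.\<close>

definition lex_greater :: "nat \<Rightarrow> nat \<Rightarrow> bool" where
  "lex_greater x y \<longleftrightarrow> (\<exists>d\<in>nbs x - nbs y. \<forall>e<n. rk e < rk d \<longrightarrow> (e \<in> nbs x \<longleftrightarrow> e \<in> nbs y))"

text \<open>Counting larger neighbourhoods turns the lexicographic order into numbers. Vertices with
  the same neighbourhood share a number, which leaves their order to \<open>height\<close>.\<close>

definition lex_index :: "nat \<Rightarrow> nat" where
  "lex_index x = card {z. z < n \<and> z \<notin> M \<and> lex_greater z x}"

definition height :: "nat \<Rightarrow> nat" where "height x = card {z. (z, x) \<in> \<pi>}"

text \<open>\<open>Suc (sum \<rho> {..<n})\<close> exceeds the rank of every member of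
  \<open>M\<close>, and \<open>Suc n\<close> exceeds every height. So behind \<open>M\<close> keys
  compare first by neighbourhood, then along \<open>\<pi>\<close>.\<close>

definition key :: "nat \<Rightarrow> nat" where
  "key u = (if u \<in> M then \<rho> u else Suc (sum \<rho> {..<n}) + (lex_index u * Suc n + height u))"

definition place :: "nat \<Rightarrow> nat" where "place u = key u * n + u"

lemma nbs_less: "d \<in> nbs x \<Longrightarrow> d < n"
  using adj_less by (auto simp: nbs_def)

lemma rk_less: "\<rho> u < \<rho> v \<Longrightarrow> u < n \<Longrightarrow> rk u < rk v"
  unfolding rk_def by (rule scaled_less)

lemma rk_inj: "u < n \<Longrightarrow> v < n \<Longrightarrow> rk u = rk v \<Longrightarrow> u = v"
  unfolding rk_def by (metis mod_less mod_mult_self3)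

text \<open>The earlier of the two first differences is the first difference of \<open>x\<close> and
  \<open>z\<close>.\<close>

lemma lex_greater_trans:
  assumes "lex_greater x y" "lex_greater y z"
  shows "lex_greater x z"
proof -
  obtain d where d: "d \<in> nbs x - nbs y" "\<forall>e<n. rk e < rk d \<longrightarrow> (e \<in> nbs x \<longleftrightarrow> e \<in> nbs y)"
    using assms(1) unfolding lex_greater_def by blast
  obtain d' where d': "d' \<in> nbs y - nbs z" "\<forall>e<n. rk e < rk d' \<longrightarrow> (e \<in> nbs y \<longleftrightarrow> e \<in> nbs z)"
    using assms(2) unfolding lex_greater_def by blast
  have less: "d < n" "d' < n" using d d' nbs_less by auto
  then have "rk d \<noteq> rk d'" using rk_inj d d' by auto
  then consider "rk d < rk d'" | "rk d' < rk d" by linarith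
  then show ?thesis
  proof cases
    case 1
    then show ?thesis unfolding lex_greater_def using d d' less
      by (intro bexI[of _ d]) auto
  next
    case 2
    then show ?thesis unfolding lex_greater_def using d d' less
      by (intro bexI[of _ d']) auto
  qed
qed

lemma lex_index_less:
  assumes "lex_greater x y" "x < n" "x \<notin> M"
  shows "lex_index x < lex_index y"
  unfolding lex_index_def
proof (rule psubset_card_mono)
  show "{z. z < n \<and> z \<notin> M \<and> lex_greater z x} \<subset> {z. z < n \<and> z \<notin> M \<and> lex_greater z y}"
  proof
    show "{z. z < n \<and> z \<notin> M \<and> lex_greater z x} \<subseteq> {z. z < n \<and> z \<notin> M \<and> lex_greater z y}"
      using assms(1) lex_greater_trans by blast
    have "\<not> lex_greater x x" by (auto simp: lex_greater_def)
    then show "{z. z < n \<and> z \<notin> M \<and> lex_greater z x} \<noteq> {z. z < n \<and> z \<notin> M \<and> lex_greater z y}"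
      using assms by blast
  qed
qed simp

lemma height_le: "height x \<le> n"
  unfolding height_def using card_mono[of "{..<n}" "{z. (z, x) \<in> \<pi>}"] po_less by auto

lemma height_less:
  assumes "(x, y) \<in> \<pi>" "x \<noteq> y"
  shows "height x < height y"
  unfolding height_def
proof (rule psubset_card_mono)
  show "finite {z. (z, y) \<in> \<pi>}"
    by (rule finite_subset[of _ "{..<n}"]) (use po_less in auto)
  have "y \<notin> {z. (z, x) \<in> \<pi>}" using po_antisym assms by auto
  moreover have "y \<in> {z. (z, y) \<in> \<pi>}" using po_refl po_less assms by auto
  ultimately show "{z. (z, x) \<in> \<pi>} \<subset> {z. (z, y) \<in> \<pi>}"
    using po_trans assms by blast
qed

lemma place_less: "key u < key v \<Longrightarrow> u < n \<Longrightarrow> place u < place v"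
  unfolding place_def by (rule scaled_less)

lemma key_le: "place u < place v \<Longrightarrow> v < n \<Longrightarrow> key u \<le> key v"
  using place_less[of v u] by force

lemma key_M_less:
  assumes "u \<in> M" "v \<notin> M"
  shows "key u < key v"
proof -
  have "\<rho> u \<le> sum \<rho> {..<n}" using M_less[OF assms(1)] by (intro member_le_sum) auto
  then show ?thesis using assms by (simp add: key_def)
qed

lemma key_of_lex_greater:
  assumes "lex_greater x y" "x < n" "x \<notin> M" "y \<notin> M"
  shows "key x < key y"
  using scaled_less[OF lex_index_less[OF assms(1-3)], of "height x" "Suc n" "height y"] height_le[of x] assms
  by (simp add: key_def)

lemma edge_less: "edge u v \<Longrightarrow> \<rho> u < \<rho> v"
  using adm unfolding admissible_def by blast

text \<open>Outside \<open>M\<close>, let \<open>d\<close> be the \<open>rk\<close>-first vertex on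
  which the neighbourhoods differ. If \<open>d\<close> belonged to \<open>nbs v\<close>,
  admissibility would supply a vertex of \<open>nbs u - nbs v\<close> of smaller rank; hence
  \<open>u\<close> is lexicographically larger. Equal neighbourhoods are decided by
  \<open>height\<close>.\<close>

lemma key_of_po:
  assumes uv: "(u, v) \<in> \<pi>" "u \<noteq> v"
  shows "key u < key v"
proof -
  have less: "u < n" "v < n" using po_less uv by auto
  consider "v \<in> M" | "u \<in> M" "v \<notin> M" | "u \<notin> M" "v \<notin> M" by blast
  then show ?thesis
  proof cases
    case 1
    then have "edge u v" using less uv by (simp add: edge_def)
    then show ?thesis using edge_less 1 M_downclosed[OF uv(1)] by (simp add: key_def)
  next
    case 2
    then show ?thesis by (rule key_M_less)
  next
    case 3
    show ?thesis
    proof (cases "nbs u = nbs v")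
      case True
      then have "lex_index u = lex_index v" by (simp add: lex_index_def lex_greater_def)
      then show ?thesis using 3 height_less[OF uv] by (simp add: key_def)
    next
      case False
      define S where "S = (nbs u - nbs v) \<union> (nbs v - nbs u)"
      have "finite S" "S \<noteq> {}" using False finite_nbs by (auto simp: S_def)
      then obtain d where d: "d \<in> S" "\<And>e. e \<in> S \<Longrightarrow> rk d \<le> rk e"
        using arg_min_if_finite[of S rk] by (metis linorder_not_less)
      have "d \<notin> nbs v - nbs u"
      proof
        assume "d \<in> nbs v - nbs u"
        then obtain e where e: "e \<in> nbs u - nbs v" "\<rho> e < \<rho> d"
          using adm uv 3 unfolding admissible_def by blast
        then have "rk e < rk d" using rk_less nbs_less by blast
        moreover have "rk d \<le> rk e" using d(2) e by (auto simp: S_def)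
        ultimately show False by simp
      qed
      then have "d \<in> nbs u - nbs v" using d(1) by (auto simp: S_def)
      moreover have "\<forall>e<n. rk e < rk d \<longrightarrow> (e \<in> nbs u \<longleftrightarrow> e \<in> nbs v)"
        using d(2) by (auto simp: S_def linorder_not_le[symmetric])
      ultimately have "lex_greater u v" unfolding lex_greater_def by blast
      then show ?thesis using key_of_lex_greater less 3 by blast
    qed
  qed
qed

lemma closed_edges:
  assumes "x \<in> M - K"
  shows "\<rho> x < \<rho> (n + x)" "c \<in> nbs x \<Longrightarrow> \<rho> c < \<rho> (n + x)"
    "c \<in> K \<Longrightarrow> c \<notin> nbs x \<Longrightarrow> \<rho> (n + x) < \<rho> c"
    "y \<in> M - K \<Longrightarrow> dg x < dg y \<Longrightarrow> \<rho> (n + x) < \<rho> y"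
proof -
  have less: "x < n" using assms M_less by auto
  show "\<rho> x < \<rho> (n + x)" by (rule edge_less) (use assms less in \<open>simp add: edge_def\<close>)
  show "\<rho> c < \<rho> (n + x)" if "c \<in> nbs x"
    by (rule edge_less) (use assms that nbs_less[OF that] in \<open>simp add: edge_def nbs_def\<close>)
  show "\<rho> (n + x) < \<rho> c" if "c \<in> K" "c \<notin> nbs x"
    by (rule edge_less) (use assms that K_subset in \<open>auto simp: edge_def nbs_def\<close>)
  show "\<rho> (n + x) < \<rho> y" if "y \<in> M - K" "dg x < dg y"
    by (rule edge_less) (use assms that M_less in \<open>auto simp: edge_def nbs_def\<close>)
qed

lemma late_edge:
  assumes "x \<in> M - K" "\<not> early x" "c \<in> nbs x"
  shows "\<rho> c < \<rho> x"
  by (rule edge_less)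
    (use assms M_less nbs_less[OF assms(3)] in \<open>auto simp: edge_def nbs_def\<close>)

text \<open>Distinct neighbourhoods of equal size contain \<open>d\<close> and \<open>e\<close>
  private to \<open>x\<close> and \<open>y\<close>. Then \<open>d\<close>, \<open>n + x\<close>,
  \<open>e\<close>, \<open>n + y\<close>, \<open>d\<close> is a cycle of strict
  inequalities.\<close>

lemma same_degree:
  assumes "x \<in> M - K" "y \<in> M - K" "dg x = dg y"
  shows "nbs x = nbs y"
proof (rule ccontr)
  assume ne: "nbs x \<noteq> nbs y"
  have "\<not> nbs x \<subseteq> nbs y" "\<not> nbs y \<subseteq> nbs x"
    using ne card_subset_eq[OF finite_nbs[of y], of "nbs x"] card_subset_eq[OF finite_nbs[of x], of "nbs y"]
      assms(3) unfolding dg_def by auto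
  then obtain d e where de: "d \<in> nbs x" "d \<notin> nbs y" "e \<in> nbs y" "e \<notin> nbs x" by blast
  have "ind x" "ind y" using assms by (auto simp: M_def)
  then have "d \<in> K" "e \<in> K" using de ind_nbs by auto
  then show False
    using closed_edges(2)[OF assms(1) de(1)] closed_edges(3)[OF assms(1) _ de(4)]
      closed_edges(2)[OF assms(2) de(3)] closed_edges(3)[OF assms(2) _ de(2)] by force
qed

text \<open>A violation \<open>a\<close>, \<open>b\<close>, \<open>c\<close> is refuted according to
  the place of \<open>b\<close>: in the clique by the virtual node of \<open>a\<close>, among the
  premature vertices by virtual nodes and \<open>unique_early\<close>, behind them by the
  lexicographic order. \<open>place\<close> only gives weak inequalities between keys, against which
  the constraints are strict.\<close>

lemma lbfs_of_admissible:
  "\<exists>pos. lbfs_pos {..<n} A pos \<and> (\<forall>u v. (u, v) \<in> \<pi> \<and> u \<noteq> v \<longrightarrow> pos u < pos v)"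
proof (intro exI[of _ place] conjI allI impI; (elim conjE)?)
  show "place u < place v" if "(u, v) \<in> \<pi>" "u \<noteq> v" for u v
    using place_less key_of_po that po_less by blast
  have "inj_on place {..<n}"
    by (rule inj_onI) (metis lessThan_iff mod_less mod_mult_self3 place_def)
  moreover have "\<exists>i\<in>{..<n}. place i < place a \<and> ((i, c) \<in> A \<longleftrightarrow> (i, b) \<notin> A)"
    if a: "a < n" and b: "b < n" and c: "c < n" and ab: "place a < place b" and bc: "place b < place c"
      and ac: "(a, c) \<in> A" and nab: "(a, b) \<notin> A" for a b c
  proof (rule ccontr)
    assume no: "\<not> ?thesis"
    have kab: "key a \<le> key b" and kbc: "key b \<le> key c" using key_le ab bc b c by auto
    have M_ab: "b \<in> M \<Longrightarrow> a \<in> M" and M_bc: "c \<in> M \<Longrightarrow> b \<in> M"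
      using key_M_less kab kbc by (metis leD)+
    have \<rho>_ab: "b \<in> M \<Longrightarrow> \<rho> a \<le> \<rho> b" and \<rho>_bc: "c \<in> M \<Longrightarrow> \<rho> b \<le> \<rho> c"
      using M_ab M_bc kab kbc by (auto simp: key_def)
    show False
    proof (cases "b \<in> K")
      case True
      then have bM: "b \<in> M" by (simp add: M_def)
      have "a \<noteq> b" using ab by auto
      then have "a \<notin> K" using clique True nab by blast
      then have aM: "a \<in> M - K" and cK: "c \<in> K" using M_ab bM ac indep by auto
      have "c \<in> nbs a" "b \<notin> nbs a" using adj_sym ac nab by (auto simp: nbs_def)
      then have "\<rho> c < \<rho> (n + a)" "\<rho> (n + a) < \<rho> b"
        using closed_edges(2,3)[OF aM] True by auto
      moreover have "\<rho> b \<le> \<rho> c" using \<rho>_bc cK by (simp add: M_def)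
      ultimately show False by simp
    next
      case bK: False
      then have ib: "ind b" using b by (simp add: ind_def)
      show False
      proof (cases "b \<in> M")
        case True
        then have bM: "b \<in> M - K" using bK by simp
        have aM: "a \<in> M" "\<rho> a \<le> \<rho> b" using M_ab \<rho>_ab True by auto
        show False
        proof (cases "a \<in> K")
          case True
          \<comment> \<open>A clique vertex not adjacent to \<open>b\<close> waits for the virtual
            node of \<open>b\<close>, hence for \<open>b\<close>.\<close>
          then have "\<rho> (n + b) < \<rho> a" using closed_edges(3)[OF bM] nab by (auto simp: nbs_def)
          with closed_edges(1)[OF bM] aM show False by simp
        next
          case False
          then have aMK: "a \<in> M - K" and cK: "c \<in> K" using aM indep ac by auto
          have \<rho>c: "\<rho> b \<le> \<rho> c" using \<rho>_bc cK by (simp add: M_def)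
          have ca: "c \<in> nbs a" using ac adj_sym by (simp add: nbs_def)
          consider "dg a < dg b" | "dg b < dg a" | "dg a = dg b" by linarith
          then show False
          proof cases
            case 1
            then show False
              using closed_edges(4)[OF aMK bM] closed_edges(2)[OF aMK ca] \<rho>c by simp
          next
            case 2
            then show False
              using closed_edges(4)[OF bM aMK] closed_edges(1)[OF bM] aM by simp
          next
            case 3
            \<comment> \<open>By \<open>same_degree\<close>, \<open>c\<close> is adjacent to both
              \<open>a\<close> and \<open>b\<close>. They are not both early, and the one that is
              not comes after all its neighbours, in particular after \<open>c\<close>.\<close>
            then have "c \<in> nbs b" using same_degree[OF aMK bM] ca by simp
            moreover have "a \<noteq> b" using ab by auto
            ultimately have "\<rho> c < \<rho> a \<or> \<rho> c < \<rho> b"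
              using ue 3 late_edge[OF aMK _ ca] late_edge[OF bM] unfolding unique_early_def by blast
            then show False using \<rho>c aM by auto
          qed
        qed
      next
        case False
        then have cM: "c \<notin> M" using M_bc by blast
        then have ic: "ind c" using c by (simp add: ind_def M_def)
        have aK: "a \<in> K" using ind_nbs[OF ic] ac by (simp add: nbs_def)
        \<comment> \<open>A difference \<open>e\<close> would be a clique vertex. There
          \<open>rk\<close> and \<open>place\<close> agree, so \<open>no\<close> excludes it, and
          \<open>a\<close> is the first difference.\<close>
        have "e \<in> nbs c \<longleftrightarrow> e \<in> nbs b" if e: "e < n" "rk e < rk a" for e
        proof (rule ccontr)
          assume x: "\<not> ?thesis"
          then have "e \<in> K" using ind_nbs ib ic by blast
          then have "place e < place a" using e aK by (simp add: place_def rk_def key_def M_def)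
          with no e x show False by (auto simp: nbs_def)
        qed
        moreover have "a \<in> nbs c - nbs b" using ac nab by (simp add: nbs_def)
        ultimately have "lex_greater c b" unfolding lex_greater_def by blast
        then have "key c < key b" using key_of_lex_greater c cM False by blast
        with kbc show False by simp
      qed
    qed
  qed
  ultimately show "lbfs_pos {..<n} A place" unfolding lbfs_pos_def by blast
qed

end

theorem lbfs_extension_iff:
  "(\<exists>\<sigma>. distinct \<sigma> \<and> set \<sigma> = {..<n} \<and> lbfs_condition A \<sigma> \<and> linear_extension {..<n} \<pi> \<sigma>) \<longleftrightarrow>
     unique_early \<and> (\<exists>\<rho>. admissible \<rho>)"
proof
  assume "\<exists>\<sigma>. distinct \<sigma> \<and> set \<sigma> = {..<n} \<and> lbfs_condition A \<sigma> \<and> linear_extension {..<n} \<pi> \<sigma>"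
  then show "unique_early \<and> (\<exists>\<rho>. admissible \<rho>)"
    using lbfs_pos_of_list unique_early_of_lbfs admissible_of_lbfs by metis
next
  assume "unique_early \<and> (\<exists>\<rho>. admissible \<rho>)"
  then obtain pos where "lbfs_pos {..<n} A pos" "\<forall>u v. (u, v) \<in> \<pi> \<and> u \<noteq> v \<longrightarrow> pos u < pos v"
    using lbfs_of_admissible by blast
  moreover have "\<pi> \<subseteq> {..<n} \<times> {..<n}" using po_less by auto
  ultimately show "\<exists>\<sigma>. distinct \<sigma> \<and> set \<sigma> = {..<n} \<and> lbfs_condition A \<sigma> \<and> linear_extension {..<n} \<pi> \<sigma>"
    using list_of_lbfs_pos by blast
qed

end

section \<open>Reasoning about programs\<close>

lemma afits_mono: "afits B e s \<Longrightarrow> B \<le> B' \<Longrightarrow> afits B' e s"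
  by (induction e) auto

lemma bfits_mono: "bfits B b s \<Longrightarrow> B \<le> B' \<Longrightarrow> bfits B' b s"
  by (induction b) (auto intro: afits_mono)

lemma runs_mono: "runs B c s t s' \<Longrightarrow> B \<le> B' \<Longrightarrow> runs B' c s t s'"
  by (induction rule: runs.induct) (blast intro: runs.intros afits_mono bfits_mono)+

lemma ex_afits: "\<exists>B. afits B e s"
proof (induction e)
  case (Const n)
  show ?case by (rule exI[of _ "Suc n"]) simp
next
  case (Var x)
  show ?case by (rule exI[of _ "Suc (vars s x)"]) simp
next
  case (Read a e)
  then obtain B where "afits B e s" ..
  then show ?case
    by (intro exI[of _ "max B (Suc (arrays s a (aval e s)))"]) (auto intro: afits_mono)
next
  case (Plus e f)
  then obtain B B' where "afits B e s" "afits B' f s" by blast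
  then show ?case
    by (intro exI[of _ "max (max B B') (Suc (aval e s + aval f s))"]) (auto elim: afits_mono)
next
  case (Minus e f)
  then obtain B B' where "afits B e s" "afits B' f s" by blast
  then show ?case by (intro exI[of _ "max B B'"]) (auto elim: afits_mono)
next
  case (Times e f)
  then obtain B B' where "afits B e s" "afits B' f s" by blast
  then show ?case
    by (intro exI[of _ "max (max B B') (Suc (aval e s * aval f s))"]) (auto elim: afits_mono)
qed

lemma ex_bfits: "\<exists>B. bfits B b s"
proof (induction b)
  case (Less e f)
  obtain B B' where "afits B e s" "afits B' f s" using ex_afits by blast
  then show ?case by (intro exI[of _ "max B B'"]) (auto elim: afits_mono)
next
  case (Equal e f)
  obtain B B' where "afits B e s" "afits B' f s" using ex_afits by blast
  then show ?case by (intro exI[of _ "max B B'"]) (auto elim: afits_mono)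
next
  case (Conj b c)
  then obtain B B' where "bfits B b s" "bfits B' c s" by blast
  then show ?case by (intro exI[of _ "max B B'"]) (auto elim: bfits_mono)
qed simp

text \<open>The word bound is existentially quantified here; \<open>runs_word_bound\<close> below recovers a
  polynomial one from the running time.\<close>

definition wp :: "com \<Rightarrow> ram_state \<Rightarrow> (nat \<Rightarrow> ram_state \<Rightarrow> bool) \<Rightarrow> bool" where
  "wp c s Q \<longleftrightarrow> (\<exists>t s' B. runs B c s t s' \<and> Q t s')"

lemma wp_mono: "wp c s Q \<Longrightarrow> (\<And>t s'. Q t s' \<Longrightarrow> R t s') \<Longrightarrow> wp c s R"
  unfolding wp_def by blast

lemma wp_Skip [simp]: "wp Skip s Q \<longleftrightarrow> Q 1 s"
proof
  assume "wp Skip s Q"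
  then show "Q 1 s" unfolding wp_def by (auto elim: runs_SkipE)
next
  assume "Q 1 s"
  then show "wp Skip s Q" unfolding wp_def using runs.skip by blast
qed

lemma wp_Assign [simp]: "wp (Assign x e) s Q \<longleftrightarrow> Q 1 (s\<lparr>vars := (vars s)(x := aval e s)\<rparr>)"
proof
  assume "wp (Assign x e) s Q"
  then show "Q 1 (s\<lparr>vars := (vars s)(x := aval e s)\<rparr>)"
    unfolding wp_def by (auto elim: runs_AssignE)
next
  obtain B where "afits B e s" using ex_afits by blast
  moreover assume "Q 1 (s\<lparr>vars := (vars s)(x := aval e s)\<rparr>)"
  ultimately show "wp (Assign x e) s Q" unfolding wp_def by (blast intro: runs.assign)
qed

lemma wp_Store [simp]: "wp (Store a e f) s Q \<longleftrightarrow>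
    Q 1 (s\<lparr>arrays := (arrays s)(a := (arrays s a)(aval e s := aval f s))\<rparr>)"
proof
  assume "wp (Store a e f) s Q"
  then show "Q 1 (s\<lparr>arrays := (arrays s)(a := (arrays s a)(aval e s := aval f s))\<rparr>)"
    unfolding wp_def by (auto elim: runs_StoreE)
next
  obtain B B' where "afits B e s" "afits B' f s" using ex_afits by blast
  then have "runs (max B B') (Store a e f) s 1
      (s\<lparr>arrays := (arrays s)(a := (arrays s a)(aval e s := aval f s))\<rparr>)"
    by (intro runs.store) (auto elim: afits_mono)
  moreover assume "Q 1 (s\<lparr>arrays := (arrays s)(a := (arrays s a)(aval e s := aval f s))\<rparr>)"
  ultimately show "wp (Store a e f) s Q" unfolding wp_def by blast
qed

lemma wp_Seq [simp]: "wp (Seq c d) s Q \<longleftrightarrow> wp c s (\<lambda>t s'. wp d s' (\<lambda>t' s''. Q (t + t') s''))"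
proof
  assume "wp (Seq c d) s Q"
  then show "wp c s (\<lambda>t s'. wp d s' (\<lambda>t' s''. Q (t + t') s''))"
    unfolding wp_def by (blast elim: runs_SeqE)
next
  assume "wp c s (\<lambda>t s'. wp d s' (\<lambda>t' s''. Q (t + t') s''))"
  then obtain t s' B t' s'' B' where
    "runs B c s t s'" "runs B' d s' t' s''" and Q: "Q (t + t') s''"
    unfolding wp_def by blast
  then have "runs (max B B') (Seq c d) s (t + t') s''"
    by (intro runs.seq) (auto elim: runs_mono)
  with Q show "wp (Seq c d) s Q" unfolding wp_def by blast
qed

lemma wp_If [simp]: "wp (If b c d) s Q \<longleftrightarrow>
    (if bval b s then wp c s (\<lambda>t. Q (1 + t)) else wp d s (\<lambda>t. Q (1 + t)))"
proof
  assume "wp (If b c d) s Q"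
  then show "if bval b s then wp c s (\<lambda>t. Q (1 + t)) else wp d s (\<lambda>t. Q (1 + t))"
    unfolding wp_def by (auto elim!: runs_IfE)
next
  obtain B where B: "bfits B b s" using ex_bfits by blast
  assume a: "if bval b s then wp c s (\<lambda>t. Q (1 + t)) else wp d s (\<lambda>t. Q (1 + t))"
  show "wp (If b c d) s Q"
  proof (cases "bval b s")
    case True
    with a obtain t s' B' where r: "runs B' c s t s'" and Q: "Q (1 + t) s'"
      unfolding wp_def by auto
    have "runs (max B B') (If b c d) s (1 + t) s'"
      using True B r by (intro runs.if_true) (auto elim: runs_mono bfits_mono)
    with Q show ?thesis unfolding wp_def by blast
  next
    case False
    with a obtain t s' B' where r: "runs B' d s t s'" and Q: "Q (1 + t) s'"
      unfolding wp_def by auto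
    have "runs (max B B') (If b c d) s (1 + t) s'"
      using False B r by (intro runs.if_false) (auto elim: runs_mono bfits_mono)
    with Q show ?thesis unfolding wp_def by blast
  qed
qed

lemma wp_While_false: "\<not> bval b s \<Longrightarrow> Q 1 s \<Longrightarrow> wp (While b c) s Q"
  unfolding wp_def using ex_bfits[of b s] by (blast intro: runs.while_false)

lemma wp_While_true:
  assumes "bval b s" "wp c s (\<lambda>t s'. wp (While b c) s' (\<lambda>t'. Q (1 + t + t')))"
  shows "wp (While b c) s Q"
proof -
  obtain B where B: "bfits B b s" using ex_bfits by blast
  obtain t s' B' t' s'' B'' where r: "runs B' c s t s'" "runs B'' (While b c) s' t' s''"
      and Q: "Q (1 + t + t') s''"
    using assms(2) unfolding wp_def by blast
  have "runs (max B (max B' B'')) (While b c) s (1 + t + t') s''"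
    using assms(1) B r by (intro runs.while_true) (auto elim: runs_mono bfits_mono)
  with Q show ?thesis unfolding wp_def by blast
qed

section \<open>Frame conditions and counting loops\<close>

fun written_vars :: "com \<Rightarrow> vname set" where
  "written_vars (Assign x e) = {x}"
| "written_vars (Seq c d) = written_vars c \<union> written_vars d"
| "written_vars (If b c d) = written_vars c \<union> written_vars d"
| "written_vars (While b c) = written_vars c"
| "written_vars _ = {}"

fun written_arrays :: "com \<Rightarrow> vname set" where
  "written_arrays (Store a e f) = {a}"
| "written_arrays (Seq c d) = written_arrays c \<union> written_arrays d"
| "written_arrays (If b c d) = written_arrays c \<union> written_arrays d"
| "written_arrays (While b c) = written_arrays c"
| "written_arrays _ = {}"

definition frame :: "com \<Rightarrow> ram_state \<Rightarrow> ram_state \<Rightarrow> bool" where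
  "frame c s s' \<longleftrightarrow> (\<forall>x. x \<notin> written_vars c \<longrightarrow> vars s' x = vars s x) \<and>
     (\<forall>a. a \<notin> written_arrays c \<longrightarrow> arrays s' a = arrays s a)"

lemma runs_frame: "runs B c s t s' \<Longrightarrow> frame c s s'"
  by (induction rule: runs.induct) (auto simp: frame_def)

lemma wp_frame: "wp c s Q \<Longrightarrow> (\<And>t s'. Q t s' \<Longrightarrow> frame c s s' \<Longrightarrow> R t s') \<Longrightarrow> wp c s R"
  unfolding wp_def using runs_frame by blast

definition For :: "vname \<Rightarrow> aexp \<Rightarrow> com \<Rightarrow> com" where
  "For x e body = Seq (Assign x (Const 0))
     (While (Less (Var x) e) (Seq body (Assign x (Plus (Var x) (Const 1)))))"

lemma written_For [simp]:
  "written_vars (For x e body) = insert x (written_vars body)"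
  "written_arrays (For x e body) = written_arrays body"
  by (auto simp: For_def)

abbreviation set_var :: "ram_state \<Rightarrow> vname \<Rightarrow> nat \<Rightarrow> ram_state" where
  "set_var s x v \<equiv> s\<lparr>vars := (vars s)(x := v)\<rparr>"

text \<open>\<open>\<tau>\<close> is the time spent so far, so that an invariant can charge
  expensive iterations to a potential. The initial 1 pays for the first assignment, the 2 for test
  and increment of an iteration, \<open>Suc\<close> for the last, failing test.\<close>

lemma wp_For_time:
  assumes x: "x \<notin> written_vars body"
    and bound: "\<And>s'. frame (For x e body) s s' \<Longrightarrow> aval e s' = N"
    and init: "I 0 1 (set_var s x 0)"
    and step: "\<And>k \<tau> s'. k < N \<Longrightarrow> frame (For x e body) s s' \<Longrightarrow> vars s' x = k \<Longrightarrow> I k \<tau> s' \<Longrightarrow>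
       wp body s' (\<lambda>t s''. I (Suc k) (\<tau> + t + 2) (set_var s'' x (Suc k)))"
    and post: "\<And>\<tau> s'. frame (For x e body) s s' \<Longrightarrow> vars s' x = N \<Longrightarrow> I N \<tau> s' \<Longrightarrow> Q (Suc \<tau>) s'"
  shows "wp (For x e body) s Q"
proof -
  let ?W = "While (Less (Var x) e) (Seq body (Assign x (Plus (Var x) (Const 1))))"
  have "wp ?W s' (\<lambda>t. Q (\<tau> + t))"
    if "k \<le> N" "frame (For x e body) s s'" "vars s' x = k" "I k \<tau> s'" for k \<tau> s'
    using that
  proof (induction "N - k" arbitrary: k \<tau> s')
    case 0
    then have k: "k = N" by simp
    have "\<not> bval (Less (Var x) e) s'" using bound[of s'] 0 k by simp
    then show ?case using post[of s' \<tau>] 0 k by (intro wp_While_false) auto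
  next
    case (Suc m)
    then have k: "k < N" by simp
    have b: "bval (Less (Var x) e) s'" using bound[of s'] Suc.prems k by simp
    have 1: "wp body s' (\<lambda>t s''. I (Suc k) (\<tau> + t + 2) (set_var s'' x (Suc k)))"
      using step k Suc.prems by blast
    have "wp body s' (\<lambda>t s''. wp ?W (set_var s'' x (vars s'' x + 1)) (\<lambda>t'. Q (\<tau> + (1 + (t + 1) + t'))))"
    proof (rule wp_frame[OF 1])
      fix t s''
      assume I: "I (Suc k) (\<tau> + t + 2) (set_var s'' x (Suc k))" and f: "frame body s' s''"
      have vx: "vars s'' x = k" using f x Suc.prems by (simp add: frame_def)
      have "frame (For x e body) s (set_var s'' x (Suc k))"
        using f Suc.prems(2) by (auto simp: frame_def)
      then have "wp ?W (set_var s'' x (Suc k)) (\<lambda>t'. Q (\<tau> + t + 2 + t'))"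
        using Suc.hyps k I by (intro Suc.hyps(1)) auto
      then show "wp ?W (set_var s'' x (vars s'' x + 1)) (\<lambda>t'. Q (\<tau> + (1 + (t + 1) + t')))"
        by (simp add: vx algebra_simps)
    qed
    then show ?case by (intro wp_While_true[OF b]) simp
  qed
  from this[of 0 "set_var s x 0" 1] init have "wp ?W (set_var s x 0) (\<lambda>t. Q (1 + t))"
    by (simp add: frame_def)
  then show ?thesis by (simp add: For_def)
qed

lemma wp_For:
  assumes x: "x \<notin> written_vars body"
    and bound: "\<And>s'. frame (For x e body) s s' \<Longrightarrow> aval e s' = N"
    and init: "I 0 (set_var s x 0)"
    and step: "\<And>k s'. k < N \<Longrightarrow> frame (For x e body) s s' \<Longrightarrow> vars s' x = k \<Longrightarrow> I k s' \<Longrightarrow>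
       wp body s' (\<lambda>t s''. t \<le> T \<and> I (Suc k) (set_var s'' x (Suc k)))"
    and post: "\<And>t s'. frame (For x e body) s s' \<Longrightarrow> t \<le> N * (T + 2) + 2 \<Longrightarrow> I N s' \<Longrightarrow> Q t s'"
  shows "wp (For x e body) s Q"
proof (rule wp_For_time[where I = "\<lambda>k \<tau> s'. \<tau> \<le> k * (T + 2) + 1 \<and> I k s'", OF x bound])
  fix k \<tau> s'
  assume "k < N" "frame (For x e body) s s'" "vars s' x = k" "\<tau> \<le> k * (T + 2) + 1 \<and> I k s'"
  then show "wp body s' (\<lambda>t s''. \<tau> + t + 2 \<le> Suc k * (T + 2) + 1 \<and> I (Suc k) (set_var s'' x (Suc k)))"
    by (intro wp_mono[OF step[of k s']]) auto
qed (use init post in auto)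

section \<open>Word size\<close>

text \<open>A read is a leaf whatever its address, because its value is a stored number.\<close>

fun leaf :: "aexp \<Rightarrow> bool" where
  "leaf (Const c) \<longleftrightarrow> c \<le> 1"
| "leaf (Var x) \<longleftrightarrow> True"
| "leaf (Read a e) \<longleftrightarrow> True"
| "leaf _ \<longleftrightarrow> False"

text \<open>A slow expression exceeds the largest stored number by at most one. Products are confined to
  addresses and tests, whose size is polynomial in the stored numbers.\<close>

fun slow :: "aexp \<Rightarrow> bool" where
  "slow (Plus e f) \<longleftrightarrow> leaf e \<and> f = Const 1"
| "slow (Minus e f) \<longleftrightarrow> leaf e"
| "slow e \<longleftrightarrow> leaf e"

fun slow_com :: "com \<Rightarrow> bool" where
  "slow_com (Assign x e) \<longleftrightarrow> slow e"
| "slow_com (Store a e f) \<longleftrightarrow> slow f"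
| "slow_com (Seq c d) \<longleftrightarrow> slow_com c \<and> slow_com d"
| "slow_com (If b c d) \<longleftrightarrow> slow_com c \<and> slow_com d"
| "slow_com (While b c) \<longleftrightarrow> slow_com c"
| "slow_com Skip \<longleftrightarrow> True"

text \<open>An exponent for \<open>V + 2\<close> that bounds all values met during evaluation,
  addresses included, when stored numbers are at most \<open>V\<close>. Constants get
  \<open>Suc c\<close> because c < 2 ^ c.\<close>

fun awidth :: "aexp \<Rightarrow> nat" where
  "awidth (Const c) = Suc c"
| "awidth (Var x) = 1"
| "awidth (Read a e) = awidth e"
| "awidth (Plus e f) = awidth e + awidth f"
| "awidth (Minus e f) = awidth e + awidth f"
| "awidth (Times e f) = awidth e + awidth f"

fun bwidth :: "bexp \<Rightarrow> nat" where
  "bwidth (Less e f) = awidth e + awidth f"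
| "bwidth (Equal e f) = awidth e + awidth f"
| "bwidth (Neg b) = bwidth b"
| "bwidth (Conj b c) = bwidth b + bwidth c"

fun cwidth :: "com \<Rightarrow> nat" where
  "cwidth (Assign x e) = awidth e"
| "cwidth (Store a e f) = awidth e + awidth f"
| "cwidth (Seq c d) = cwidth c + cwidth d"
| "cwidth (If b c d) = bwidth b + cwidth c + cwidth d"
| "cwidth (While b c) = bwidth b + cwidth c"
| "cwidth Skip = 0"

definition values_le :: "nat \<Rightarrow> ram_state \<Rightarrow> bool" where
  "values_le V s \<longleftrightarrow> (\<forall>x. vars s x \<le> V) \<and> (\<forall>a i. arrays s a i \<le> V)"

lemma awidth_pos: "0 < awidth e"
  by (induction e) auto

lemma aval_less: "values_le V s \<Longrightarrow> aval e s < (V + 2) ^ awidth e"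
proof (induction e)
  case (Const c)
  have "c < 2 ^ c" by (rule less_exp)
  also have "\<dots> \<le> (V + 2) ^ c" by (intro power_mono) auto
  also have "\<dots> \<le> (V + 2) ^ Suc c" by (intro power_increasing) auto
  finally show ?case by simp
next
  case (Var x)
  then have "vars s x \<le> V" by (simp add: values_le_def)
  then show ?case by simp
next
  case (Read a e)
  then have "arrays s a (aval e s) \<le> V" by (simp add: values_le_def)
  also have "V < (V + 2) ^ 1" by simp
  also have "\<dots> \<le> (V + 2) ^ awidth (Read a e)"
    using awidth_pos[of "Read a e"] by (intro power_increasing) auto
  finally show ?case by simp
next
  case (Plus e f)
  have ge: "2 \<le> (V + 2) ^ awidth g" for g
    by (rule order_trans[OF _ self_le_power]) (simp_all add: awidth_pos)
  \<comment> \<open>From 2 on a sum is at most the product, so the widths of a sum may be added as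
    for a product.\<close>
  have "x + y \<le> x * y" if "2 \<le> x" "2 \<le> y" for x y :: nat
  proof -
    have "x + y \<le> 2 * max x y" by simp
    also have "\<dots> \<le> min x y * max x y" using that by (intro mult_le_mono1) simp
    also have "\<dots> = x * y" by (simp add: min_def max_def)
    finally show ?thesis .
  qed
  from this[OF ge[of e] ge[of f]] show ?case using Plus by (auto simp: power_add intro: less_le_trans[OF add_strict_mono])
next
  case (Minus e f)
  have "aval e s < (V + 2) ^ awidth e" using Minus by simp
  also have "\<dots> \<le> (V + 2) ^ awidth (Minus e f)" by (intro power_increasing) auto
  finally show ?case by simp
next
  case (Times e f)
  then show ?case by (simp add: power_add mult_strict_mono')
qed

lemma width_mono: "(V + 2 :: nat) ^ k \<le> B \<Longrightarrow> l \<le> k \<Longrightarrow> (V + 2) ^ l \<le> B"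
  by (rule order_trans[OF power_increasing]) auto

lemma afits_width: "values_le V s \<Longrightarrow> (V + 2) ^ awidth e \<le> B \<Longrightarrow> afits B e s"
proof (induction e)
  case (Read a e)
  then show ?case using aval_less[OF Read.prems(1), of "Read a e"] by auto
next
  case (Plus e f)
  then show ?case using aval_less[OF Plus.prems(1), of "Plus e f"]
      width_mono[OF Plus.prems(2), of "awidth e"] width_mono[OF Plus.prems(2), of "awidth f"] by auto
next
  case (Minus e f)
  then show ?case
    using width_mono[OF Minus.prems(2), of "awidth e"] width_mono[OF Minus.prems(2), of "awidth f"] by auto
next
  case (Times e f)
  then show ?case using aval_less[OF Times.prems(1), of "Times e f"]
      width_mono[OF Times.prems(2), of "awidth e"] width_mono[OF Times.prems(2), of "awidth f"] by auto
next
  case (Const c)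
  then show ?case using aval_less[OF Const.prems(1), of "Const c"] by auto
next
  case (Var x)
  then show ?case using aval_less[OF Var.prems(1), of "Var x"] by auto
qed

lemma bfits_width: "values_le V s \<Longrightarrow> (V + 2) ^ bwidth b \<le> B \<Longrightarrow> bfits B b s"
proof (induction b)
  case (Less e f)
  then show ?case
    using width_mono[OF Less.prems(2), of "awidth e"] width_mono[OF Less.prems(2), of "awidth f"]
    by (auto intro: afits_width)
next
  case (Equal e f)
  then show ?case
    using width_mono[OF Equal.prems(2), of "awidth e"] width_mono[OF Equal.prems(2), of "awidth f"]
    by (auto intro: afits_width)
next
  case (Conj b c)
  then show ?case
    using width_mono[OF Conj.prems(2), of "bwidth b"] width_mono[OF Conj.prems(2), of "bwidth c"] by auto
qed simp

lemma leaf_le: "leaf e \<Longrightarrow> values_le V s \<Longrightarrow> 1 \<le> V \<Longrightarrow> aval e s \<le> V"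
  by (cases e) (auto simp: values_le_def)

lemma slow_le: "slow e \<Longrightarrow> values_le V s \<Longrightarrow> 1 \<le> V \<Longrightarrow> aval e s \<le> V + 1"
proof (cases e)
  case (Plus f g)
  moreover assume "slow e" "values_le V s" "1 \<le> V"
  ultimately show ?thesis using leaf_le[of f V s] by simp
next
  case (Minus f g)
  moreover assume "slow e" "values_le V s" "1 \<le> V"
  ultimately show ?thesis using leaf_le[of f V s] by simp
qed (auto simp: values_le_def intro: le_SucI)

lemma width_le:
  assumes "(U + 2 :: nat) ^ k \<le> B" "V \<le> U" "l \<le> k"
  shows "(V + 2) ^ l \<le> B"
proof -
  have "(V + 2) ^ l \<le> (U + 2) ^ l" using assms(2) by (intro power_mono) auto
  also have "\<dots> \<le> B" using assms(1,3) by (rule width_mono)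
  finally show ?thesis .
qed

lemma values_le_mono: "values_le V s \<Longrightarrow> V \<le> W \<Longrightarrow> values_le W s"
  unfolding values_le_def by (meson order_trans)

text \<open>A step raises the largest stored number by at most one, so \<open>V + t\<close> bounds
  them throughout, and the widths bound every intermediate value by a power of
  \<open>V + t + 2\<close>.\<close>

lemma runs_word_bound:
  assumes "runs B0 c s t s'" "slow_com c" "values_le V s" "1 \<le> V" "(V + t + 2) ^ cwidth c \<le> B"
  shows "runs B c s t s' \<and> values_le (V + t) s'"
  using assms
proof (induction arbitrary: V rule: runs.induct)
  case (skip s)
  then show ?case using runs.skip[of B s] values_le_mono[of V s "V + 1"] by simp
next
  case (assign e s x)
  have "afits B e s"
    by (rule afits_width[OF assign.prems(2) width_le[OF assign.prems(4)]]) auto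
  moreover have "aval e s \<le> V + 1" using assign.prems by (intro slow_le) auto
  ultimately show ?case using assign.prems runs.assign[of B e s x]
    by (auto simp: values_le_def intro: le_SucI)
next
  case (store e s f a)
  have "afits B e s" "afits B f s"
    by (rule afits_width[OF store.prems(2) width_le[OF store.prems(4)]]; simp)+
  moreover have "aval f s \<le> V + 1" using store.prems by (intro slow_le) auto
  ultimately show ?case using store.prems runs.store[of B e s f a]
    by (auto simp: values_le_def intro: le_SucI)
next
  case (seq c s t s' d t' s'')
  have 1: "runs B c s t s' \<and> values_le (V + t) s'"
    using seq.prems by (intro seq.IH(1) width_le[OF seq.prems(4)]) simp_all
  have "runs B d s' t' s'' \<and> values_le (V + t + t') s''"
    using seq.prems 1 by (intro seq.IH(2) width_le[OF seq.prems(4)]) simp_all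
  then show ?case using runs.seq[OF conjunct1[OF 1], of d t' s''] by (simp add: add.assoc)
next
  case (if_true b s c t s' d)
  have "bfits B b s"
    by (rule bfits_width[OF if_true.prems(2) width_le[OF if_true.prems(4)]]) simp_all
  moreover have "runs B c s t s' \<and> values_le (V + t) s'"
    using if_true.prems by (intro if_true.IH width_le[OF if_true.prems(4)]) simp_all
  ultimately show ?case using runs.if_true[OF _ if_true.hyps(2), of B c t s' d]
      values_le_mono[of "V + t" s' "V + (1 + t)"] by simp
next
  case (if_false b s d t s' c)
  have "bfits B b s"
    by (rule bfits_width[OF if_false.prems(2) width_le[OF if_false.prems(4)]]) simp_all
  moreover have "runs B d s t s' \<and> values_le (V + t) s'"
    using if_false.prems by (intro if_false.IH width_le[OF if_false.prems(4)]) simp_all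
  ultimately show ?case using runs.if_false[OF _ if_false.hyps(2), of B d t s' c]
      values_le_mono[of "V + t" s' "V + (1 + t)"] by simp
next
  case (while_false b s c)
  have "bfits B b s"
    by (rule bfits_width[OF while_false.prems(2) width_le[OF while_false.prems(4)]]) simp_all
  then show ?case using runs.while_false[OF _ while_false.hyps(2), of B c] while_false.prems
      values_le_mono[of V s "V + 1"] by simp
next
  case (while_true b s c t s' t' s'')
  have b: "bfits B b s"
    by (rule bfits_width[OF while_true.prems(2) width_le[OF while_true.prems(4)]]) simp_all
  have 1: "runs B c s t s' \<and> values_le (V + t) s'"
    using while_true.prems by (intro while_true.IH(1) width_le[OF while_true.prems(4)]) simp_all
  have "runs B (While b c) s' t' s'' \<and> values_le (V + t + t') s''"
    using while_true.prems 1 by (intro while_true.IH(2) width_le[OF while_true.prems(4)]) simp_all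
  then show ?case using runs.while_true[OF b while_true.hyps(2) conjunct1[OF 1], of t' s'']
      values_le_mono[of "V + t + t'" s'' "V + (1 + t + t')"] by simp
qed

section \<open>Matrices in memory\<close>

text \<open>Rows are unbounded: an untouched array stores the empty relation, and rows beyond those
  filled read as zero.\<close>

definition stores_matrix :: "nat \<Rightarrow> (nat \<Rightarrow> nat) \<Rightarrow> (nat \<Rightarrow> nat \<Rightarrow> bool) \<Rightarrow> bool" where
  "stores_matrix m f R \<longleftrightarrow> (\<forall>u v. v < m \<longrightarrow> f (u * m + v) = of_bool (R u v))"

lemma matrix_index_inj:
  fixes u v u' v' m :: nat
  assumes "v < m" "v' < m"
  shows "u * m + v = u' * m + v' \<longleftrightarrow> u = u' \<and> v = v'"
  using assms by (metis mod_less mod_mult_self3 add_right_cancel mult_cancel2 not_less0)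

lemma stores_matrix_update:
  assumes "stores_matrix m f R" "b < m" "\<And>u v. v < m \<Longrightarrow> R' u v \<longleftrightarrow> u = a \<and> v = b \<or> R u v"
  shows "stores_matrix m (f(a * m + b := Suc 0)) R'"
  using assms unfolding stores_matrix_def by (auto simp: matrix_index_inj)

lemma stores_matrix_cong:
  "stores_matrix m f R \<Longrightarrow> (\<And>u v. v < m \<Longrightarrow> R' u v \<longleftrightarrow> R u v) \<Longrightarrow> stores_matrix m f R'"
  unfolding stores_matrix_def by auto

lemma stores_matrixD: "stores_matrix m f R \<Longrightarrow> v < m \<Longrightarrow> f (u * m + v) = of_bool (R u v)"
  unfolding stores_matrix_def by blast

abbreviation sizeN :: aexp where "sizeN \<equiv> Var ''n''"
abbreviation sizeP :: aexp where "sizeP \<equiv> Var ''p''"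
abbreviation is_one :: "aexp \<Rightarrow> bexp" where "is_one e \<equiv> Equal e (Const 1)"
abbreviation is_zero :: "aexp \<Rightarrow> bexp" where "is_zero e \<equiv> Equal e (Const 0)"
abbreviation Or :: "bexp \<Rightarrow> bexp \<Rightarrow> bexp" where "Or b c \<equiv> Neg (Conj (Neg b) (Neg c))"
abbreviation entry :: "vname \<Rightarrow> aexp \<Rightarrow> aexp \<Rightarrow> aexp" where
  "entry a u v \<equiv> Read a (Plus (Times u sizeN) v)"

subsection \<open>Adjacency and relation matrices\<close>

lemma concat_nth_take:
  assumes "i < length xss" "j < length (xss ! i)"
  shows "length (concat (take i xss)) + j < length (concat xss)"
    and "concat xss ! (length (concat (take i xss)) + j) = xss ! i ! j"
proof -
  have "concat xss = concat (take i xss) @ xss ! i @ concat (drop (Suc i) xss)"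
    using arg_cong[OF id_take_nth_drop[OF assms(1)], of concat] by simp
  then show "length (concat (take i xss)) + j < length (concat xss)"
    and "concat xss ! (length (concat (take i xss)) + j) = xss ! i ! j"
    using assms(2) by (simp_all add: nth_append)
qed

definition row_prog :: com where
  "row_prog = For ''j'' (Var ''d'')
     (Store ''E'' (Plus (Times (Var ''u'') sizeN) (Read ''nbr'' (Plus (Read ''off'' (Var ''u'')) (Var ''j''))))
       (Const 1))"

definition matrix_prog :: com where
  "matrix_prog = For ''u'' sizeN
     (Seq (Assign ''d'' (Minus (Read ''off'' (Plus (Var ''u'') (Const 1))) (Read ''off'' (Var ''u''))))
     (Seq (Store ''deg'' (Var ''u'') (Var ''d'')) row_prog))"

lemma wp_matrix_prog:
  assumes n: "vars s ''n'' = n" "length adj = n"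
    and off: "arrays s ''off'' = list_array (map (\<lambda>v. length (concat (take v adj))) [0..<length adj + 1])"
    and nbr: "arrays s ''nbr'' = list_array (concat adj)"
    and E: "arrays s ''E'' = (\<lambda>_. 0)"
    and adj: "\<And>v. v < n \<Longrightarrow> distinct (adj ! v) \<and> set (adj ! v) = {w. (v, w) \<in> A}"
    and A: "A \<subseteq> {..<n} \<times> {..<n}"
  shows "wp matrix_prog s (\<lambda>t s'. t \<le> n * (3 * n + 6) + 2 \<and>
     stores_matrix n (arrays s' ''E'') (\<lambda>u v. (u, v) \<in> A) \<and>
     (\<forall>v<n. arrays s' ''deg'' v = card {w. (v, w) \<in> A}))"
  unfolding matrix_prog_def
proof (rule wp_For[where N = n and T = "3 * n + 4" and
      I = "\<lambda>k s'. stores_matrix n (arrays s' ''E'') (\<lambda>u v. u < k \<and> (u, v) \<in> A) \<and>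
         (\<forall>v<k. arrays s' ''deg'' v = card {w. (v, w) \<in> A})"], goal_cases)
  case (4 k s')
  then have k: "k < n" and fr: "vars s' ''n'' = n" "arrays s' ''off'' = arrays s ''off''"
      "arrays s' ''nbr'' = arrays s ''nbr''"
    using n by (simp_all add: frame_def row_prog_def)
  define o1 where "o1 v = length (concat (take v adj))" for v
  have off': "arrays s' ''off'' v = o1 v" if "v \<le> n" for v
    using that n fr unfolding o1_def off list_array_def by (simp del: upt_Suc)
  have o1: "o1 (Suc k) = o1 k + length (adj ! k)"
    using k n by (simp add: o1_def take_Suc_conv_app_nth)
  have len: "length (adj ! k) = card {w. (k, w) \<in> A}"
    using adj[OF k] distinct_card by fastforce
  \<comment> \<open>A list without repetitions has at most \<open>n\<close> entries; this bounds the
    row loop.\<close>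
  have "card {w. (k, w) \<in> A} \<le> card {..<n}" by (rule card_mono) (use A in auto)
  then have len_le: "length (adj ! k) \<le> n" using len by simp
  let ?s = "s'\<lparr>vars := (vars s')(''d'' := length (adj ! k)),
     arrays := (arrays s')(''deg'' := (arrays s' ''deg'')(k := length (adj ! k)))\<rparr>"
  have "wp row_prog ?s (\<lambda>t s''. Suc (Suc t) \<le> 3 * n + 4 \<and>
           stores_matrix n (arrays s'' ''E'') (\<lambda>u v. u < Suc k \<and> (u, v) \<in> A) \<and>
           (\<forall>v<Suc k. arrays s'' ''deg'' v = card {w. (v, w) \<in> A}))"
    unfolding row_prog_def
  proof (rule wp_For[where N = "length (adj ! k)" and T = 1 and
        I = "\<lambda>j s''. stores_matrix n (arrays s'' ''E'')
          (\<lambda>u v. u < k \<and> (u, v) \<in> A \<or> u = k \<and> v \<in> set (take j (adj ! k)))"], goal_cases)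
    case j: (4 j s'')
    then have fr': "vars s'' ''n'' = n" "vars s'' ''u'' = k" "arrays s'' ''off'' k = o1 k"
      "arrays s'' ''nbr'' = list_array (concat adj)"
      using fr 4(3) off'[of k] k nbr by (simp_all add: frame_def)
    have nb: "list_array (concat adj) (o1 k + j) = adj ! k ! j"
      using concat_nth_take[of k adj j] k n j by (simp add: list_array_def o1_def)
    have "adj ! k ! j \<in> set (adj ! k)" using j by simp
    then have "adj ! k ! j < n" using adj[OF k] A by auto
    then have "stores_matrix n ((arrays s'' ''E'')(k * n + adj ! k ! j := Suc 0))
          (\<lambda>u v. u < k \<and> (u, v) \<in> A \<or> u = k \<and> v \<in> set (take (Suc j) (adj ! k)))"
      using j(1) by (intro stores_matrix_update[OF j(4)]) (auto simp: take_Suc_conv_app_nth)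
    then show ?case by (simp add: fr' j(3) nb)
  next
    case j: (5 t s'')
    have "stores_matrix n (arrays s'' ''E'') (\<lambda>u v. u < Suc k \<and> (u, v) \<in> A)"
      by (rule stores_matrix_cong[OF j(3)]) (use adj[OF k] in \<open>auto simp: less_Suc_eq\<close>)
    moreover have "arrays s'' ''deg'' = (arrays s' ''deg'')(k := length (adj ! k))"
      using j(1) by (simp add: frame_def)
    ultimately show ?case using j(2) len_le len 4 by (auto simp: less_Suc_eq)
  qed (use 4 in \<open>auto simp: frame_def\<close>)
  then show ?case using k 4(3) by (simp add: off' o1)
next
  case (5 t s')
  have "stores_matrix n (arrays s' ''E'') (\<lambda>u v. (u, v) \<in> A)"
    by (rule stores_matrix_cong[OF conjunct1[OF 5(3)]]) (use A in auto)
  with 5 show ?case by (simp add: algebra_simps)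
qed (use n E in \<open>auto simp: frame_def stores_matrix_def row_prog_def\<close>)

definition relation_prog :: com where
  "relation_prog = For ''q'' sizeP
     (Store ''R'' (Plus (Times (Read ''fst'' (Var ''q'')) sizeN) (Read ''snd'' (Var ''q''))) (Const 1))"

lemma wp_relation_prog:
  assumes n: "vars s ''n'' = n" "vars s ''p'' = length ps"
    and ps: "arrays s ''fst'' = list_array (map fst ps)" "arrays s ''snd'' = list_array (map snd ps)"
    and R: "arrays s ''R'' = (\<lambda>_. 0)" and less: "set ps \<subseteq> {..<n} \<times> {..<n}"
  shows "wp relation_prog s (\<lambda>t s'. t \<le> length ps * 3 + 2 \<and>
     stores_matrix n (arrays s' ''R'') (\<lambda>u v. (u, v) \<in> set ps))"
  unfolding relation_prog_def
proof (rule wp_For[where N = "length ps" and T = 1 and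
      I = "\<lambda>k s'. stores_matrix n (arrays s' ''R'') (\<lambda>u v. (u, v) \<in> set (take k ps))"], goal_cases)
  case (4 k s')
  have k: "ps ! k \<in> set ps" using 4 by simp
  then have "snd (ps ! k) < n" using less by auto
  then have "stores_matrix n ((arrays s' ''R'')(fst (ps ! k) * n + snd (ps ! k) := Suc 0))
      (\<lambda>u v. (u, v) \<in> set (take (Suc k) ps))"
    using 4(1) by (intro stores_matrix_update[OF 4(4)]) (auto simp: take_Suc_conv_app_nth prod_eq_iff)
  then show ?case using 4 n ps by (simp add: frame_def list_array_def)
qed (use n R in \<open>auto simp: frame_def stores_matrix_def\<close>)

subsection \<open>Split partition\<close>

text \<open>The last condition says that the complement of \<open>K\<close> is independent, so
  \<open>K\<close> alone encodes the partition.\<close>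

definition split_partition :: "nat set \<Rightarrow> nat rel \<Rightarrow> nat set \<Rightarrow> bool" where
  "split_partition V A K \<longleftrightarrow> K \<subseteq> V \<and> (\<forall>u\<in>K. \<forall>v\<in>K. u \<noteq> v \<longrightarrow> (u, v) \<in> A) \<and>
     (\<forall>(u, v)\<in>A. u \<in> K \<or> v \<in> K)"

text \<open>If a vertex of maximal degree among the undecided ones is adjacent to all of the clique so
  far but outside the clique of the given partition, it can be added there, or exchanged with its
  only non-neighbour.\<close>

lemma split_partition_extend:
  assumes A: "A \<subseteq> V \<times> V" "finite V" "\<And>u v. (u, v) \<in> A \<Longrightarrow> (v, u) \<in> A" "\<And>u. (u, u) \<notin> A"
    and sp: "split_partition V A K'" and K: "K \<subseteq> K'" "(S - K) \<inter> K' = {}" "S \<subseteq> V"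
    and b: "b \<in> V - S" "\<And>v. v \<in> V - S \<Longrightarrow> card {w. (v, w) \<in> A} \<le> card {w. (b, w) \<in> A}"
    and adj: "\<forall>w\<in>K. (b, w) \<in> A"
  shows "\<exists>K''. split_partition V A K'' \<and> insert b K \<subseteq> K'' \<and> (S - K) \<inter> K'' = {}"
proof (cases "b \<in> K'")
  case True
  then show ?thesis using sp K by blast
next
  case bK: False
  have K'V: "K' \<subseteq> V" "finite K'" using sp A(2) finite_subset by (auto simp: split_partition_def)
  have fin: "finite {w. (v, w) \<in> A}" for v by (rule finite_subset[OF _ A(2)]) (use A in auto)
  have nb: "{w. (b, w) \<in> A} \<subseteq> K'" using sp bK by (auto simp: split_partition_def)
  show ?thesis
  proof (cases "\<forall>c\<in>K'. (b, c) \<in> A")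
    case True
    then have "split_partition V A (insert b K')"
      using sp b A(3) by (auto simp: split_partition_def)
    then show ?thesis using K b by (intro exI[of _ "insert b K'"]) auto
  next
    case False
    then obtain c where c: "c \<in> K'" "(b, c) \<notin> A" by blast
    \<comment> \<open>\<open>c\<close> is not in \<open>K\<close>, whose members are adjacent to
      \<open>b\<close>, and decided vertices outside \<open>K\<close> are not in \<open>K'\<close>.
      So \<open>c\<close> is undecided and its degree is at most that of \<open>b\<close>.\<close>
    then have cS: "c \<in> V - S" using K adj K'V by auto
    have sub: "{w. (b, w) \<in> A} \<subseteq> K' - {c}" using nb c by auto
    have sup: "K' - {c} \<subseteq> {w. (c, w) \<in> A}" using sp c by (auto simp: split_partition_def)
    \<comment> \<open>The inequalities close to a circle, so \<open>b\<close> and \<open>c\<close>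
      both have the neighbourhood \<open>K' - {c}\<close> and can be exchanged.\<close>
    have "card {w. (c, w) \<in> A} \<le> card {w. (b, w) \<in> A}" using b cS by blast
    moreover have "card {w. (b, w) \<in> A} \<le> card (K' - {c})" using card_mono[OF _ sub] K'V by simp
    moreover have "card (K' - {c}) \<le> card {w. (c, w) \<in> A}" using card_mono[OF fin sup] .
    ultimately have "card {w. (b, w) \<in> A} = card (K' - {c})" "card (K' - {c}) = card {w. (c, w) \<in> A}"
      by simp_all
    then have eq: "{w. (b, w) \<in> A} = K' - {c}" "K' - {c} = {w. (c, w) \<in> A}"
      using card_subset_eq[OF _ sub] card_subset_eq[OF fin sup] K'V by simp_all
    have cover: "u \<in> insert b (K' - {c}) \<or> v \<in> insert b (K' - {c})" if uv: "(u, v) \<in> A" for u v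
    proof -
      have "u \<in> K' \<or> v \<in> K'" using sp uv by (auto simp: split_partition_def)
      moreover have "v \<in> K' - {c}" if "u = c" using uv that eq by blast
      moreover have "u \<in> K' - {c}" if "v = c" using uv that eq A(3) by blast
      ultimately show ?thesis by blast
    qed
    have "split_partition V A (insert b (K' - {c}))"
      unfolding split_partition_def
    proof (intro conjI ballI impI)
      fix u v assume "u \<in> insert b (K' - {c})" "v \<in> insert b (K' - {c})" "u \<noteq> v"
      moreover have "(b, x) \<in> A" "(x, b) \<in> A" if "x \<in> K' - {c}" for x using that eq(1) A(3) by auto
      moreover have "(x, y) \<in> A" if "x \<in> K'" "y \<in> K'" "x \<noteq> y" for x y
        using that sp by (auto simp: split_partition_def)
      ultimately show "(u, v) \<in> A" by blast
    qed (use K'V b cover in auto)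
    then show ?thesis using K b c adj by (intro exI[of _ "insert b (K' - {c})"]) auto
  qed
qed

text \<open>\<open>g\<close> holds a degree plus one: 0 means that no candidate has been seen, and
  isolated vertices can still be selected.\<close>

definition select_prog :: com where
  "select_prog = For ''u'' sizeN
     (If (Conj (is_zero (Read ''done'' (Var ''u''))) (Less (Var ''g'') (Plus (Read ''deg'' (Var ''u'')) (Const 1))))
       (Seq (Assign ''b'' (Var ''u'')) (Assign ''g'' (Plus (Read ''deg'' (Var ''u'')) (Const 1)))) Skip)"

lemma wp_select_prog:
  assumes n: "vars s ''n'' = n" and S: "arrays s ''done'' = (\<lambda>v. of_bool (v \<in> S))"
    and deg: "\<forall>v<n. arrays s ''deg'' v = d v" and g: "vars s ''g'' = 0" and ne: "\<not> {..<n} \<subseteq> S"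
  shows "wp select_prog s (\<lambda>t s'. t \<le> n * 5 + 2 \<and>
     (\<exists>b\<in>{..<n} - S. vars s' ''b'' = b \<and> (\<forall>v\<in>{..<n} - S. d v \<le> d b)))"
  unfolding select_prog_def
proof (rule wp_For[where N = n and T = 3 and
      I = "\<lambda>k s'. vars s' ''g'' = 0 \<and> (\<forall>v<k. v \<in> S) \<or>
        (\<exists>b\<in>{..<k} - S. vars s' ''b'' = b \<and> vars s' ''g'' = Suc (d b) \<and> (\<forall>v\<in>{..<k} - S. d v \<le> d b))"], goal_cases)
  case (4 k s')
  then have "arrays s' ''done'' k = of_bool (k \<in> S)" "arrays s' ''deg'' k = d k"
    using S deg by (simp_all add: frame_def)
  note k = this 4(3)
  from 4(4) consider "vars s' ''g'' = 0" "\<forall>v<k. v \<in> S"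
    | b where "b < k" "b \<notin> S" "vars s' ''b'' = b" "vars s' ''g'' = Suc (d b)" "\<And>v. v < k \<Longrightarrow> v \<notin> S \<Longrightarrow> d v \<le> d b"
    by auto
  then show ?case
  proof cases
    case 1
    then show ?thesis using k by (auto simp: less_Suc_eq)
  next
    case (2 b)
    have "d v \<le> d k" if "v < k" "v \<notin> S" "d b < d k" for v
      using 2(5)[of v] that by simp
    then show ?thesis using k 2 by (auto simp: less_Suc_eq)
  qed
next
  case (5 t s')
  then show ?case using ne by auto
qed (use n g in \<open>auto simp: frame_def\<close>)

definition test_prog :: com where
  "test_prog = For ''u'' sizeN
     (If (Conj (is_one (Read ''K'' (Var ''u''))) (is_zero (entry ''E'' (Var ''b'') (Var ''u''))))
       (Assign ''o'' (Const 0)) Skip)"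

lemma wp_test_prog:
  assumes n: "vars s ''n'' = n" and K: "arrays s ''K'' = (\<lambda>v. of_bool (v \<in> K))" "K \<subseteq> {..<n}"
    and E: "stores_matrix n (arrays s ''E'') (\<lambda>u v. (u, v) \<in> A)" and o1: "vars s ''o'' = 1"
  shows "wp test_prog s (\<lambda>t s'. t \<le> n * 4 + 2 \<and>
     vars s' ''o'' = of_bool (\<forall>w\<in>K. (vars s ''b'', w) \<in> A))"
  unfolding test_prog_def
proof (rule wp_For[where N = n and T = 2 and
      I = "\<lambda>k s'. vars s' ''o'' = of_bool (\<forall>w\<in>K. w < k \<longrightarrow> (vars s ''b'', w) \<in> A)"], goal_cases)
  case (4 k s')
  then have "arrays s' ''K'' k = of_bool (k \<in> K)" "vars s' ''b'' = vars s ''b''" "vars s' ''n'' = n"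
    "arrays s' ''E'' (vars s ''b'' * n + k) = of_bool ((vars s ''b'', k) \<in> A)"
    using K n stores_matrixD[OF E] by (simp_all add: frame_def)
  with 4(1,3,4) show ?case by (auto simp: less_Suc_eq)
next
  case (5 t s')
  then show ?case using K by (auto simp: subset_eq)
qed (use n o1 in \<open>auto simp: frame_def\<close>)

definition split_prog :: com where
  "split_prog = For ''r'' sizeN
     (Seq (Assign ''g'' (Const 0)) (Seq select_prog (Seq (Store ''done'' (Var ''b'') (Const 1))
     (Seq (Assign ''o'' (Const 1)) (Seq test_prog (Store ''K'' (Var ''b'') (Var ''o'')))))))"

lemma wp_split_prog:
  assumes n: "vars s ''n'' = n" and K: "arrays s ''K'' = (\<lambda>_. 0)" "arrays s ''done'' = (\<lambda>_. 0)"
    and E: "stores_matrix n (arrays s ''E'') (\<lambda>u v. (u, v) \<in> A)"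
    and deg: "\<forall>v<n. arrays s ''deg'' v = card {w. (v, w) \<in> A}"
    and A: "A \<subseteq> {..<n} \<times> {..<n}" "\<And>u v. (u, v) \<in> A \<Longrightarrow> (v, u) \<in> A" "\<And>u. (u, u) \<notin> A"
    and sp: "\<exists>K. split_partition {..<n} A K"
  shows "wp split_prog s (\<lambda>t s'. t \<le> n * (n * 9 + 10) + 2 \<and>
     (\<exists>K. split_partition {..<n} A K \<and> arrays s' ''K'' = (\<lambda>v. of_bool (v \<in> K))))"
  unfolding split_prog_def
proof (rule wp_For[where N = n and T = "n * 9 + 8" and
      I = "\<lambda>k s'. \<exists>S K K'. card S = k \<and> S \<subseteq> {..<n} \<and> arrays s' ''done'' = (\<lambda>v. of_bool (v \<in> S)) \<and>
        arrays s' ''K'' = (\<lambda>v. of_bool (v \<in> K)) \<and> K \<subseteq> S \<and>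
        split_partition {..<n} A K' \<and> K \<subseteq> K' \<and> (S - K) \<inter> K' = {}"], goal_cases)
  case (4 k s')
  then obtain S K K' where I: "card S = k" "S \<subseteq> {..<n}" "arrays s' ''done'' = (\<lambda>v. of_bool (v \<in> S))"
        "arrays s' ''K'' = (\<lambda>v. of_bool (v \<in> K))" "K \<subseteq> S"
        "split_partition {..<n} A K'" "K \<subseteq> K'" "(S - K) \<inter> K' = {}" by blast
  have fr: "vars s' ''n'' = n" "arrays s' ''E'' = arrays s ''E''" "arrays s' ''deg'' = arrays s ''deg''"
    using 4(2) n by (simp_all add: frame_def select_prog_def test_prog_def)
  have ne: "\<not> {..<n} \<subseteq> S" using I 4(1) by (metis card_lessThan card_mono finite_lessThan
        finite_subset leD)
  show ?case
  proof (simp, rule wp_frame[OF wp_select_prog[where n = n and S = S and d = "\<lambda>v. card {w. (v, w) \<in> A}"]], goal_cases)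
    case (6 t1 s1)
    then obtain b where b: "b \<in> {..<n} - S" "vars s1 ''b'' = b"
       "\<forall>v\<in>{..<n} - S. card {w. (v, w) \<in> A} \<le> card {w. (b, w) \<in> A}" by blast
    note t1 = 6(1)
    have fr1: "vars s1 ''n'' = n" "arrays s1 = arrays s'"
      using 6(2) fr by (simp_all add: frame_def select_prog_def fun_eq_iff)
    show ?case
    proof (rule wp_frame[OF wp_test_prog[where n = n and K = K and A = A]], goal_cases)
      case (6 t2 s2)
      have fr2: "vars s2 ''b'' = b" "arrays s2 ''K'' = arrays s' ''K''"
          "arrays s2 ''done'' = (\<lambda>v. of_bool (v \<in> insert b S))"
        using 6(2) fr1 b I(3) by (simp_all add: frame_def test_prog_def fun_eq_iff)
      have o1: "vars s2 ''o'' = of_bool (\<forall>w\<in>K. (b, w) \<in> A)" using 6(1) b by simp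
      have t12: "t1 \<le> n * 5 + 2" "t2 \<le> n * 4 + 2" using t1 6(1) by auto
      have fin: "finite S" using I(2) finite_subset by blast
      have ex: "\<exists>K1 K2. (arrays s2 ''K'')(b := vars s2 ''o'') = (\<lambda>v. of_bool (v \<in> K1)) \<and> K1 \<subseteq> insert b S \<and>
          split_partition {..<n} A K2 \<and> K1 \<subseteq> K2 \<and> (insert b S - K1) \<inter> K2 = {}"
      proof (cases "\<forall>w\<in>K. (b, w) \<in> A")
        case True
        obtain K'' where K'': "split_partition {..<n} A K''" "insert b K \<subseteq> K''" "(S - K) \<inter> K'' = {}"
          using split_partition_extend[OF A(1) finite_lessThan A(2,3) I(6,7,8,2) b(1) _ True] b(3) by blast
        have "(\<lambda>v. of_bool (v \<in> K))(b := 1) = (\<lambda>v. of_bool (v \<in> insert b K) :: nat)"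
          by auto
        moreover have "vars s2 ''o'' = 1" unfolding o1 of_bool_eq_1_iff using True .
        ultimately have "(arrays s2 ''K'')(b := vars s2 ''o'') = (\<lambda>v. of_bool (v \<in> insert b K))"
          unfolding fr2(2) I(4) by (simp only:)
        with K'' show ?thesis
          using I(5) by - (rule exI[of _ "insert b K"], rule exI[of _ K''], blast)
      next
        case False
        then obtain w where w: "w \<in> K" "(b, w) \<notin> A" by blast
        have "b \<noteq> w" using w I(5) b(1) by blast
        then have "b \<notin> K'" using w I(6,7) unfolding split_partition_def by blast
        have "(\<lambda>v. of_bool (v \<in> K))(b := 0) = (\<lambda>v. of_bool (v \<in> K) :: nat)"
          using I(5) b(1) by (auto simp: fun_eq_iff)
        moreover have "vars s2 ''o'' = 0" unfolding o1 of_bool_eq_0_iff using False .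
        ultimately have "(arrays s2 ''K'')(b := vars s2 ''o'') = (\<lambda>v. of_bool (v \<in> K))"
          unfolding fr2(2) I(4) by (simp only:)
        then show ?thesis using \<open>b \<notin> K'\<close> I(5-8)
          by - (rule exI[of _ K], rule exI[of _ K'], blast)
      qed
      have "\<exists>S1 K1 K2. card S1 = Suc k \<and> S1 \<subseteq> {..<n} \<and> arrays s2 ''done'' = (\<lambda>v. of_bool (v \<in> S1)) \<and>
          (arrays s2 ''K'')(b := vars s2 ''o'') = (\<lambda>v. of_bool (v \<in> K1)) \<and> K1 \<subseteq> S1 \<and>
          split_partition {..<n} A K2 \<and> K1 \<subseteq> K2 \<and> (S1 - K1) \<inter> K2 = {}"
      proof -
        have "card (insert b S) = Suc k" "insert b S \<subseteq> {..<n}" using b(1) I(1,2) fin by auto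
        with ex fr2(3) show ?thesis by blast
      qed
      with t12 show ?case by (simp add: fr2(1))
    qed (use fr fr1 E I in auto)
  qed (use fr deg I ne in auto)
next
  case (5 t s')
  then obtain S K K' where I: "card S = n" "S \<subseteq> {..<n}"
        "arrays s' ''K'' = (\<lambda>v. of_bool (v \<in> K))"
        "split_partition {..<n} A K'" "K \<subseteq> K'" "(S - K) \<inter> K' = {}" by blast
  have "S = {..<n}" using I(1,2) by (metis card_lessThan card_subset_eq finite_lessThan)
  then have "K = K'" using I by (auto simp: split_partition_def)
  moreover have "t \<le> n * (n * 9 + 10) + 2" using 5(2) by (simp add: algebra_simps)
  ultimately show ?case using I by blast
next
  case 3
  obtain K' where "split_partition {..<n} A K'" using sp by blast
  then show ?case
    by - (rule exI[of _ "{}"], rule exI[of _ "{}"], rule exI[of _ K'], use K in simp)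
qed (use n in \<open>auto simp: frame_def select_prog_def test_prog_def\<close>)

subsection \<open>Constraints\<close>

lemma of_bool_update:
  "(\<lambda>v. of_bool (P v) :: nat)(x := Suc 0) = (\<lambda>v. of_bool (v = x \<or> P v))"
  by (auto simp: fun_eq_iff)

text \<open>\<open>a\<close> flags that \<open>nbs x\<close> is not contained in
  \<open>nbs y\<close>, \<open>b\<close> the reverse; proper inclusion is \<open>a\<close> = 0 and
  \<open>b\<close> = 1.\<close>

definition compare_prog :: com where
  "compare_prog = For ''c'' sizeN (Seq
     (If (Conj (is_one (entry ''E'' (Var ''c'') (Var ''x''))) (is_zero (entry ''E'' (Var ''c'') (Var ''y''))))
       (Assign ''a'' (Const 1)) Skip)
     (If (Conj (is_one (entry ''E'' (Var ''c'') (Var ''y''))) (is_zero (entry ''E'' (Var ''c'') (Var ''x''))))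
       (Assign ''b'' (Const 1)) Skip))"

definition base_prog :: com where
  "base_prog = For ''q'' sizeP (Seq (Assign ''x'' (Read ''fst'' (Var ''q'')))
     (Seq (Assign ''y'' (Read ''snd'' (Var ''q'')))
     (If (is_zero (Read ''K'' (Var ''x'')))
       (If (is_one (Read ''K'' (Var ''y'')))
         (Seq (Store ''base'' (Var ''x'') (Const 1))
           (If (is_one (entry ''E'' (Var ''y'') (Var ''x''))) (Store ''early'' (Var ''x'') (Const 1)) Skip))
         (Seq (Assign ''a'' (Const 0)) (Seq (Assign ''b'' (Const 0)) (Seq compare_prog
           (If (Conj (is_zero (Var ''a'')) (is_one (Var ''b''))) (Store ''base'' (Var ''x'') (Const 1)) Skip)))))
       Skip)))"

text \<open>One pass is enough: \<open>M\<close> is defined by a single step of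
  \<open>\<pi>\<close>, and a clique vertex is entered at the latest by its reflexive pair.\<close>

definition premature_prog :: com where
  "premature_prog = For ''q'' sizeP
     (If (Conj (is_zero (Read ''K'' (Read ''fst'' (Var ''q'')))) (is_zero (Read ''base'' (Read ''snd'' (Var ''q'')))))
       Skip (Store ''M'' (Read ''fst'' (Var ''q'')) (Const 1)))"

definition unique_row_prog :: com where
  "unique_row_prog = For ''v'' sizeN
     (If (Conj (Neg (Equal (Var ''u'') (Var ''v'')))
          (Conj (is_one (Read ''early'' (Var ''u''))) (Conj (is_one (Read ''early'' (Var ''v'')))
            (Equal (Read ''deg'' (Var ''u'')) (Read ''deg'' (Var ''v''))))))
       (Assign ''answer'' (Const 0)) Skip)"

definition unique_prog :: com where
  "unique_prog = Seq (Assign ''answer'' (Const 1)) (For ''u'' sizeN unique_row_prog)"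

text \<open>The range tests guard the matrix reads: a column number of \<open>n\<close> or more
  would address a cell of another row. Both halves of a conjunction are evaluated, which is harmless
  as arrays are total.\<close>

definition edge_test :: bexp where
  "edge_test =
     Or (Conj (Less (Var ''u'') sizeN) (Conj (Less (Var ''v'') sizeN)
          (Or (Conj (is_one (entry ''R'' (Var ''u'') (Var ''v'')))
                (Conj (Neg (Equal (Var ''u'') (Var ''v''))) (is_one (Read ''M'' (Var ''v'')))))
              (Conj (is_one (Read ''M'' (Var ''v''))) (Conj (is_zero (Read ''K'' (Var ''v'')))
                (Conj (is_zero (Read ''early'' (Var ''v''))) (is_one (entry ''E'' (Var ''u'') (Var ''v'')))))))))
    (Or (Conj (Less (Var ''u'') sizeN) (Conj (Neg (Less (Var ''v'') sizeN))
          (Conj (is_one (Read ''M'' (Minus (Var ''v'') sizeN)))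
          (Conj (is_zero (Read ''K'' (Minus (Var ''v'') sizeN)))
            (Or (Equal (Var ''u'') (Minus (Var ''v'') sizeN))
              (is_one (entry ''E'' (Var ''u'') (Minus (Var ''v'') sizeN))))))))
        (Conj (Neg (Less (Var ''u'') sizeN)) (Conj (Less (Var ''v'') sizeN)
          (Conj (is_one (Read ''M'' (Minus (Var ''u'') sizeN)))
          (Conj (is_zero (Read ''K'' (Minus (Var ''u'') sizeN)))
            (Or (Conj (is_one (Read ''K'' (Var ''v''))) (is_zero (entry ''E'' (Var ''v'') (Minus (Var ''u'') sizeN))))
              (Conj (is_one (Read ''M'' (Var ''v''))) (Conj (is_zero (Read ''K'' (Var ''v'')))
                (Less (Read ''deg'' (Minus (Var ''u'') sizeN)) (Read ''deg'' (Var ''v'')))))))))))"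

abbreviation nodes :: aexp where "nodes \<equiv> Plus sizeN sizeN"

definition edge_row_prog :: com where
  "edge_row_prog = For ''v'' nodes
     (If edge_test
       (Seq (Store ''D'' (Plus (Times (Var ''u'') nodes) (Var ''v'')) (Const 1))
         (Store ''count'' (Var ''v'') (Plus (Read ''count'' (Var ''v'')) (Const 1)))) Skip)"

definition edge_prog :: com where
  "edge_prog = For ''u'' nodes edge_row_prog"

definition block_row_prog :: com where
  "block_row_prog = For ''c'' sizeN
     (If (Conj (is_one (entry ''E'' (Var ''c'') (Var ''y''))) (is_zero (entry ''E'' (Var ''c'') (Var ''x''))))
       (Store ''count'' (Var ''c'') (Plus (Read ''count'' (Var ''c'')) (Const 1))) Skip)"

definition block_prog :: com where
  "block_prog = For ''q'' sizeP (Seq (Assign ''x'' (Read ''fst'' (Var ''q'')))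
     (Seq (Assign ''y'' (Read ''snd'' (Var ''q'')))
     (If (is_zero (Read ''M'' (Var ''x''))) block_row_prog Skip)))"

locale split_program = split_instance +
  fixes ps :: "(nat \<times> nat) list"
  assumes set_ps: "set ps = \<pi>"
begin

text \<open>What all phases after the search for the clique read and none of them writes.\<close>

definition mem :: "ram_state \<Rightarrow> bool" where
  "mem s \<longleftrightarrow> vars s ''n'' = n \<and> vars s ''p'' = length ps \<and>
     arrays s ''fst'' = list_array (map fst ps) \<and> arrays s ''snd'' = list_array (map snd ps) \<and>
     stores_matrix n (arrays s ''E'') (\<lambda>u v. (u, v) \<in> A) \<and>
     arrays s ''K'' = (\<lambda>v. of_bool (v \<in> K)) \<and> (\<forall>v<n. arrays s ''deg'' v = dg v) \<and>
     stores_matrix n (arrays s ''R'') (\<lambda>u v. (u, v) \<in> \<pi>)"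

lemma mem_frame:
  "frame c s s' \<Longrightarrow> mem s \<Longrightarrow> {''n'', ''p''} \<inter> written_vars c = {} \<Longrightarrow>
     {''fst'', ''snd'', ''E'', ''K'', ''deg'', ''R''} \<inter> written_arrays c = {} \<Longrightarrow> mem s'"
  by (simp add: frame_def mem_def)

lemma mem_pair:
  assumes "mem s" "q < length ps"
  shows "arrays s ''fst'' q = fst (ps ! q)" "arrays s ''snd'' q = snd (ps ! q)"
    "(fst (ps ! q), snd (ps ! q)) \<in> \<pi>" "fst (ps ! q) < n" "snd (ps ! q) < n"
proof -
  show "arrays s ''fst'' q = fst (ps ! q)" "arrays s ''snd'' q = snd (ps ! q)"
    using assms by (simp_all add: mem_def list_array_def)
  show "(fst (ps ! q), snd (ps ! q)) \<in> \<pi>" using assms(2) set_ps nth_mem by fastforce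
  then show "fst (ps ! q) < n" "snd (ps ! q) < n" using po_less by blast+
qed

lemma mem_entry:
  "mem s \<Longrightarrow> x < n \<Longrightarrow> arrays s ''E'' (c * n + x) = of_bool (c \<in> nbs x)"
  using stores_matrixD[of n "arrays s ''E''" "\<lambda>u v. (u, v) \<in> A" x c] by (simp add: mem_def nbs_def)

lemma mem_simps:
  assumes "mem s"
  shows "vars s ''n'' = n" "vars s ''p'' = length ps" "arrays s ''K'' v = of_bool (v \<in> K)"
  using assms by (simp_all add: mem_def)

lemma wp_compare_prog:
  assumes m: "mem s" and x: "vars s ''x'' = x" "x < n" and y: "vars s ''y'' = y" "y < n"
    and ab: "vars s ''a'' = 0" "vars s ''b'' = 0"
  shows "wp compare_prog s (\<lambda>t s'. t \<le> n * 6 + 2 \<and>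
     (vars s' ''a'' = 0 \<and> vars s' ''b'' = 1 \<longleftrightarrow> nbs x \<subset> nbs y))"
  unfolding compare_prog_def
proof (rule wp_For[where N = n and T = 4 and
      I = "\<lambda>k s'. vars s' ''a'' = of_bool (\<exists>c\<in>nbs x - nbs y. c < k) \<and>
        vars s' ''b'' = of_bool (\<exists>c\<in>nbs y - nbs x. c < k)"], goal_cases)
  case (4 k s')
  have "mem s'" using 4(2) by (rule mem_frame) (simp_all add: m)
  moreover have "vars s' ''x'' = x" "vars s' ''y'' = y" using 4(2) x y by (simp_all add: frame_def)
  ultimately show ?case using 4(1,3,4) x y
    by (simp add: mem_simps mem_entry less_Suc_eq) blast
next
  case (5 t s')
  have "(\<exists>c\<in>nbs x - nbs y. c < n) \<longleftrightarrow> \<not> nbs x \<subseteq> nbs y" "(\<exists>c\<in>nbs y - nbs x. c < n) \<longleftrightarrow> \<not> nbs y \<subseteq> nbs x"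
    using adj_less by (auto simp: nbs_def)
  then show ?case using 5 by auto
qed (use m ab in \<open>auto simp: frame_def mem_def\<close>)

lemma wp_base_prog:
  assumes m: "mem s" and z: "arrays s ''base'' = (\<lambda>_. 0)" "arrays s ''early'' = (\<lambda>_. 0)"
  shows "wp base_prog s (\<lambda>t s'. t \<le> length ps * (n * 6 + 12) + 2 \<and>
     arrays s' ''base'' = (\<lambda>v. of_bool (base v)) \<and> arrays s' ''early'' = (\<lambda>v. of_bool (early v)))"
  unfolding base_prog_def
proof (rule wp_For[where N = "length ps" and T = "n * 6 + 10" and
      I = "\<lambda>k s'. arrays s' ''base'' = (\<lambda>v. of_bool (v \<notin> K \<and>
          (\<exists>y. (v, y) \<in> set (take k ps) \<and> (y \<in> K \<or> nbs v \<subset> nbs y)))) \<and>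
        arrays s' ''early'' = (\<lambda>v. of_bool (v \<notin> K \<and> (\<exists>y\<in>nbs v. (v, y) \<in> set (take k ps))))"], goal_cases)
  case (4 k s')
  have m': "mem s'" using 4(2) by (rule mem_frame) (simp_all add: m compare_prog_def)
  define x where "x = fst (ps ! k)"
  define y where "y = snd (ps ! k)"
  note pair = mem_pair[OF m' 4(1), folded x_def y_def]
  have tk: "(v, w) \<in> set (take (Suc k) ps) \<longleftrightarrow> v = x \<and> w = y \<or> (v, w) \<in> set (take k ps)" for v w
    using 4(1) by (auto simp: take_Suc_conv_app_nth x_def y_def prod_eq_iff)
  note simps = mem_simps[OF m'] mem_entry[OF m'] pair 4(3) conjunct1[OF 4(4)] conjunct2[OF 4(4)]
  consider "x \<in> K" | "x \<notin> K" "y \<in> K" | "x \<notin> K" "y \<notin> K" by blast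
  then show ?case
  proof cases
    case 1
    then show ?thesis by (auto simp: simps tk fun_eq_iff)
  next
    case 2
    then show ?thesis by (auto simp: simps tk fun_eq_iff)
  next
    case 3
    \<comment> \<open>A pair of independent vertices can affect \<open>base\<close> but not
      \<open>early\<close>.\<close>
    have ny: "y \<notin> nbs x" using indep[of y x] 3 by (auto simp: nbs_def)
    let ?s = "s'\<lparr>vars := (vars s')(''x'' := x, ''y'' := y, ''a'' := 0, ''b'' := 0)\<rparr>"
    have cmp: "wp compare_prog ?s (\<lambda>t s''. t \<le> n * 6 + 2 \<and>
        (vars s'' ''a'' = 0 \<and> vars s'' ''b'' = 1 \<longleftrightarrow> nbs x \<subset> nbs y) \<and>
        arrays s'' = arrays s' \<and> vars s'' ''x'' = x)"
      by (rule wp_frame[OF wp_compare_prog[where x = x and y = y]])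
        (use m' pair in \<open>auto simp: mem_def frame_def compare_prog_def fun_eq_iff\<close>)
    show ?thesis
    proof (simp add: simps 3, rule wp_mono[OF cmp], goal_cases)
      case (1 t s'')
      have b: "(\<lambda>v. of_bool (v \<notin> K \<and> (\<exists>y. (v, y) \<in> set (take (Suc k) ps) \<and> (y \<in> K \<or> nbs v \<subset> nbs y)))) =
          (\<lambda>v. of_bool (v = x \<and> nbs x \<subset> nbs y \<or> v \<notin> K \<and>
            (\<exists>y. (v, y) \<in> set (take k ps) \<and> (y \<in> K \<or> nbs v \<subset> nbs y))) :: nat)"
        unfolding tk using 3 by (intro ext arg_cong[of _ _ of_bool]) blast
      have e: "(\<lambda>v. of_bool (v \<notin> K \<and> (\<exists>y\<in>nbs v. (v, y) \<in> set (take (Suc k) ps)))) =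
          (\<lambda>v. of_bool (v \<notin> K \<and> (\<exists>y\<in>nbs v. (v, y) \<in> set (take k ps))) :: nat)"
        unfolding tk using ny by (intro ext arg_cong[of _ _ of_bool]) blast
      show ?case
      proof (cases "nbs x \<subset> nbs y")
        case True
        then show ?thesis unfolding b e using 1 4(4) by (simp add: of_bool_update)
      next
        case False
        then show ?thesis unfolding b e using 1 4(4) by auto
      qed
    qed
  qed
next
  case (5 t s')
  have "base = (\<lambda>v. v \<notin> K \<and> (\<exists>y. (v, y) \<in> set (take (length ps) ps) \<and> (y \<in> K \<or> nbs v \<subset> nbs y)))"
  proof (intro ext)
    fix v
    have "(v, y) \<in> \<pi> \<Longrightarrow> v < n \<and> y < n" for y using po_less by blast
    then show "base v = (v \<notin> K \<and> (\<exists>y. (v, y) \<in> set (take (length ps) ps) \<and> (y \<in> K \<or> nbs v \<subset> nbs y)))"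
      unfolding base_def ind_def take_all[OF order_refl] set_ps by blast
  qed
  moreover have "early = (\<lambda>v. v \<notin> K \<and> (\<exists>y\<in>nbs v. (v, y) \<in> set (take (length ps) ps)))"
  proof (intro ext)
    fix v
    have "(v, y) \<in> \<pi> \<Longrightarrow> v < n \<and> y < n" for y using po_less by blast
    then show "early v = (v \<notin> K \<and> (\<exists>y\<in>nbs v. (v, y) \<in> set (take (length ps) ps)))"
      unfolding early_def ind_def take_all[OF order_refl] set_ps by blast
  qed
  ultimately show ?case using 5 by (simp add: algebra_simps)
qed (use m z in \<open>auto simp: frame_def compare_prog_def mem_def\<close>)

lemma wp_premature_prog:
  assumes m: "mem s" and z: "arrays s ''base'' = (\<lambda>v. of_bool (base v))" "arrays s ''M'' = (\<lambda>_. 0)"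
  shows "wp premature_prog s (\<lambda>t s'. t \<le> length ps * 4 + 2 \<and> arrays s' ''M'' = (\<lambda>v. of_bool (v \<in> M)))"
  unfolding premature_prog_def
proof (rule wp_For[where N = "length ps" and T = 2 and
      I = "\<lambda>k s'. arrays s' ''M'' = (\<lambda>v. of_bool (\<exists>y. (v, y) \<in> set (take k ps) \<and> (v \<in> K \<or> base y)))"], goal_cases)
  case (4 k s')
  have m': "mem s'" using 4(2) by (rule mem_frame) (simp_all add: m)
  have b: "arrays s' ''base'' = (\<lambda>v. of_bool (base v))" using 4(2) z by (simp add: frame_def)
  have tk: "(v, w) \<in> set (take (Suc k) ps) \<longleftrightarrow> v = fst (ps ! k) \<and> w = snd (ps ! k) \<or> (v, w) \<in> set (take k ps)" for v w
    using 4(1) by (auto simp: take_Suc_conv_app_nth prod_eq_iff)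
  show ?case
    by (auto simp: mem_simps[OF m'] mem_pair[OF m' 4(1)] 4(3,4) b tk fun_eq_iff)
next
  case (5 t s')
  have "v \<in> M \<longleftrightarrow> (\<exists>y. (v, y) \<in> set (take (length ps) ps) \<and> (v \<in> K \<or> base y))" for v
    using po_refl[of v] po_less K_subset by (auto simp: M_def ind_def set_ps)
  then show ?case using 5 by simp
qed (use m z in \<open>auto simp: frame_def mem_def\<close>)

lemma wp_unique_prog:
  assumes m: "mem s" and e: "arrays s ''early'' = (\<lambda>v. of_bool (early v))"
  shows "wp unique_prog s (\<lambda>t s'. t \<le> n * (n * 4 + 4) + 3 \<and> vars s' ''answer'' = of_bool unique_early)"
proof -
  have "wp (For ''u'' sizeN unique_row_prog) (set_var s ''answer'' 1)
     (\<lambda>t s'. t \<le> n * (n * 4 + 4) + 2 \<and> vars s' ''answer'' = of_bool unique_early)"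
  proof (rule wp_For[where N = n and T = "n * 4 + 2" and
      I = "\<lambda>k s'. vars s' ''answer'' = of_bool (\<forall>x<k. \<forall>y<n. early x \<and> early y \<and> dg x = dg y \<longrightarrow> x = y)"], goal_cases)
    case (4 k s')
    have m': "mem s'" using 4(2) by (rule mem_frame) (use m in \<open>simp_all add: mem_def unique_row_prog_def\<close>)
    have e': "arrays s' ''early'' = (\<lambda>v. of_bool (early v))"
      using 4(2) e by (simp add: frame_def unique_row_prog_def)
    show ?case
      unfolding unique_row_prog_def
    proof (rule wp_For[where N = n and T = 2 and
        I = "\<lambda>l s''. vars s'' ''answer'' = of_bool ((\<forall>x<k. \<forall>y<n. early x \<and> early y \<and> dg x = dg y \<longrightarrow> x = y) \<and>
          (\<forall>y<l. early k \<and> early y \<and> dg k = dg y \<longrightarrow> k = y))"], goal_cases)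
      case l: (4 l s'')
      have "mem s''" using l(2) by (rule mem_frame) (simp_all add: m')
      moreover have "arrays s'' ''early'' = (\<lambda>v. of_bool (early v))" "vars s'' ''u'' = k"
        using l(2) e' 4(3) by (simp_all add: frame_def)
      ultimately show ?case using l(1,3,4) 4(1) by (auto simp: mem_def less_Suc_eq)
    next
      case l: (5 t s'')
      then show ?case by (auto simp: less_Suc_eq)
    qed (use 4(4) m' in \<open>auto simp: frame_def mem_def\<close>)
  next
    case (5 t s')
    have "unique_early \<longleftrightarrow> (\<forall>x<n. \<forall>y<n. early x \<and> early y \<and> dg x = dg y \<longrightarrow> x = y)"
      unfolding unique_early_def by (auto simp: early_def ind_def)
    then show ?case using 5 by (simp add: algebra_simps)
  qed (use m in \<open>auto simp: frame_def mem_def unique_row_prog_def\<close>)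
  then show ?thesis unfolding unique_prog_def by simp
qed

definition constraint_mem :: "ram_state \<Rightarrow> bool" where
  "constraint_mem s \<longleftrightarrow> mem s \<and> arrays s ''M'' = (\<lambda>v. of_bool (v \<in> M)) \<and>
     arrays s ''early'' = (\<lambda>v. of_bool (early v))"

lemma bval_edge_test:
  assumes m: "constraint_mem s" and uv: "vars s ''u'' = u" "vars s ''v'' = v" "u < n + n" "v < n + n"
  shows "bval edge_test s \<longleftrightarrow> edge u v"
proof -
  have mem: "mem s" and ME: "arrays s ''M'' = (\<lambda>v. of_bool (v \<in> M))" "arrays s ''early'' = (\<lambda>v. of_bool (early v))"
    using m by (auto simp: constraint_mem_def)
  have R: "v < n \<Longrightarrow> arrays s ''R'' (u * n + v) = of_bool ((u, v) \<in> \<pi>)"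
    using mem stores_matrixD[of n "arrays s ''R''" "\<lambda>u v. (u, v) \<in> \<pi>" v u] by (simp add: mem_def)
  have deg: "x < n \<Longrightarrow> arrays s ''deg'' x = dg x" for x using mem by (simp add: mem_def)
  show ?thesis
  proof (cases "u < n"; cases "v < n")
    assume "u < n" "v < n"
    then show ?thesis
      by (auto simp: edge_test_def edge_def uv mem_simps[OF mem] ME R mem_entry[OF mem] nbs_def)
  next
    assume *: "u < n" "\<not> v < n"
    define x where "x = v - n"
    have "v = n + x" "x < n" using * uv by (auto simp: x_def)
    with * show ?thesis
      by (auto simp: edge_test_def edge_def uv mem_simps[OF mem] ME mem_entry[OF mem] nbs_def)
  next
    assume *: "\<not> u < n" "v < n"
    define x where "x = u - n"
    have "u = n + x" "x < n" using * uv by (auto simp: x_def)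
    with * show ?thesis
      by (auto simp: edge_test_def edge_def uv mem_simps[OF mem] ME mem_entry[OF mem] deg nbs_def)
  next
    assume "\<not> u < n" "\<not> v < n"
    then show ?thesis by (simp add: edge_test_def edge_def uv mem_simps[OF mem])
  qed
qed

lemma wp_edge_prog:
  assumes m: "constraint_mem s" and z: "arrays s ''D'' = (\<lambda>_. 0)" "arrays s ''count'' = (\<lambda>_. 0)"
  shows "wp edge_prog s (\<lambda>t s'. t \<le> (n + n) * ((n + n) * 5 + 4) + 2 \<and>
     stores_matrix (n + n) (arrays s' ''D'') (\<lambda>u v. u < n + n \<and> edge u v) \<and>
     (\<forall>v<n + n. arrays s' ''count'' v = (\<Sum>u<n + n. of_bool (edge u v))))"
  unfolding edge_prog_def
proof (rule wp_For[where N = "n + n" and T = "(n + n) * 5 + 2" and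
      I = "\<lambda>k s'. stores_matrix (n + n) (arrays s' ''D'') (\<lambda>u v. u < k \<and> edge u v) \<and>
     (\<forall>v<n + n. arrays s' ''count'' v = (\<Sum>u<k. of_bool (edge u v)))"], goal_cases)
  case (4 k s')
  have m': "constraint_mem s'"
    using mem_frame[OF 4(2)] m 4(2) by (simp add: constraint_mem_def edge_row_prog_def frame_def)
  show ?case
    unfolding edge_row_prog_def
  proof (rule wp_For[where N = "n + n" and T = 3 and
      I = "\<lambda>l s''. stores_matrix (n + n) (arrays s'' ''D'') (\<lambda>u v. (u < k \<or> u = k \<and> v < l) \<and> edge u v) \<and>
     (\<forall>v<n + n. arrays s'' ''count'' v = (\<Sum>u<k. of_bool (edge u v)) + of_bool (v < l \<and> edge k v))"], goal_cases)
    case l: (4 l s'')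
    have m'': "constraint_mem s''"
      using mem_frame[OF l(2)] m' l(2) by (simp add: constraint_mem_def frame_def)
    have u: "vars s'' ''u'' = k" using l(2) 4(3) by (simp add: frame_def)
    note test = bval_edge_test[OF m'' u l(3) 4(1) l(1)]
    show ?case
    proof (cases "edge k l")
      case True
      have "stores_matrix (n + n) ((arrays s'' ''D'')(k * (n + n) + l := Suc 0))
          (\<lambda>u v. (u < k \<or> u = k \<and> v < Suc l) \<and> edge u v)"
        by (rule stores_matrix_update[OF conjunct1[OF l(4)] l(1)]) (use True in \<open>auto simp: less_Suc_eq\<close>)
      then show ?thesis using True test l(1,3,4) u m''
        by (auto simp: constraint_mem_def mem_simps less_Suc_eq)
    next
      case False
      have "stores_matrix (n + n) (arrays s'' ''D'') (\<lambda>u v. (u < k \<or> u = k \<and> v < Suc l) \<and> edge u v)"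
        by (rule stores_matrix_cong[OF conjunct1[OF l(4)]]) (use False in \<open>auto simp: less_Suc_eq\<close>)
      then show ?thesis using False test l(1,3,4)
        by (auto simp: less_Suc_eq)
    qed
  next
    case l: (5 t s'')
    have "stores_matrix (n + n) (arrays s'' ''D'') (\<lambda>u v. u < Suc k \<and> edge u v)"
      by (rule stores_matrix_cong[OF conjunct1[OF l(3)]]) (auto simp: less_Suc_eq)
    then show ?case using l by simp
  qed (use 4(4) m' in \<open>auto simp: frame_def constraint_mem_def mem_def\<close>)
next
  case (5 t s')
  then show ?case by (simp add: algebra_simps)
qed (use m z in \<open>auto simp: frame_def constraint_mem_def mem_def edge_row_prog_def stores_matrix_def\<close>)

text \<open>The pair number \<open>q\<close> forbids numbering \<open>c\<close> before some vertex adjacent only to the first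
  component.\<close>

definition blocks :: "nat \<Rightarrow> nat \<Rightarrow> bool" where
  "blocks q c \<longleftrightarrow> fst (ps ! q) \<notin> M \<and> c \<in> nbs (snd (ps ! q)) - nbs (fst (ps ! q))"

lemma blocks_less: "blocks q c \<Longrightarrow> c < n"
  using adj_less by (auto simp: blocks_def nbs_def)

lemma wp_block_prog:
  assumes m: "constraint_mem s"
  shows "wp block_prog s (\<lambda>t s'. t \<le> length ps * (n * 4 + 7) + 2 \<and>
     (\<forall>v. arrays s' ''count'' v = arrays s ''count'' v + (\<Sum>q<length ps. of_bool (blocks q v))))"
  unfolding block_prog_def
proof (rule wp_For[where N = "length ps" and T = "n * 4 + 5" and
      I = "\<lambda>k s'. \<forall>v. arrays s' ''count'' v = arrays s ''count'' v + (\<Sum>q<k. of_bool (blocks q v))"], goal_cases)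
  case (4 k s')
  have m': "constraint_mem s'"
    using mem_frame[OF 4(2)] m 4(2) by (simp add: constraint_mem_def block_row_prog_def frame_def)
  then have m1: "mem s'" by (simp add: constraint_mem_def)
  define x where "x = fst (ps ! k)"
  define y where "y = snd (ps ! k)"
  note pair = mem_pair[OF m1 4(1), folded x_def y_def]
  show ?case
  proof (cases "x \<in> M")
    case True
    then have "\<not> blocks k v" for v by (simp add: blocks_def x_def)
    then show ?thesis using True 4 m' pair by (simp add: constraint_mem_def)
  next
    case False
    let ?s = "s'\<lparr>vars := (vars s')(''x'' := x, ''y'' := y)\<rparr>"
    have "wp block_row_prog ?s (\<lambda>t s''. t + 3 \<le> n * 4 + 5 \<and>
      (\<forall>v. arrays s'' ''count'' v = arrays s ''count'' v + (\<Sum>q<Suc k. of_bool (blocks q v))))"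
      unfolding block_row_prog_def
    proof (rule wp_For[where N = n and T = 2 and
        I = "\<lambda>l s''. \<forall>v. arrays s'' ''count'' v = arrays s ''count'' v +
          (\<Sum>q<k. of_bool (blocks q v)) + of_bool (v < l \<and> blocks k v)"], goal_cases)
      case l: (4 l s'')
      have m'': "mem s''" using l(2) by (rule mem_frame) (use m1 in \<open>simp_all add: mem_def\<close>)
      have xy: "vars s'' ''x'' = x" "vars s'' ''y'' = y" using l(2) by (simp_all add: frame_def)
      have b: "blocks k v \<longleftrightarrow> v \<in> nbs y \<and> v \<notin> nbs x" for v using False by (simp add: blocks_def x_def y_def)
      show ?case using l(1,3,4)
        by (auto simp: xy mem_simps[OF m''] mem_entry[OF m''] pair b less_Suc_eq)
    next
      case l: (5 t s'')
      then show ?case using blocks_less by auto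
    qed (use 4(4) m1 in \<open>auto simp: frame_def mem_def\<close>)
    then show ?thesis using False m' pair 4(3) by (simp add: constraint_mem_def)
  qed
next
  case (5 t s')
  then show ?case by (simp add: algebra_simps)
qed (use m in \<open>auto simp: frame_def constraint_mem_def mem_def block_row_prog_def\<close>)

end

subsection \<open>Greedy numbering\<close>

definition find_prog :: com where
  "find_prog = For ''v'' nodes
     (If (Conj (is_zero (Read ''placed'' (Var ''v''))) (is_zero (Read ''count'' (Var ''v''))))
       (Seq (Assign ''f'' (Var ''v'')) (Assign ''found'' (Const 1))) Skip)"

definition release_edges_prog :: com where
  "release_edges_prog = For ''v'' nodes
     (If (is_one (Read ''D'' (Plus (Times (Var ''f'') nodes) (Var ''v''))))
       (Store ''count'' (Var ''v'') (Minus (Read ''count'' (Var ''v'')) (Const 1))) Skip)"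

definition release_row_prog :: com where
  "release_row_prog = For ''c'' sizeN
     (If (Conj (is_one (entry ''E'' (Var ''c'') (Var ''y''))) (is_zero (entry ''E'' (Var ''c'') (Var ''x''))))
       (Store ''count'' (Var ''c'') (Minus (Read ''count'' (Var ''c'')) (Const 1))) Skip)"

text \<open>\<open>f\<close> may be a virtual node; its row in the adjacency matrix reads as zero,
  so it settles no pair.\<close>

definition release_prog :: com where
  "release_prog = For ''q'' sizeP (Seq (Assign ''x'' (Read ''fst'' (Var ''q'')))
     (Seq (Assign ''y'' (Read ''snd'' (Var ''q'')))
     (If (Conj (is_zero (Read ''M'' (Var ''x''))) (Conj (is_zero (Read ''settled'' (Var ''q'')))
          (Conj (is_one (entry ''E'' (Var ''f'') (Var ''x''))) (is_zero (entry ''E'' (Var ''f'') (Var ''y''))))))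
       (Seq (Store ''settled'' (Var ''q'') (Const 1)) release_row_prog) Skip)))"

text \<open>A round without an available node leaves the counters alone, so later rounds fail too
  and the answer stays 0.\<close>

definition greedy_prog :: com where
  "greedy_prog = For ''r'' nodes (Seq (Assign ''found'' (Const 0)) (Seq find_prog
     (If (is_one (Var ''found''))
       (Seq (Store ''placed'' (Var ''f'') (Const 1)) (Seq release_edges_prog release_prog))
       (Assign ''answer'' (Const 0)))))"

section \<open>Correctness of the greedy numbering and of its counters\<close>

context split_program
begin

definition settled :: "nat set \<Rightarrow> nat \<Rightarrow> bool" where
  "settled S q \<longleftrightarrow> fst (ps ! q) \<notin> M \<and> S \<inter> (nbs (fst (ps ! q)) - nbs (snd (ps ! q))) \<noteq> {}"

definition avail :: "nat set \<Rightarrow> nat \<Rightarrow> bool" where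
  "avail S v \<longleftrightarrow> (\<forall>u. edge u v \<longrightarrow> u \<in> S) \<and> (\<forall>q<length ps. blocks q v \<longrightarrow> settled S q)"

text \<open>Predecessors and witnesses are required to lie in \<open>S\<close> itself, so enlarging
  \<open>S\<close> never disturbs constraints already met.\<close>

definition partial_rank :: "nat set \<Rightarrow> (nat \<Rightarrow> nat) \<Rightarrow> bool" where
  "partial_rank S \<rho> \<longleftrightarrow> (\<forall>u. \<forall>v\<in>S. edge u v \<longrightarrow> u \<in> S \<and> \<rho> u < \<rho> v) \<and>
     (\<forall>q<length ps. \<forall>c\<in>S. blocks q c \<longrightarrow>
        (\<exists>d\<in>S \<inter> (nbs (fst (ps ! q)) - nbs (snd (ps ! q))). \<rho> d < \<rho> c))"

lemma edge_nodes: "edge u v \<Longrightarrow> u < n + n \<and> v < n + n"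
  using M_less[of "u - n"] M_less[of "v - n"] by (auto simp: edge_def split: if_splits)

lemma admissible_iff:
  "admissible \<rho> \<longleftrightarrow> (\<forall>u v. edge u v \<longrightarrow> \<rho> u < \<rho> v) \<and> (\<forall>q<length ps. \<forall>c. blocks q c \<longrightarrow>
     (\<exists>d\<in>nbs (fst (ps ! q)) - nbs (snd (ps ! q)). \<rho> d < \<rho> c))"
proof -
  have "(\<forall>x y. (x, y) \<in> \<pi> \<longrightarrow> P x y) \<longleftrightarrow> (\<forall>q<length ps. P (fst (ps ! q)) (snd (ps ! q)))" for P
    unfolding set_ps[symmetric] by (metis in_set_conv_nth prod.collapse prod.sel)
  from this[of "\<lambda>x y. \<forall>c. x \<notin> M \<and> c \<in> nbs y - nbs x \<longrightarrow> (\<exists>d\<in>nbs x - nbs y. \<rho> d < \<rho> c)"]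
  show ?thesis unfolding admissible_def blocks_def by blast
qed

lemma partial_rank_all: "partial_rank {..<n + n} \<rho> \<Longrightarrow> admissible \<rho>"
  unfolding admissible_iff partial_rank_def using edge_nodes blocks_less
  by (metis IntE lessThan_iff trans_less_add1)

text \<open>One more than the sum of the old ranks exceeds each of them, and availability puts all
  predecessors and witnesses of \<open>v\<close> into \<open>S\<close>.\<close>

lemma partial_rank_insert:
  assumes r: "partial_rank S \<rho>" and S: "finite S" "v \<notin> S" and a: "avail S v"
  shows "\<exists>\<rho>. partial_rank (insert v S) \<rho>"
proof
  let ?\<rho> = "\<rho>(v := Suc (sum \<rho> S))"
  have less: "\<rho> u < Suc (sum \<rho> S)" if "u \<in> S" for u
    using member_le_sum[OF that, of \<rho>] S(1) by simp
  show "partial_rank (insert v S) ?\<rho>"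
    unfolding partial_rank_def
  proof (intro conjI allI ballI impI)
    fix u w assume w: "w \<in> insert v S" and e: "edge u w"
    show "u \<in> insert v S" using w e r a unfolding partial_rank_def avail_def by blast
    have "u \<in> S" using w e r a unfolding partial_rank_def avail_def by blast
    moreover have "\<rho> u < \<rho> w" if "w \<noteq> v" using w e r that unfolding partial_rank_def by blast
    ultimately show "?\<rho> u < ?\<rho> w" using less S(2) by auto
  next
    fix q c assume q: "q < length ps" and c: "c \<in> insert v S" and b: "blocks q c"
    let ?D = "nbs (fst (ps ! q)) - nbs (snd (ps ! q))"
    show "\<exists>d\<in>insert v S \<inter> ?D. ?\<rho> d < ?\<rho> c"
    proof (cases "c = v")
      case True
      then obtain d where "d \<in> S \<inter> ?D"
        using a b q unfolding avail_def settled_def by blast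
      then show ?thesis using True less S(2) by (intro bexI[of _ d]) auto
    next
      case False
      then obtain d where "d \<in> S \<inter> ?D" "\<rho> d < \<rho> c"
        using r b q c unfolding partial_rank_def by blast
      then show ?thesis using False S(2) by (intro bexI[of _ d]) auto
    qed
  qed
qed

text \<open>Under an admissible rank, the unplaced node of least rank has its predecessors and
  witnesses at smaller ranks, hence already placed, and would be available. This is why no
  backtracking is required.\<close>

lemma stuck_not_admissible:
  assumes S: "S \<subset> {..<n + n}" and stuck: "\<forall>v<n + n. v \<notin> S \<longrightarrow> \<not> avail S v"
  shows "\<not> admissible \<rho>"
proof
  assume adm: "admissible \<rho>"
  have "finite ({..<n + n} - S)" "{..<n + n} - S \<noteq> {}" using S by auto
  then obtain v where v: "v \<in> {..<n + n} - S" "\<And>u. u \<in> {..<n + n} - S \<Longrightarrow> \<rho> v \<le> \<rho> u"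
    using arg_min_if_finite[of "{..<n + n} - S" \<rho>] by (metis linorder_not_less)
  have in_S: "u \<in> S" if "u < n + n" "\<rho> u < \<rho> v" for u
    using v(2)[of u] that by force
  have "avail S v"
    unfolding avail_def
  proof (intro conjI allI impI)
    fix u assume "edge u v"
    then show "u \<in> S" using in_S edge_nodes adm unfolding admissible_iff by blast
  next
    fix q assume q: "q < length ps" and b: "blocks q v"
    then obtain d where "d \<in> nbs (fst (ps ! q)) - nbs (snd (ps ! q))" "\<rho> d < \<rho> v"
      using adm unfolding admissible_iff by blast
    moreover then have "d < n + n" using adj_less[of d] by (fastforce simp: nbs_def)
    ultimately show "settled S q" using in_S b unfolding settled_def blocks_def by blast
  qed
  then show False using stuck v by auto
qed

definition pending :: "nat set \<Rightarrow> nat \<Rightarrow> nat" where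
  "pending S v = (\<Sum>u<n + n. of_bool (edge u v \<and> u \<notin> S)) +
     (\<Sum>q<length ps. of_bool (blocks q v \<and> \<not> settled S q))"

lemma pending_eq_0_iff: "pending S v = 0 \<longleftrightarrow> avail S v"
  unfolding pending_def avail_def using edge_nodes by auto

lemma settled_insert: "settled S q \<Longrightarrow> settled (insert f S) q"
  by (auto simp: settled_def)

text \<open>Stated with truncated subtractions, which compose, so that the loops need no lower bound on
  the counters.\<close>

lemma pending_insert:
  assumes "f < n + n" "f \<notin> S"
  shows "pending (insert f S) v = pending S v - of_bool (edge f v) -
     (\<Sum>q<length ps. of_bool (blocks q v \<and> settled (insert f S) q \<and> \<not> settled S q))"
proof -
  have "(\<Sum>u<n + n. of_bool (edge u v \<and> u \<notin> S)) =
      of_bool (edge f v) + (\<Sum>u\<in>{..<n + n} - {f}. of_bool (edge u v \<and> u \<notin> S) :: nat)"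
    using assms by (subst sum.remove[of _ f]) auto
  moreover have "(\<Sum>u<n + n. of_bool (edge u v \<and> u \<notin> insert f S)) =
      (\<Sum>u\<in>{..<n + n} - {f}. of_bool (edge u v \<and> u \<notin> S) :: nat)"
    using assms by (subst sum.remove[of _ f]) (auto intro!: sum.cong)
  moreover have "(\<Sum>q<length ps. of_bool (blocks q v \<and> \<not> settled S q) :: nat) =
      (\<Sum>q<length ps. of_bool (blocks q v \<and> \<not> settled (insert f S) q)) +
      (\<Sum>q<length ps. of_bool (blocks q v \<and> settled (insert f S) q \<and> \<not> settled S q))"
    unfolding sum.distrib[symmetric] by (intro sum.cong) (auto dest: settled_insert)
  ultimately show ?thesis unfolding pending_def by simp
qed

lemma wp_find_prog:
  assumes n: "vars s ''n'' = n" and S: "arrays s ''placed'' = (\<lambda>v. of_bool (v \<in> S))"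
    and f: "vars s ''found'' = 0"
  shows "wp find_prog s (\<lambda>t s'. t \<le> (n + n) * 5 + 2 \<and>
     (vars s' ''found'' = 1 \<and> vars s' ''f'' < n + n \<and> vars s' ''f'' \<notin> S \<and> arrays s ''count'' (vars s' ''f'') = 0 \<or>
      vars s' ''found'' = 0 \<and> (\<forall>v<n + n. v \<notin> S \<longrightarrow> arrays s ''count'' v \<noteq> 0)))"
  unfolding find_prog_def
proof (rule wp_For[where N = "n + n" and T = 3 and
      I = "\<lambda>k s'. vars s' ''found'' = 1 \<and> vars s' ''f'' < n + n \<and> vars s' ''f'' \<notin> S \<and> arrays s ''count'' (vars s' ''f'') = 0 \<or>
      vars s' ''found'' = 0 \<and> (\<forall>v<k. v \<notin> S \<longrightarrow> arrays s ''count'' v \<noteq> 0)"], goal_cases)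
  case (4 k s')
  then have "arrays s' ''placed'' = (\<lambda>v. of_bool (v \<in> S))" "arrays s' ''count'' = arrays s ''count''"
    using S by (simp_all add: frame_def)
  then show ?case using 4(1,3,4) by (auto simp: less_Suc_eq)
qed (use n f in \<open>auto simp: frame_def\<close>)

lemma wp_release_edges_prog:
  assumes n: "vars s ''n'' = n" and f: "vars s ''f'' = f" "f < n + n"
    and D: "stores_matrix (n + n) (arrays s ''D'') (\<lambda>u v. u < n + n \<and> edge u v)"
  shows "wp release_edges_prog s (\<lambda>t s'. t \<le> (n + n) * 4 + 2 \<and>
     (\<forall>v<n + n. arrays s' ''count'' v = arrays s ''count'' v - of_bool (edge f v)))"
  unfolding release_edges_prog_def
proof (rule wp_For[where N = "n + n" and T = 2 and
      I = "\<lambda>k s'. \<forall>v<n + n. arrays s' ''count'' v = arrays s ''count'' v - of_bool (v < k \<and> edge f v)"], goal_cases)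
  case (4 k s')
  then have "vars s' ''n'' = n" "vars s' ''f'' = f" "arrays s' ''D'' (f * (n + n) + k) = of_bool (edge f k)"
    using n f stores_matrixD[OF D, of k f] by (simp_all add: frame_def)
  then show ?case using 4(1,3,4) by (auto simp: less_Suc_eq)
qed (use n in \<open>auto simp: frame_def\<close>)

lemma wp_release_row_prog:
  assumes m: "mem s" and x: "vars s ''x'' = x" "x < n" and y: "vars s ''y'' = y" "y < n"
  shows "wp release_row_prog s (\<lambda>t s'. t \<le> n * 4 + 2 \<and>
     (\<forall>v. arrays s' ''count'' v = arrays s ''count'' v - of_bool (v \<in> nbs y - nbs x)))"
  unfolding release_row_prog_def
proof (rule wp_For[where N = n and T = 2 and
      I = "\<lambda>k s'. \<forall>v. arrays s' ''count'' v = arrays s ''count'' v - of_bool (v < k \<and> v \<in> nbs y - nbs x)"], goal_cases)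
  case (4 k s')
  have m': "mem s'" using 4(2) by (rule mem_frame) (use m in simp_all)
  have xy: "vars s' ''x'' = x" "vars s' ''y'' = y" using 4(2) x y by (simp_all add: frame_def)
  show ?case using 4(1,3,4)
    by (auto simp: xy mem_simps[OF m'] mem_entry[OF m'] x(2) y(2) less_Suc_eq)
next
  case (5 t s')
  have "v \<in> nbs y \<Longrightarrow> v < n" for v using adj_less by (auto simp: nbs_def)
  then show ?case using 5 by auto
qed (use m in \<open>auto simp: frame_def mem_def\<close>)

text \<open>The row loop is charged to the pairs that \<open>f\<close> newly settles. Any other pair
  costs 6: two assignments, the test, the empty branch and two for the loop.\<close>

lemma wp_release_prog:
  assumes m: "constraint_mem s" and f: "vars s ''f'' = f"
    and S: "\<forall>q<length ps. arrays s ''settled'' q = of_bool (settled S q)"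
  shows "wp release_prog s (\<lambda>t s'. t \<le> length ps * 6 +
        (4 * n + 4) * (\<Sum>q<length ps. of_bool (settled (insert f S) q \<and> \<not> settled S q)) + 2 \<and>
     (\<forall>q<length ps. arrays s' ''settled'' q = of_bool (settled (insert f S) q)) \<and>
     (\<forall>v. arrays s' ''count'' v = arrays s ''count'' v -
       (\<Sum>q<length ps. of_bool (blocks q v \<and> settled (insert f S) q \<and> \<not> settled S q))))"
  unfolding release_prog_def
proof (rule wp_For_time[where N = "length ps" and
      I = "\<lambda>k \<tau> s'. \<tau> \<le> k * 6 + (4 * n + 4) * (\<Sum>q<k. of_bool (settled (insert f S) q \<and> \<not> settled S q)) + 1 \<and>
     (\<forall>q<length ps. arrays s' ''settled'' q = of_bool (if q < k then settled (insert f S) q else settled S q)) \<and>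
     (\<forall>v. arrays s' ''count'' v = arrays s ''count'' v -
       (\<Sum>q<k. of_bool (blocks q v \<and> settled (insert f S) q \<and> \<not> settled S q)))"], goal_cases)
  case (4 k \<tau> s')
  have m': "constraint_mem s'"
    using mem_frame[OF 4(2)] m 4(2) by (simp add: constraint_mem_def release_row_prog_def frame_def)
  have m1: "mem s'" and M': "arrays s' ''M'' = (\<lambda>v. of_bool (v \<in> M))"
    using m' by (simp_all add: constraint_mem_def)
  have f': "vars s' ''f'' = f" using 4(2) f by (simp add: frame_def release_row_prog_def)
  define x where "x = fst (ps ! k)"
  define y where "y = snd (ps ! k)"
  note pair = mem_pair[OF m1 4(1), folded x_def y_def]
  define new where "new \<longleftrightarrow> x \<notin> M \<and> \<not> settled S k \<and> f \<in> nbs x \<and> f \<notin> nbs y"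
  have new: "settled (insert f S) k \<and> \<not> settled S k \<longleftrightarrow> new"
    by (auto simp: settled_def new_def x_def y_def)
  have t: "arrays s' ''settled'' k = of_bool (settled S k)" using 4(1,4) by simp
  have fE: "arrays s' ''E'' (f * n + z) = of_bool (f \<in> nbs z)" if "z < n" for z
    using mem_entry[OF m1 that] .
  note simps = mem_simps[OF m1] pair 4(3) M' f' t fE[OF pair(4)] fE[OF pair(5)]
  show ?case
  proof (cases new)
    case True
    let ?s = "s'\<lparr>vars := (vars s')(''x'' := x, ''y'' := y),
       arrays := (arrays s')(''settled'' := (arrays s' ''settled'')(k := 1))\<rparr>"
    have "wp release_row_prog ?s (\<lambda>t s''. t \<le> n * 4 + 2 \<and>
       (\<forall>v. arrays s'' ''count'' v = arrays s' ''count'' v - of_bool (v \<in> nbs y - nbs x)) \<and>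
       arrays s'' ''settled'' = (arrays s' ''settled'')(k := 1))"
      by (rule wp_frame[OF wp_release_row_prog[where x = x and y = y]])
        (use m1 pair in \<open>auto simp: mem_def frame_def release_row_prog_def\<close>)
    note row = this
    have b: "blocks k v \<longleftrightarrow> v \<in> nbs y - nbs x" for v
      using True by (simp add: blocks_def new_def x_def y_def)
    have st: "settled (insert f S) k" "\<not> settled S k" using True new by auto
    have nd: "x \<notin> M" "f \<in> nbs x" "f \<notin> nbs y" using True by (auto simp: new_def)
    show ?thesis
    proof (simp add: simps nd st, rule wp_mono[OF row[simplified]], goal_cases)
      case (1 t s'')
      then show ?case using 4(4) st b by (auto simp: less_Suc_eq algebra_simps)
    qed
  next
    case False
    have c: "\<not> (x \<notin> M \<and> \<not> settled S k \<and> f \<in> nbs x \<and> f \<notin> nbs y)" using False by (simp add: new_def)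
    have nd: "settled (insert f S) k \<longleftrightarrow> settled S k" using False new settled_insert by blast
    show ?thesis using 4(4) c nd
      by (auto simp: simps less_Suc_eq)
  qed
next
  case (5 \<tau> s')
  then show ?case by simp
qed (use m S in \<open>auto simp: frame_def constraint_mem_def mem_def release_row_prog_def\<close>)

text \<open>The number of settled pairs is the potential: it never decreases and is at most
  \<open>length ps\<close>, which bounds all row loops together. While the answer is 1 every round
  has placed a node; the answer 0 certifies that the constraints are unsatisfiable, by
  \<open>unique_early\<close> or by a stuck round.\<close>

lemma wp_greedy_prog:
  assumes m: "constraint_mem s"
    and D: "stores_matrix (n + n) (arrays s ''D'') (\<lambda>u v. u < n + n \<and> edge u v)"
    and z: "arrays s ''placed'' = (\<lambda>_. 0)" "arrays s ''settled'' = (\<lambda>_. 0)"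
    and cnt: "\<forall>v<n + n. arrays s ''count'' v = pending {} v"
    and ans: "vars s ''answer'' = of_bool unique_early"
  shows "wp greedy_prog s (\<lambda>t s'. t \<le> (n + n) * ((n + n) * 9 + length ps * 6 + 13) + (4 * n + 4) * length ps + 2 \<and>
     vars s' ''answer'' = of_bool (unique_early \<and> (\<exists>\<rho>. admissible \<rho>)))"
  unfolding greedy_prog_def
proof (rule wp_For_time[where N = "n + n" and
      I = "\<lambda>k \<tau> s'. \<exists>S. S \<subseteq> {..<n + n} \<and> arrays s' ''placed'' = (\<lambda>v. of_bool (v \<in> S)) \<and>
        (\<forall>q<length ps. arrays s' ''settled'' q = of_bool (settled S q)) \<and>
        (\<forall>v<n + n. arrays s' ''count'' v = pending S v) \<and>
        (vars s' ''answer'' = 1 \<and> card S = k \<and> unique_early \<and> (\<exists>\<rho>. partial_rank S \<rho>) \<or>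
         vars s' ''answer'' = 0 \<and> \<not> (unique_early \<and> (\<exists>\<rho>. admissible \<rho>))) \<and>
        \<tau> \<le> k * ((n + n) * 9 + length ps * 6 + 13) + (4 * n + 4) * (\<Sum>q<length ps. of_bool (settled S q)) + 1"], goal_cases)
  case 1
  then show ?case by (simp add: find_prog_def release_edges_prog_def release_prog_def release_row_prog_def)
next
  case (2 s')
  then show ?case using m
    by (simp add: frame_def find_prog_def release_edges_prog_def release_prog_def release_row_prog_def
        constraint_mem_def mem_def)
next
  case 3
  have "partial_rank {} \<rho>" for \<rho> by (simp add: partial_rank_def)
  moreover have "\<not> settled {} q" for q by (simp add: settled_def)
  ultimately show ?case using z cnt ans by (intro exI[of _ "{}"]) auto
next
  case (4 k \<tau> s')
  then obtain S where S: "S \<subseteq> {..<n + n}" "arrays s' ''placed'' = (\<lambda>v. of_bool (v \<in> S))"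
        "\<forall>q<length ps. arrays s' ''settled'' q = of_bool (settled S q)"
        "\<forall>v<n + n. arrays s' ''count'' v = pending S v"
        "vars s' ''answer'' = 1 \<and> card S = k \<and> unique_early \<and> (\<exists>\<rho>. partial_rank S \<rho>) \<or>
         vars s' ''answer'' = 0 \<and> \<not> (unique_early \<and> (\<exists>\<rho>. admissible \<rho>))"
        "\<tau> \<le> k * ((n + n) * 9 + length ps * 6 + 13) + (4 * n + 4) * (\<Sum>q<length ps. of_bool (settled S q)) + 1"
    by blast
  have m': "constraint_mem s'" and D': "arrays s' ''D'' = arrays s ''D''"
    using mem_frame[OF 4(2)] m 4(2)
    by (simp_all add: constraint_mem_def find_prog_def release_edges_prog_def release_prog_def
        release_row_prog_def frame_def)
  have n': "vars s' ''n'' = n" using m' by (simp add: constraint_mem_def mem_def)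
  let ?s = "set_var s' ''found'' 0"
  have find: "wp find_prog ?s (\<lambda>t s1. t \<le> (n + n) * 5 + 2 \<and> arrays s1 = arrays s' \<and>
      vars s1 ''answer'' = vars s' ''answer'' \<and> constraint_mem s1 \<and>
     (vars s1 ''found'' = 1 \<and> vars s1 ''f'' < n + n \<and> vars s1 ''f'' \<notin> S \<and> avail S (vars s1 ''f'') \<or>
      vars s1 ''found'' = 0 \<and> (\<forall>v<n + n. v \<notin> S \<longrightarrow> \<not> avail S v)))"
  proof (rule wp_frame[OF wp_find_prog[where S = S]], goal_cases)
    case f: (4 t s1)
    have fr: "arrays s1 = arrays s'" "vars s1 ''answer'' = vars s' ''answer''" "vars s1 ''n'' = vars s' ''n''"
        "vars s1 ''p'' = vars s' ''p''"
      using f(2) by (simp_all add: frame_def find_prog_def fun_eq_iff)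
    have "constraint_mem s1" using m' fr by (simp add: constraint_mem_def mem_def)
    moreover have "arrays ?s ''count'' v = 0 \<longleftrightarrow> avail S v" if "v < n + n" for v
      using S(4) that pending_eq_0_iff by simp
    ultimately show ?case using f(1) fr by blast
  qed (use n' S(2) in simp_all)
  show ?case
  proof (simp, rule wp_mono[OF find[simplified]], goal_cases)
    case (1 t1 s1)
    show ?case
    proof (cases "vars s1 ''found'' = Suc 0")
      case False
      then have stuck: "\<forall>v<n + n. v \<notin> S \<longrightarrow> \<not> avail S v" using 1 by auto
      \<comment> \<open>With only \<open>k\<close> nodes placed some are left, and being stuck
        refutes admissibility; otherwise the answer was already 0.\<close>
      have "\<not> (unique_early \<and> (\<exists>\<rho>. admissible \<rho>))"
      proof (cases "card S = k")
        case True
        then have "S \<subset> {..<n + n}" using S(1) 4(1) by auto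
        then show ?thesis using stuck_not_admissible stuck by blast
      next
        case False
        then show ?thesis using S(5) by blast
      qed
      then show ?thesis using False 1 S by (auto intro!: exI[of _ S])
    next
      case True
      define f where "f = vars s1 ''f''"
      have f: "f < n + n" "f \<notin> S" "avail S f" using True 1 by (auto simp: f_def)
      let ?S = "insert f S"
      let ?s1 = "s1\<lparr>arrays := (arrays s')(''placed'' := (arrays s' ''placed'')(f := 1))\<rparr>"
      have m1: "constraint_mem ?s1" using 1 m' by (auto simp: constraint_mem_def mem_def)
      have n1: "vars s1 ''n'' = n" using 1 by (auto simp: constraint_mem_def mem_def)
      have edges: "wp release_edges_prog ?s1 (\<lambda>t s2. t \<le> (n + n) * 4 + 2 \<and>
          (\<forall>v<n + n. arrays s2 ''count'' v = pending S v - of_bool (edge f v)) \<and> constraint_mem s2 \<and>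
          vars s2 ''f'' = f \<and> vars s2 ''answer'' = vars s1 ''answer'' \<and>
          arrays s2 ''placed'' = (\<lambda>v. of_bool (v \<in> ?S)) \<and> arrays s2 ''settled'' = arrays s' ''settled'')"
      proof (rule wp_frame[OF wp_release_edges_prog[where f = f]], goal_cases)
        case e: (5 t s2)
        have fr: "vars s2 ''n'' = vars s1 ''n''" "vars s2 ''p'' = vars s1 ''p''" "vars s2 ''f'' = f"
          "vars s2 ''answer'' = vars s1 ''answer''"
          using e(2) by (simp_all add: frame_def release_edges_prog_def f_def)
        have fa: "arrays s2 a = arrays ?s1 a" if "a \<noteq> ''count''" for a
          using e(2) that by (simp add: frame_def release_edges_prog_def)
        have "constraint_mem s2" using m1 fr fa by (simp add: constraint_mem_def mem_def)
        moreover have "arrays s2 ''placed'' = (\<lambda>v. of_bool (v \<in> ?S))"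
          using fa S(2) by (auto simp: fun_eq_iff)
        moreover have "arrays s2 ''settled'' = arrays s' ''settled''" using fa by simp
        ultimately show ?case using e(1) fr S(4) by simp
      qed (use n1 f D D' in \<open>simp_all add: f_def\<close>)
      have release: "wp release_edges_prog ?s1 (\<lambda>t s2. t \<le> (n + n) * 4 + 2 \<and> wp release_prog s2 (\<lambda>t s3.
          t \<le> length ps * 6 + (4 * n + 4) * (\<Sum>q<length ps. of_bool (settled ?S q \<and> \<not> settled S q)) + 2 \<and>
          (\<forall>q<length ps. arrays s3 ''settled'' q = of_bool (settled ?S q)) \<and>
          (\<forall>v<n + n. arrays s3 ''count'' v = pending ?S v) \<and>
          vars s3 ''answer'' = vars s1 ''answer'' \<and> arrays s3 ''placed'' = (\<lambda>v. of_bool (v \<in> ?S))))"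
      proof (rule wp_mono[OF edges], goal_cases)
        case e: (1 t2 s2)
        have "wp release_prog s2 (\<lambda>t s3.
          t \<le> length ps * 6 + (4 * n + 4) * (\<Sum>q<length ps. of_bool (settled ?S q \<and> \<not> settled S q)) + 2 \<and>
          (\<forall>q<length ps. arrays s3 ''settled'' q = of_bool (settled ?S q)) \<and>
          (\<forall>v<n + n. arrays s3 ''count'' v = pending ?S v) \<and>
          vars s3 ''answer'' = vars s1 ''answer'' \<and> arrays s3 ''placed'' = (\<lambda>v. of_bool (v \<in> ?S)))"
        proof (rule wp_frame[OF wp_release_prog[where f = f and S = S]], goal_cases)
          case r: (4 t3 s3)
          then show ?case using e pending_insert[OF f(1,2)]
            by (simp add: frame_def release_prog_def release_row_prog_def)
        qed (use e S(3) in auto)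
        then show ?case using e by blast
      qed
      have sum: "(\<Sum>q<length ps. of_bool (settled ?S q)) = (\<Sum>q<length ps. of_bool (settled S q)) +
          (\<Sum>q<length ps. of_bool (settled ?S q \<and> \<not> settled S q) :: nat)"
        unfolding sum.distrib[symmetric] by (intro sum.cong) (auto dest: settled_insert)
      have inv: "vars s1 ''answer'' = 1 \<and> card ?S = Suc k \<and> unique_early \<and> (\<exists>\<rho>. partial_rank ?S \<rho>) \<or>
         vars s1 ''answer'' = 0 \<and> \<not> (unique_early \<and> (\<exists>\<rho>. admissible \<rho>))"
      proof -
        have fin: "finite S" using S(1) finite_subset by blast
        show ?thesis using S(5) partial_rank_insert[OF _ fin f(2,3)] f(2) fin 1 by auto
      qed
      have a1: "arrays s1 = arrays s'" using 1 by blast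
      show ?thesis
      proof (simp add: True a1 f_def[symmetric], rule wp_mono[OF release[simplified]], goal_cases)
        case r: (1 t2 s2)
        then have r1: "t2 \<le> (n + n) * 4 + 2" by simp
        show ?case
        proof (rule wp_mono[OF conjunct2[OF r]], goal_cases)
          case r3: (1 t3 s3)
          have t: "\<tau> + Suc (Suc (Suc (Suc (t1 + (t2 + t3) + 1)))) \<le> Suc k * ((n + n) * 9 + length ps * 6 + 13) +
              (4 * n + 4) * (\<Sum>q<length ps. of_bool (settled ?S q)) + 1"
            using r1 r3 1 S(6) unfolding sum by (simp add: algebra_simps)
          have "?S \<subseteq> {..<n + n}" using f S(1) by auto
          then show ?case using t inv r3 by (intro exI[of _ ?S]) (simp add: algebra_simps)
        qed
      qed
    qed
  qed
next
  case (5 \<tau> s')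
  then obtain S where S: "S \<subseteq> {..<n + n}"
        "vars s' ''answer'' = 1 \<and> card S = n + n \<and> unique_early \<and> (\<exists>\<rho>. partial_rank S \<rho>) \<or>
         vars s' ''answer'' = 0 \<and> \<not> (unique_early \<and> (\<exists>\<rho>. admissible \<rho>))"
        "\<tau> \<le> (n + n) * ((n + n) * 9 + length ps * 6 + 13) + (4 * n + 4) * (\<Sum>q<length ps. of_bool (settled S q)) + 1"
    by blast
  have "(\<Sum>q<length ps. of_bool (settled S q)) \<le> (\<Sum>q<length ps. 1 :: nat)"
    by (rule sum_mono) simp
  then have "(4 * n + 4) * (\<Sum>q<length ps. of_bool (settled S q)) \<le> (4 * n + 4) * length ps"
    by (intro mult_le_mono2) simp
  with S(3) have "Suc \<tau> \<le> (n + n) * ((n + n) * 9 + length ps * 6 + 13) + (4 * n + 4) * length ps + 2"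
    by linarith
  moreover have "S = {..<n + n}" if "card S = n + n"
    using S(1) that by (intro card_subset_eq) auto
  then have "vars s' ''answer'' = of_bool (unique_early \<and> (\<exists>\<rho>. admissible \<rho>))"
    using S(2) partial_rank_all by auto
  ultimately show ?case by blast
qed

end

section \<open>The decision procedure\<close>

definition constraint_prog :: com where
  "constraint_prog = Seq base_prog (Seq premature_prog (Seq unique_prog
     (Seq edge_prog (Seq block_prog greedy_prog))))"

definition decision_prog :: com where
  "decision_prog = Seq matrix_prog (Seq relation_prog (Seq split_prog constraint_prog))"

lemmas prog_defs = row_prog_def matrix_prog_def relation_prog_def select_prog_def test_prog_def
  split_prog_def compare_prog_def base_prog_def premature_prog_def unique_row_prog_def
  unique_prog_def edge_test_def edge_row_prog_def edge_prog_def block_row_prog_def block_prog_def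
  find_prog_def release_edges_prog_def release_row_prog_def release_prog_def greedy_prog_def

lemma frame_arrays: "frame c s s' \<Longrightarrow> a \<notin> written_arrays c \<Longrightarrow> arrays s' a = arrays s a"
  by (simp add: frame_def)

lemma written_progs:
  "written_vars matrix_prog = {''u'', ''d'', ''j''}"
  "written_arrays matrix_prog = {''deg'', ''E''}"
  "written_vars relation_prog = {''q''}"
  "written_arrays relation_prog = {''R''}"
  "written_vars split_prog = {''r'', ''g'', ''u'', ''b'', ''o''}"
  "written_arrays split_prog = {''done'', ''K''}"
  "written_vars base_prog = {''q'', ''x'', ''y'', ''c'', ''a'', ''b''}"
  "written_arrays base_prog = {''base'', ''early''}"
  "written_vars premature_prog = {''q''}"
  "written_arrays premature_prog = {''M''}"
  "written_vars unique_prog = {''answer'', ''u'', ''v''}"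
  "written_arrays unique_prog = {}"
  "written_vars edge_prog = {''u'', ''v''}"
  "written_arrays edge_prog = {''D'', ''count''}"
  "written_vars block_prog = {''q'', ''x'', ''y'', ''c''}"
  "written_arrays block_prog = {''count''}"
  by (auto simp: prog_defs)

context split_program
begin

text \<open>Each phase relies on its arrays still being zero; the frame conditions carry this past
  the phases before it.\<close>

lemma wp_constraint_prog:
  assumes m: "mem s"
    and z: "\<And>a. a \<in> {''base'', ''early'', ''M'', ''D'', ''count'', ''placed'', ''settled''} \<Longrightarrow>
      arrays s a = (\<lambda>_. 0)"
  shows "wp constraint_prog s (\<lambda>t s'. t \<le> length ps * (n * 6 + 12) + 2 + (length ps * 4 + 2) +
      (n * (n * 4 + 4) + 3) + ((n + n) * ((n + n) * 5 + 4) + 2) + (length ps * (n * 4 + 7) + 2) +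
      ((n + n) * ((n + n) * 9 + length ps * 6 + 13) + (4 * n + 4) * length ps + 2) \<and>
     vars s' ''answer'' = of_bool (unique_early \<and> (\<exists>\<rho>. admissible \<rho>)))"
  unfolding constraint_prog_def wp_Seq
proof (rule wp_frame[OF wp_base_prog], goal_cases)
  case s1: (4 t1 s1)
  have m1: "mem s1" using s1(2) by (rule mem_frame) (simp_all add: m written_progs)
  have z1: "arrays s1 a = (\<lambda>_. 0)" if "a \<in> {''M'', ''D'', ''count'', ''placed'', ''settled''}" for a
  proof -
    have "a \<notin> written_arrays base_prog" using that by (auto simp: written_progs)
    then have "arrays s1 a = arrays s a" by (rule frame_arrays[OF s1(2)])
    also have "\<dots> = (\<lambda>_. 0)" by (rule z) (use that in blast)
    finally show ?thesis .
  qed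
  show ?case
  proof (rule wp_frame[OF wp_premature_prog], goal_cases)
    case s2: (4 t2 s2)
    have m2: "mem s2" using s2(2) by (rule mem_frame) (simp_all add: m1 written_progs)
    have z2: "arrays s2 a = (\<lambda>_. 0)" if "a \<in> {''D'', ''count'', ''placed'', ''settled''}" for a
    proof -
      have "a \<notin> written_arrays premature_prog" using that by (auto simp: written_progs)
      then have "arrays s2 a = arrays s1 a" by (rule frame_arrays[OF s2(2)])
      also have "\<dots> = (\<lambda>_. 0)" by (rule z1) (use that in blast)
      finally show ?thesis .
    qed
    have e2: "arrays s2 ''early'' = (\<lambda>v. of_bool (early v))"
      using s2(2) s1(1) by (simp add: frame_def written_progs)
    show ?case
    proof (rule wp_frame[OF wp_unique_prog], goal_cases)
      case s3: (3 t3 s3)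
      have "mem s3" using s3(2) by (rule mem_frame) (simp_all add: m2 written_progs)
      moreover have a3: "arrays s3 a = arrays s2 a" for a using s3(2) by (simp add: frame_def written_progs)
      ultimately have m3: "constraint_mem s3" using s2(1) e2 by (simp add: constraint_mem_def)
      show ?case
      proof (rule wp_frame[OF wp_edge_prog], goal_cases)
        case s4: (4 t4 s4)
        have v4: "\<And>a. a \<notin> {''D'', ''count''} \<Longrightarrow> arrays s4 a = arrays s3 a"
            "vars s4 ''n'' = vars s3 ''n''" "vars s4 ''p'' = vars s3 ''p''" "vars s4 ''answer'' = vars s3 ''answer''"
          using s4(2) by (simp_all add: frame_def written_progs)
        have m4: "constraint_mem s4" using m3 v4 by (simp add: constraint_mem_def mem_def)
        show ?case
        proof (rule wp_frame[OF wp_block_prog], goal_cases)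
          case s5: (2 t5 s5)
          have v5: "\<And>a. a \<noteq> ''count'' \<Longrightarrow> arrays s5 a = arrays s4 a"
              "vars s5 ''n'' = vars s4 ''n''" "vars s5 ''p'' = vars s4 ''p''" "vars s5 ''answer'' = vars s4 ''answer''"
            using s5(2) by (simp_all add: frame_def written_progs)
          have m5: "constraint_mem s5" using m4 v5 by (simp add: constraint_mem_def mem_def)
          have c5: "\<forall>v<n + n. arrays s5 ''count'' v = pending {} v"
            using s4(1) s5(1) by (simp add: pending_def settled_def)
          show ?case
          proof (rule wp_mono[OF wp_greedy_prog], goal_cases)
            case s6: (7 t6 s6)
            then show ?case using s1(1) s2(1) s3(1) s4(1) s5(1) by auto
          qed (use m5 c5 s3(1) s4(1) v4 v5 a3 z2 in auto)
        qed (use m4 in auto)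
      qed (use m3 a3 z2 in auto)
    qed (use m2 e2 in auto)
  qed (use m1 s1 z1 in auto)
qed (use m z in auto)

end

lemma wp_decision_prog:
  fixes n :: nat and G :: "nat pair_pre_digraph" and \<pi> :: "nat rel"
  assumes G: "pair_graph G" "split_graph G" "pverts G = {..<n}" and n: "0 < n"
    and po: "partial_order_on (pverts G) \<pi>" and adj: "adjacency_lists G adj"
    and ps: "distinct ps" "set ps = \<pi>"
  shows "wp decision_prog (input_state adj ps) (\<lambda>t s'. t \<le> 201 * (n * card \<pi>) \<and>
     vars s' ''answer'' = of_bool (\<exists>\<sigma>. lbfs_ordering G \<sigma> \<and> linear_extension (pverts G) \<pi> \<sigma>))"
proof -
  interpret pair_graph G by fact
  let ?A = "parcs G"
  have A: "?A \<subseteq> {..<n} \<times> {..<n}" "\<And>u v. (u, v) \<in> ?A \<Longrightarrow> (v, u) \<in> ?A" "\<And>u. (u, u) \<notin> ?A"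
  proof -
    show "?A \<subseteq> {..<n} \<times> {..<n}"
    proof
      fix e assume "e \<in> ?A"
      then show "e \<in> {..<n} \<times> {..<n}"
        using arc_fst_in_verts[of e] arc_snd_in_verts[of e] G(3) by (simp add: mem_Times_iff)
    qed
    show "(v, u) \<in> ?A" if "(u, v) \<in> ?A" for u v
      using pair_sym_arcs that by (simp add: symmetric_def sym_def)
    show "(u, u) \<notin> ?A" for u using pair_no_loops[of "(u, u)"] by auto
  qed
  have adj': "length adj = n"
    "\<And>v. v < n \<Longrightarrow> distinct (adj ! v) \<and> set (adj ! v) = {w. (v, w) \<in> ?A}"
    using adj G(3) by (auto simp: adjacency_lists_def)
  have \<pi>: "\<pi> \<subseteq> {..<n} \<times> {..<n}" "\<And>v. v < n \<Longrightarrow> (v, v) \<in> \<pi>"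
    using po G(3) by (auto simp: partial_order_on_def preorder_on_def refl_on_def)
  have p: "length ps = card \<pi>" using distinct_card[OF ps(1)] ps(2) by simp
  have "card ((\<lambda>v. (v, v)) ` {..<n}) \<le> card \<pi>"
    using \<pi> finite_subset[OF \<pi>(1)] by (intro card_mono) auto
  then have np: "n \<le> card \<pi>" by (simp add: card_image inj_on_def)
  have sp: "\<exists>K. split_partition {..<n} ?A K"
  proof -
    obtain K I where KI: "K \<union> I = {..<n}" "is_clique G K" "is_independent G I"
      using G(2,3) unfolding split_graph_def by auto
    note KI(1,2)
    moreover have "u \<in> K \<or> v \<in> K" if uv: "(u, v) \<in> ?A" for u v
    proof -
      have "u \<in> K \<union> I" "v \<in> K \<union> I" using KI(1) A(1) uv by auto
      then show ?thesis using KI(3) uv unfolding is_independent_def by blast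
    qed
    ultimately have "split_partition {..<n} ?A K"
      unfolding split_partition_def is_clique_def by blast
    then show ?thesis ..
  qed
  have s0: "vars (input_state adj ps) ''n'' = n" "vars (input_state adj ps) ''p'' = length ps"
    "arrays (input_state adj ps) ''off'' = list_array (map (\<lambda>v. length (concat (take v adj))) [0..<length adj + 1])"
    "arrays (input_state adj ps) ''nbr'' = list_array (concat adj)"
    "arrays (input_state adj ps) ''fst'' = list_array (map fst ps)"
    "arrays (input_state adj ps) ''snd'' = list_array (map snd ps)"
    "\<And>a. a \<notin> {''off'', ''nbr'', ''fst'', ''snd''} \<Longrightarrow> arrays (input_state adj ps) a = (\<lambda>_. 0)"
    by (simp_all add: input_state_def adj'(1))
  show ?thesis
    unfolding decision_prog_def wp_Seq
  proof (rule wp_frame[OF wp_matrix_prog[where n = n and adj = adj and A = ?A]], goal_cases)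
    case s1: (8 t1 s1)
    have v1: "vars s1 ''n'' = n" "vars s1 ''p'' = length ps"
        "\<And>a. a \<notin> {''E'', ''deg''} \<Longrightarrow> arrays s1 a = arrays (input_state adj ps) a"
      using s1(2) s0 by (simp_all add: frame_def written_progs)
    show ?case
    proof (rule wp_frame[OF wp_relation_prog[where n = n and ps = ps]], goal_cases)
      case s2: (7 t2 s2)
      have v2: "vars s2 ''n'' = n" "vars s2 ''p'' = length ps"
          "\<And>a. a \<noteq> ''R'' \<Longrightarrow> arrays s2 a = arrays s1 a"
        using s2(2) v1 by (simp_all add: frame_def written_progs)
      show ?case
      proof (rule wp_frame[OF wp_split_prog[where n = n and A = ?A]], goal_cases)
        case s3: (10 t3 s3)
        then obtain K where K: "split_partition {..<n} ?A K" "arrays s3 ''K'' = (\<lambda>v. of_bool (v \<in> K))"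
          by blast
        have v3: "vars s3 ''n'' = n" "vars s3 ''p'' = length ps"
            "\<And>a. a \<notin> {''K'', ''done''} \<Longrightarrow> arrays s3 a = arrays s2 a"
          using s3(2) v2 by (simp_all add: frame_def written_progs)
        interpret split_program n ?A \<pi> K ps
          using A K(1) po G(3) ps(2) by unfold_locales (auto simp: split_partition_def)
        \<comment> \<open>The adjacency lists hold out-neighbours, \<open>nbs\<close> in-neighbours;
          symmetry identifies them.\<close>
        have deg: "card {w. (v, w) \<in> ?A} = dg v" for v
          using A(2) unfolding dg_def nbs_def by (intro arg_cong[of _ _ card]) blast
        have "mem s3"
          unfolding mem_def using v3 v2 v1 s0 K(2) s1(1) s2(1) ps(2) deg by simp
        then have "wp constraint_prog s3 (\<lambda>t s'. t \<le> length ps * (n * 6 + 12) + 2 + (length ps * 4 + 2) +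
      (n * (n * 4 + 4) + 3) + ((n + n) * ((n + n) * 5 + 4) + 2) + (length ps * (n * 4 + 7) + 2) +
      ((n + n) * ((n + n) * 9 + length ps * 6 + 13) + (4 * n + 4) * length ps + 2) \<and>
     vars s' ''answer'' = of_bool (unique_early \<and> (\<exists>\<rho>. admissible \<rho>)))"
        proof (rule wp_constraint_prog)
          fix a assume a: "a \<in> {''base'', ''early'', ''M'', ''D'', ''count'', ''placed'', ''settled''}"
          have "arrays s3 a = arrays s2 a" by (rule v3(3)) (use a in auto)
          also have "\<dots> = arrays s1 a" by (rule v2(3)) (use a in auto)
          also have "\<dots> = arrays (input_state adj ps) a" by (rule v1(3)) (use a in auto)
          also have "\<dots> = (\<lambda>_. 0)" by (rule s0(7)) (use a in auto)
          finally show "arrays s3 a = (\<lambda>_. 0)" .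
        qed
        then show ?case
        proof (rule wp_mono, goal_cases)
          case s4: (1 t4 s4)
          have "(\<exists>\<sigma>. lbfs_ordering G \<sigma> \<and> linear_extension (pverts G) \<pi> \<sigma>) \<longleftrightarrow>
              unique_early \<and> (\<exists>\<rho>. admissible \<rho>)"
            unfolding lbfs_extension_iff[symmetric] lbfs_ordering_iff[OF pair_finite_verts] G(3) by auto
          moreover have "t1 + (t2 + (t3 + t4)) \<le> 201 * (n * card \<pi>)"
          proof -
            let ?p = "length ps"
            \<comment> \<open>Every monomial in the four bounds is at most \<open>n * ?p\<close>, so
              the constant is the sum of the coefficients: 11 + 5 + 21 + 164 = 201.\<close>
            have "n * n \<le> n * ?p" "n \<le> n * ?p" "?p \<le> n * ?p" "1 \<le> n * ?p" using n np p by auto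
            moreover have "t1 \<le> 3 * (n * n) + 6 * n + 2" using s1(1) by (simp add: algebra_simps)
            moreover have "t2 \<le> 3 * ?p + 2" using s2(1) by simp
            moreover have "t3 \<le> 9 * (n * n) + 10 * n + 2" using s3(1) by (simp add: algebra_simps)
            moreover have "t4 \<le> 26 * (n * ?p) + 27 * ?p + 60 * (n * n) + 38 * n + 13"
              using s4 by (simp add: algebra_simps)
            ultimately show ?thesis unfolding p by linarith
          qed
          ultimately show ?case using s4 by simp
        qed
      qed (use v1 v2 s0 s1 A sp in auto)
    qed (use v1 s0 \<pi> ps in auto)
  qed (use s0 adj' A in auto)
qed

lemma slow_decision_prog: "slow_com decision_prog"
  by (simp add: decision_prog_def constraint_prog_def prog_defs For_def)

text \<open>Offsets count arcs and \<open>length ps\<close> counts pairs, both at most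
  \<open>n * n\<close>; every other input number is at most \<open>n\<close>.\<close>

lemma values_le_input:
  assumes "length adj = n" "length ps \<le> n * n" "set ps \<subseteq> {..<n} \<times> {..<n}"
    and "\<And>v. v < n \<Longrightarrow> distinct (adj ! v) \<and> set (adj ! v) \<subseteq> {..<n}"
  shows "values_le (n * n) (input_state adj ps)"
proof -
  have n: "n \<le> n * n" by (cases n) auto
  have len: "length xs \<le> n" if "xs \<in> set adj" for xs
  proof -
    have "distinct xs" "set xs \<subseteq> {..<n}" using assms(1,4) that by (auto simp: in_set_conv_nth)
    then show ?thesis using card_mono[of "{..<n}" "set xs"] distinct_card[of xs] by simp
  qed
  have concat_le: "length (concat xss) \<le> length xss * n" if "set xss \<subseteq> set adj" for xss
    using that len by (induction xss) (auto intro: add_mono)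
  have off: "length (concat (take v adj)) \<le> n * n" for v
  proof -
    have "length (concat (take v adj)) \<le> length (take v adj) * n"
      by (rule concat_le) (rule set_take_subset)
    also have "\<dots> \<le> n * n" using assms(1) by (intro mult_le_mono1) simp
    finally show ?thesis .
  qed
  have arr: "list_array xs i \<le> n * n" if "\<And>x. x \<in> set xs \<Longrightarrow> x \<le> n * n" for xs i
    using that by (simp add: list_array_def)
  have small: "x \<le> n * n" if "x < n" for x using that n by linarith
  have "x < n" if x: "x \<in> set (concat adj)" for x
  proof -
    obtain v where "v < n" "x \<in> set (adj ! v)"
      using x assms(1) by (auto simp: in_set_conv_nth[of _ adj])
    then show ?thesis using assms(4) by blast
  qed
  moreover have "x < n" if "x \<in> set (map fst ps) \<union> set (map snd ps)" for x
    using that assms(3) by auto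
  ultimately have "arrays (input_state adj ps) a i \<le> n * n" for a i
  proof -
    assume "\<And>x. x \<in> set (concat adj) \<Longrightarrow> x < n"
      and "\<And>x. x \<in> set (map fst ps) \<union> set (map snd ps) \<Longrightarrow> x < n"
    then have "list_array (concat adj) i \<le> n * n" "list_array (map fst ps) i \<le> n * n"
        "list_array (map snd ps) i \<le> n * n"
      using small by (intro arr; blast)+
    moreover have "list_array (map (\<lambda>v. length (concat (take v adj))) [0..<length adj + 1]) i \<le> n * n"
      by (rule arr) (use off off[of "length adj"] in auto)
    ultimately show ?thesis unfolding input_state_def by (simp del: upt_Suc)
  qed
  then show ?thesis using assms(1,2) n by (simp add: values_le_def input_state_def)
qed

text \<open>Every summand is a multiple of (n + 2) ^ 3, with C + 4 multiples in all. As n + 2 is at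
  least 2, this factor is absorbed by (n + 2) ^ (C + 4).\<close>

lemma polynomial_bound:
  fixes n C w :: nat
  assumes "t \<le> C * (n * (n * n))"
  shows "(n * n + 1 + t + 2) ^ w \<le> (n + 2) ^ ((C + 7) * w)"
proof -
  let ?X = "(n + 2) ^ 3"
  have "n * n \<le> ?X" "n * (n * n) \<le> ?X" "1 \<le> ?X"
    by (simp_all add: power3_eq_cube algebra_simps)
  then have "n * n + 1 + t + 2 \<le> ?X + 1 * ?X + C * ?X + 2 * ?X"
    using assms by (intro add_mono) (auto intro: order_trans[OF assms])
  also have "\<dots> = (C + 4) * ?X" by (simp add: algebra_simps)
  also have "\<dots> \<le> (n + 2) ^ (C + 4) * ?X"
  proof (rule mult_le_mono1)
    have "C + 4 \<le> 2 ^ (C + 4)" using less_exp[of "C + 4"] by simp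
    also have "\<dots> \<le> (n + 2) ^ (C + 4)" by (intro power_mono) auto
    finally show "C + 4 \<le> (n + 2) ^ (C + 4)" .
  qed
  also have "\<dots> = (n + 2) ^ (C + 7)" by (simp add: power_add[symmetric])
  finally show ?thesis by (simp add: power_mono power_mult)
qed

theorem theorem5:
  "\<exists>(P :: com) (C :: nat) (k :: nat).
     \<forall>(n :: nat) (G :: nat pair_pre_digraph) (\<pi> :: nat rel)
       (adj :: nat list list) (ps :: (nat \<times> nat) list).
       pair_graph G \<and> connected (with_proj G) \<and> split_graph G \<and> pverts G = {..<n} \<and>
       partial_order_on (pverts G) \<pi> \<and>
       adjacency_lists G adj \<and> distinct ps \<and> set ps = \<pi>
       \<longrightarrow> decides_within ((n + 2) ^ k) P (input_state adj ps) (C * (n * card \<pi>))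
             (\<exists>\<sigma>. lbfs_ordering G \<sigma> \<and> linear_extension (pverts G) \<pi> \<sigma>)"
proof (rule exI[of _ decision_prog], rule exI[of _ 201],
    rule exI[of _ "(201 + 7) * cwidth decision_prog"], intro allI impI, elim conjE)
  fix n :: nat and G :: "nat pair_pre_digraph" and \<pi> :: "nat rel"
    and adj :: "nat list list" and ps :: "(nat \<times> nat) list"
  assume G: "pair_graph G" "connected (with_proj G)" "split_graph G" "pverts G = {..<n}"
    and po: "partial_order_on (pverts G) \<pi>" and adj: "adjacency_lists G adj"
    and ps: "distinct ps" "set ps = \<pi>"
  interpret pair_graph G by fact
  \<comment> \<open>Connectedness includes the existence of a vertex; then
    \<open>n * card \<pi>\<close> is at least 1 and absorbs additive constants.\<close>
  have n: "0 < n"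
    using G(2,4) by (auto simp: connected_def strongly_connected_def)
  have \<pi>: "\<pi> \<subseteq> {..<n} \<times> {..<n}"
    using po G(4) by (auto simp: partial_order_on_def preorder_on_def refl_on_def)
  then have "card \<pi> \<le> card ({..<n} \<times> {..<n})" by (intro card_mono) auto
  then have card: "card \<pi> \<le> n * n" by simp
  have "wp decision_prog (input_state adj ps) (\<lambda>t s'. t \<le> 201 * (n * card \<pi>) \<and>
     vars s' ''answer'' = of_bool (\<exists>\<sigma>. lbfs_ordering G \<sigma> \<and> linear_extension (pverts G) \<pi> \<sigma>))"
    by (rule wp_decision_prog[OF G(1,3,4) n po adj ps])
  then obtain t s' B where r: "runs B decision_prog (input_state adj ps) t s'" and t: "t \<le> 201 * (n * card \<pi>)"
    and ans: "vars s' ''answer'' = of_bool (\<exists>\<sigma>. lbfs_ordering G \<sigma> \<and> linear_extension (pverts G) \<pi> \<sigma>)"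
    unfolding wp_def by blast
  have "values_le (n * n) (input_state adj ps)"
  proof (rule values_le_input)
    show "length ps \<le> n * n" using card distinct_card[OF ps(1)] ps(2) by simp
    show "distinct (adj ! v) \<and> set (adj ! v) \<subseteq> {..<n}" if "v < n" for v
      using adj that arc_snd_in_verts G(4) by (fastforce simp: adjacency_lists_def)
  qed (use adj G(4) \<pi> ps in \<open>auto simp: adjacency_lists_def\<close>)
  \<comment> \<open>The \<open>+ 1\<close> meets the demand of \<open>runs_word_bound\<close> for a
    bound of at least 1, the largest constant the program stores.\<close>
  then have v: "values_le (n * n + 1) (input_state adj ps)" by (rule values_le_mono) simp
  have "t \<le> 201 * (n * (n * n))" using t card by (meson mult_le_mono2 order_trans)
  from polynomial_bound[OF this]
  have "runs ((n + 2) ^ ((201 + 7) * cwidth decision_prog)) decision_prog (input_state adj ps) t s'"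
    using runs_word_bound[OF r slow_decision_prog v] by simp
  with t ans[unfolded of_bool_def] show "decides_within ((n + 2) ^ ((201 + 7) * cwidth decision_prog)) decision_prog
      (input_state adj ps) (201 * (n * card \<pi>))
      (\<exists>\<sigma>. lbfs_ordering G \<sigma> \<and> linear_extension (pverts G) \<pi> \<sigma>)"
    unfolding decides_within_def by blast
qed

end
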